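(* Let $G=(V,E)$ be an unrooted directed tree without leaves, with $E=\{e_i\}_{i\in I}$, and let $L(G)$ be the associated directed metric tree. (a) Let $\rho=(\rho_i)_{i\in I}$ be a $1$-admissible weight for $L(G)$. The following assertions are equivalent: (i) the left translation semigroup $\{T_t\}_{t\ge0}$ is hypercyclic on $L^1_\rho(L(G))$; (ii) the left translation semigroup is weakly mixing on $L^1_\rho(L(G))$; (iii) there exists an increasing sequence $(n_h)_{h\in\mathbb{N}}$ of natural numbers such that for all $i\in I$ $$\lim_{h\to\infty}\ \inf_{s\in[0,1)}\ \inf_{j\in M_{n_h}(i)}\rho_j(s)=0$$ and $$\lim_{h\to\infty}\ \inf_{s\in[0,1)}\ \min\left\{\rho_{K_{n_h}(i)}(s),\ \inf_{j\in M_{n_h}(K_{n_h}(i))}\rho_j(s)\right\}=0.$$ (b) Let $1<p<\infty$ and let $\rho=(\rho_i)_{i\in I}$ be a $p$-admissible weight for $L(G)$. The following assertions are equivalent: (i) the left translation semigroup $\{T_t\}_{t\ge0}$ is hypercyclic on $L^p_\rho(L(G))$; (ii) the left translation semigroup is weakly mixing on $L^p_\rho(L(G))$; (iii) there exists an increasing sequence $(n_h)_{h\in\mathbb{N}}$ of natural numbers such that for all $i\in I$ $$\lim_{h\to\infty}\ \sup_{s\in[0,1)}\left(\sum_{j\in M_{n_h}(i)}\frac{1}{\rho_j(s)^{1/(p-1)}}\right)=\infty$$ and $$\lim_{h\to\infty}\ \sup_{s\in[0,1)}\left(\frac{1}{\rho_{K_{n_h}(i)}(s)^{1/(p-1)}}+\sum_{j\in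 M_{n_h}(K_{n_h}(i))}\frac{1}{\rho_j(s)^{1/(p-1)}}\right)=\infty.$$
   Context: **Directed tree.** A directed tree $G=(V,E)$ consists of a countable vertex set $V$ and a set $E\subset (V\times V)\setminus\{(v,v):v\in V\}$ of directed edges such that: the graph is connected (any two distinct vertices are joined by a finite path, ignoring orientation of edges); there are no closed directed cycles; and each vertex $v$ has at most one parent, i.e. at most one $w\in V$ with $(w,v)\in E$ (then $v$ is a child of $w$). For an edge $e=(v,w)$, $v$ is the tail and $w$ the head. A leaf is a vertex without children. The tree is rooted if there is a vertex (the root) that is not the head of any edge, and unrooted otherwise. **Directed metric tree.** $L(G)$ is obtained by identifying each edge with $[0,1)$, with coordinate increasing in the direction of the edge. Write $E=\{e_i\}_{i\in I}$ and let $\mathcal{A}=(\mathcal{A}_{ij})_{i,j\in I}$ be given by $\mathcal{A}_{ij}=1$ if the head of $e_i$ is the tail of $e_j$, and $\mathcal{A}_{ij}=0$ otherwise. Put $M_0(i)=\{i\}$ and, for $n\ge 1$, $M_n(i)=\{j\in I:(\mathcal{A}^n)_{ij}\ne 0\}$, i.e. the set of indices $j$ such that $e_j$ is reached from $e_i$ in $n$ steps along the direction of the edges. (Since each column of $\mathcal{A}$ has at most one nonzero entry, $(\mathcal{A}^n)_{ij}\in\{0,1\}$.) For $G$ unrooted, $j\in I$ and $n\in\mathbb{N}$, $K_n(j)\in I$ denotes the index of the unique edge such that $j\in M_n(K_n(j))$ (the $n$-th ancestor edge of $e_j$). **Spaces.** A weight on $L(G)$ is a family $\rho=(\rho_i)_{i\in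 I}$ of functions $\rho_i:[0,1)\to\mathbb{R}$ with $\rho_i\in L^1((0,1))$ and $\rho_i>0$ a.e. A function $f$ on $L(G)$ is identified with the family $(f_i)_{i\in I}$ of its restrictions to edges, $f_i:[0,1)\to\mathbb{K}$, $\mathbb{K}=\mathbb{R}$ or $\mathbb{C}$. For $1\le p<\infty$, $L^p_\rho(L(G))$ is the Banach space of all (a.e. classes of) families $f=(f_i)_{i\in I}$ of measurable functions with $\|f\|_{p,\rho}=\big(\sum_{i\in I}\int_0^1|f_i(s)|^p\rho_i(s)\,ds\big)^{1/p}<\infty$. **Left translation semigroup.** For $s\in[0,1)$, $t\ge0$, let $n(t,s)$ be the integer part of $s+t$. For $f=(f_i)_{i\in I}$, $t\ge 0$, $$(T_tf)_i(s)=\sum_{j\in M_{n(t,s)}(i)}(\mathcal{A}^{n(t,s)})_{ij}\,f_j\big(t+s-n(t,s)\big),\qquad i\in I,\ s\in[0,1).$$ **Admissible weights.** A weight $\rho$ with $\rho_i(s)>0$ for every $i\in I$ and every $s\in[0,1)$ is $p$-admissible for $L(G)$ if there exist $M\ge1$ and $w\in\mathbb{R}$ such that for all $i\in I$, $s\in[0,1)$, $t\ge0$: $$\rho_i(s)\le Me^{wt}\inf_{j\in M_{n(t,s)}(i)}\rho_j(s+t-n(t,s))\quad\text{if }p=1,$$ $$\Big(\sum_{j\in M_{n(t,s)}(i)}\rho_j(s+t-n(t,s))^{-1/(p-1)}\Big)^{p-1}\le M^pe^{pwt}\frac1{\rho_i(s)}\quad\text{if }1<p<\infty.$$ For a $p$-admissible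 weight, $\{T_t\}_{t\ge0}$ is a strongly continuous semigroup on $L^p_\rho(L(G))$. **Dynamics.** A strongly continuous semigroup $\{T_t\}_{t\ge0}$ on a separable Banach space $X$ is hypercyclic if there is $x\in X$ with $\{T_tx:t\ge0\}$ dense in $X$; it is topologically transitive if for all nonempty open $U,V\subset X$ there is $t_0\ge0$ with $T_{t_0}(U)\cap V\ne\emptyset$; it is weakly mixing if $(T_t\oplus T_t)_{t\ge0}$, $(T_t\oplus T_t)(x,y)=(T_tx,T_ty)$, is topologically transitive on $X\times X$. *)

theory Defs
  imports "HOL-Analysis.Analysis"
begin

section \<open>Directed trees\<close>

locale directed_tree =
  fixes V :: "'v set" and E :: "('v \<times> 'v) set"
  assumes countable_vertices: "countable V"
    and edges: "E \<subseteq> V \<times> V - Id"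
    and connected: "\<And>v w. \<lbrakk>v \<in> V; w \<in> V\<rbrakk> \<Longrightarrow> (v, w) \<in> (E \<union> E\<inverse>)\<^sup>*"
    and no_cycles: "acyclic E"
    and parent_unique: "\<And>u w v. \<lbrakk>(u, v) \<in> E; (w, v) \<in> E\<rbrakk> \<Longrightarrow> u = w"

definition unrooted :: "'v set \<Rightarrow> ('v \<times> 'v) set \<Rightarrow> bool" where
  "unrooted V E \<longleftrightarrow> \<not> (\<exists>r\<in>V. \<forall>u. (u, r) \<notin> E)"

definition leafless :: "'v set \<Rightarrow> ('v \<times> 'v) set \<Rightarrow> bool" where
  "leafless V E \<longleftrightarrow> \<not> (\<exists>v\<in>V. \<forall>w. (v, w) \<notin> E)"

section \<open>The adjacency matrix of the edges\<close>

text \<open>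
  The edges are enumerated by a bijection \<open>e\<close> from an index set \<open>I\<close> onto the edge set;
  an edge \<open>(v, w)\<close> has tail \<open>v\<close> and head \<open>w\<close>.
\<close>

definition adj :: "('i \<Rightarrow> 'v \<times> 'v) \<Rightarrow> 'i \<Rightarrow> 'i \<Rightarrow> nat" where
  "adj e i j = (if snd (e i) = fst (e j) then 1 else 0)"

text \<open>
  Powers of a possibly infinite matrix. In a directed tree each column of the adjacency matrix
  has at most one nonzero entry, so the sums below have at most one nonzero term.
\<close>

primrec adj_pow :: "'i set \<Rightarrow> ('i \<Rightarrow> 'v \<times> 'v) \<Rightarrow> nat \<Rightarrow> 'i \<Rightarrow> 'i \<Rightarrow> nat" where
  "adj_pow I e 0 i j = (if i = j then 1 else 0)"
| "adj_pow I e (Suc n) i j = (\<Sum>\<^sub>\<infinity>k\<in>I. adj_pow I e n i k * adj e k j)"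

definition descendants :: "'i set \<Rightarrow> ('i \<Rightarrow> 'v \<times> 'v) \<Rightarrow> nat \<Rightarrow> 'i \<Rightarrow> 'i set" where
  "descendants I e n i = {j \<in> I. adj_pow I e n i j \<noteq> 0}"

definition ancestor :: "'i set \<Rightarrow> ('i \<Rightarrow> 'v \<times> 'v) \<Rightarrow> nat \<Rightarrow> 'i \<Rightarrow> 'i" where
  "ancestor I e n j = (THE k. k \<in> I \<and> j \<in> descendants I e n k)"

section \<open>Weighted spaces of p-integrable functions on the metric tree\<close>

text \<open>
  A function on the metric tree is a family \<open>f i s\<close> with \<open>i \<in> I\<close> and \<open>s \<in> [0, 1)\<close>; the values of
  \<open>f\<close> for other arguments are irrelevant, and are identified by \<open>Lp_rel\<close> below.
\<close>

type_synonym ('i, 'k) edge_fun = "'i \<Rightarrow> real \<Rightarrow> 'k"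

abbreviation edge_measure :: "real measure" where
  "edge_measure \<equiv> lebesgue_on {0..<1}"

definition weight :: "'i set \<Rightarrow> ('i, real) edge_fun \<Rightarrow> bool" where
  "weight I \<rho> \<longleftrightarrow>
     (\<forall>i\<in>I. integrable edge_measure (\<rho> i) \<and> (AE s in edge_measure. 0 < \<rho> i s))"

definition Lp_sum ::
  "'i set \<Rightarrow> ('i, real) edge_fun \<Rightarrow> real \<Rightarrow> ('i, 'k::real_normed_vector) edge_fun \<Rightarrow> ennreal" where
  "Lp_sum I \<rho> p f =
     (\<Sum>\<^sub>\<infinity>i\<in>I. \<integral>\<^sup>+s. ennreal (norm (f i s) powr p * \<rho> i s) \<partial>edge_measure)"

definition Lp_norm ::
  "'i set \<Rightarrow> ('i, real) edge_fun \<Rightarrow> real \<Rightarrow> ('i, 'k::real_normed_vector) edge_fun \<Rightarrow> real" where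
  "Lp_norm I \<rho> p f = enn2real (Lp_sum I \<rho> p f) powr (1 / p)"

definition Lp_fun ::
  "'i set \<Rightarrow> ('i, real) edge_fun \<Rightarrow> real \<Rightarrow> ('i, 'k::real_normed_vector) edge_fun set" where
  "Lp_fun I \<rho> p =
     {f. (\<forall>i\<in>I. f i \<in> borel_measurable edge_measure) \<and> Lp_sum I \<rho> p f < \<infinity>}"

definition Lp_rel ::
  "'i set \<Rightarrow> ('i, real) edge_fun \<Rightarrow> real \<Rightarrow>
     (('i, 'k::real_normed_vector) edge_fun \<times> ('i, 'k) edge_fun) set" where
  "Lp_rel I \<rho> p =
     {(f, g). f \<in> Lp_fun I \<rho> p \<and> g \<in> Lp_fun I \<rho> p \<and>
        (\<forall>i\<in>I. AE s in edge_measure. f i s = g i s)}"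

definition Lp_space ::
  "'i set \<Rightarrow> ('i, real) edge_fun \<Rightarrow> real \<Rightarrow> ('i, 'k::real_normed_vector) edge_fun set set" where
  "Lp_space I \<rho> p = Lp_fun I \<rho> p // Lp_rel I \<rho> p"

definition Lp_repr :: "('i, 'k) edge_fun set \<Rightarrow> ('i, 'k) edge_fun" where
  "Lp_repr C = (SOME f. f \<in> C)"

definition Lp_dist ::
  "'i set \<Rightarrow> ('i, real) edge_fun \<Rightarrow> real \<Rightarrow>
     ('i, 'k::real_normed_vector) edge_fun set \<Rightarrow> ('i, 'k) edge_fun set \<Rightarrow> real" where
  "Lp_dist I \<rho> p C D = Lp_norm I \<rho> p (\<lambda>i s. Lp_repr C i s - Lp_repr D i s)"

definition Lp_topology ::
  "'i set \<Rightarrow> ('i, real) edge_fun \<Rightarrow> real \<Rightarrow>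
     ('i, 'k::real_normed_vector) edge_fun set topology" where
  "Lp_topology I \<rho> p = Metric_space.mtopology (Lp_space I \<rho> p) (Lp_dist I \<rho> p)"

section \<open>Admissible weights and the left translation semigroup\<close>

abbreviation steps :: "real \<Rightarrow> real \<Rightarrow> nat" where
  "steps t s \<equiv> nat \<lfloor>s + t\<rfloor>"

text \<open>
  The infimum for \<open>p = 1\<close> is taken in \<open>[0, \<infinity>]\<close>, so that it is \<open>\<infinity>\<close> over the empty set. For
  \<open>1 < p\<close> the right-hand side is finite, so the inequality between elements of \<open>[0, \<infinity>]\<close> says
  that the family is summable and that the inequality holds between real numbers.
\<close>

definition admissible ::
  "'i set \<Rightarrow> ('i \<Rightarrow> 'v \<times> 'v) \<Rightarrow> real \<Rightarrow> ('i, real) edge_fun \<Rightarrow> bool" where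
  "admissible I e p \<rho> \<longleftrightarrow>
     1 \<le> p \<and> weight I \<rho> \<and> (\<forall>i\<in>I. \<forall>s\<in>{0..<1}. 0 < \<rho> i s) \<and>
     (\<exists>M\<ge>1. \<exists>w. \<forall>i\<in>I. \<forall>s\<in>{0..<1}. \<forall>t\<ge>0.
        let n = steps t s; D = descendants I e n i; r = s + t - real n in
          (p = 1 \<longrightarrow>
             ennreal (\<rho> i s) \<le> ennreal (M * exp (w * t)) * (INF j\<in>D. ennreal (\<rho> j r))) \<and>
          (1 < p \<longrightarrow>
             (\<lambda>j. \<rho> j r powr (- 1 / (p - 1))) summable_on D \<and>
             (\<Sum>\<^sub>\<infinity>j\<in>D. \<rho> j r powr (- 1 / (p - 1))) powr (p - 1)
               \<le> M powr p * exp (p * w * t) * (1 / \<rho> i s)))"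

definition translate ::
  "'i set \<Rightarrow> ('i \<Rightarrow> 'v \<times> 'v) \<Rightarrow> real \<Rightarrow>
     ('i, 'k::real_normed_field) edge_fun \<Rightarrow> ('i, 'k) edge_fun" where
  "translate I e t f = (\<lambda>i s.
     let n = steps t s in
       \<Sum>\<^sub>\<infinity>j\<in>descendants I e n i. of_nat (adj_pow I e n i j) * f j (t + s - real n))"

text \<open>
  The semigroup on classes. For an admissible weight the result does not depend on the
  representative, since every edge has at most countably many descendants.
\<close>

definition translation_semigroup ::
  "'i set \<Rightarrow> ('i \<Rightarrow> 'v \<times> 'v) \<Rightarrow> ('i, real) edge_fun \<Rightarrow> real \<Rightarrow> real \<Rightarrow>
     ('i, 'k::real_normed_field) edge_fun set \<Rightarrow> ('i, 'k) edge_fun set" where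
  "translation_semigroup I e \<rho> p t C = Lp_rel I \<rho> p `` {translate I e t (Lp_repr C)}"

section \<open>Dynamics of one-parameter families of maps\<close>

definition hypercyclic :: "'a topology \<Rightarrow> (real \<Rightarrow> 'a \<Rightarrow> 'a) \<Rightarrow> bool" where
  "hypercyclic X T \<longleftrightarrow>
     (\<exists>x\<in>topspace X. X closure_of ((\<lambda>t. T t x) ` {0..}) = topspace X)"

definition topologically_transitive :: "'a topology \<Rightarrow> (real \<Rightarrow> 'a \<Rightarrow> 'a) \<Rightarrow> bool" where
  "topologically_transitive X T \<longleftrightarrow>
     (\<forall>U W. openin X U \<and> U \<noteq> {} \<and> openin X W \<and> W \<noteq> {} \<longrightarrow> (\<exists>t\<ge>0. T t ` U \<inter> W \<noteq> {}))"

definition weakly_mixing :: "'a topology \<Rightarrow> (real \<Rightarrow> 'a \<Rightarrow> 'a) \<Rightarrow> bool" where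
  "weakly_mixing X T \<longleftrightarrow>
     topologically_transitive (prod_topology X X) (\<lambda>t (x, y). (T t x, T t y))"

end

theory Submission
  imports Defs
begin

text \<open>
  After \<open>n\<close> units of time the value of a translated function on an edge \<open>i\<close> is the sum of the
  original values over the descendants \<open>D n i\<close>. Everything therefore depends on how cheaply a unit
  mass on \<open>i\<close> can be produced by masses on \<open>D n i\<close>: at the point \<open>s\<close> of the edges, the price is the
  infimum of \<open>\<Sum>j\<in>D n i. \<bar>x j\<bar> powr p * \<rho> j s\<close> over all families with \<open>\<Sum>j\<in>D n i. x j = 1\<close>. It is
  the infimum of the weights for \<open>p = 1\<close>, and a power of the sum of \<open>1 / \<rho> j s powr (1 / (p - 1))\<close> for
  \<open>p > 1\<close>. Admissibility bounds the weight at a point by a multiple of the price over its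
  descendants, and the price occurs in the conditions on the weight too, so that the cases \<open>p = 1\<close>
  and \<open>p > 1\<close> have one proof, written with \<open>mass_cost_ge\<close>. The existence of the sequence
  becomes \<open>cheap_returns\<close>: for finitely many edges \<open>i\<close> and every \<open>c > 0\<close> there are arbitrarily
  large \<open>n\<close> such that the price of \<open>i\<close> is below \<open>c\<close> at some point, and, for the \<open>n\<close>-th ancestor \<open>k\<close> of
  \<open>i\<close>, the weight on \<open>k\<close> or the price of \<open>k\<close> is below \<open>c\<close> at some point.

  The condition suffices. By admissibility a low price at one point of an edge gives a low price
  along its whole parent edge, so the condition for a child of \<open>i\<close> yields uniform bounds for \<open>i\<close>
  (\<open>cheap_child_imp_uniformly_cheap\<close>). Let \<open>u\<close> and \<open>v\<close> be bounded with finite support. To move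
  from near \<open>u\<close> to near \<open>v\<close> in time \<open>n\<close>, add to \<open>u\<close> a cheap preimage of \<open>v\<close>. The translate of
  \<open>u\<close> itself lives on ancestors: where their weight is small it can be neglected, and elsewhere it
  is cancelled by another cheap preimage (\<open>uniformly_cheap_connects\<close>). Since \<open>n\<close> does not depend on
  \<open>u\<close> and \<open>v\<close>, this gives weak mixing. Weak mixing implies hypercyclicity by the Baire category
  theorem, as the space is complete and separable (\<open>transitive_imp_hypercyclic\<close>).

  The condition is necessary. Suppose that there is a dense orbit. The translations have dense
  range, so the tails of the orbit are dense too, and for the indicator \<open>\<phi>\<close> of a finite set of
  edges there are functions near \<open>\<phi>\<close> that come back near \<open>\<phi>\<close> at arbitrarily large times. At such
  times the translate of \<open>\<phi>\<close> vanishes on half of each edge of the set, and it is at least \<open>1\<close> on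
  half of the ancestor, where \<open>\<phi>\<close> vanishes. The small perturbation of \<open>\<phi>\<close> has to make up for the
  difference, which is possible only if the price, or the weight of the ancestor, is small
  (\<open>return_obstruction\<close>, \<open>dense_orbit_imp_cheap_returns\<close>).
\<close>

section \<open>Sums over countable sets\<close>

lemma infsum_ennreal_eq_SUP:
  "(\<Sum>\<^sub>\<infinity>x\<in>A. f x :: ennreal) = (SUP F\<in>{F. finite F \<and> F \<subseteq> A}. sum f F)"
  by (rule nonneg_infsum_complete) simp

lemma sum_le_infsum_ennreal:
  "finite F \<Longrightarrow> F \<subseteq> A \<Longrightarrow> sum f F \<le> (\<Sum>\<^sub>\<infinity>x\<in>A. f x :: ennreal)"
  unfolding infsum_ennreal_eq_SUP by (rule SUP_upper) simp

lemma infsum_ennreal_mono: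
  fixes f g :: "'a \<Rightarrow> ennreal"
  shows "(\<And>x. x \<in> A \<Longrightarrow> f x \<le> g x) \<Longrightarrow> (\<Sum>\<^sub>\<infinity>x\<in>A. f x) \<le> (\<Sum>\<^sub>\<infinity>x\<in>A. g x)"
  by (rule infsum_mono) (auto intro: nonneg_summable_on_complete)

lemma infsum_ennreal_mono_set:
  fixes f :: "'a \<Rightarrow> ennreal"
  shows "A \<subseteq> B \<Longrightarrow> (\<Sum>\<^sub>\<infinity>x\<in>A. f x) \<le> (\<Sum>\<^sub>\<infinity>x\<in>B. f x)"
  by (rule infsum_mono_neutral) (auto intro: nonneg_summable_on_complete)

lemma le_infsum_ennreal: "x \<in> A \<Longrightarrow> f x \<le> (\<Sum>\<^sub>\<infinity>x\<in>A. f x :: ennreal)"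
  using sum_le_infsum_ennreal[of "{x}" A f] by simp

lemma infsum_ennreal_eq_nn_integral:
  fixes f :: "'a \<Rightarrow> ennreal"
  assumes "countable A"
  shows "(\<Sum>\<^sub>\<infinity>x\<in>A. f x) = (\<integral>\<^sup>+x. f x \<partial>count_space A)"
proof (cases "finite A")
  case True
  then show ?thesis
    by (simp add: nn_integral_count_space_finite)
next
  case False
  have bij: "bij_betw (from_nat_into A) UNIV A"
    using assms False by (rule bij_betw_from_nat_into)
  let ?g = "\<lambda>n. f (from_nat_into A n)"
  have "(\<Sum>\<^sub>\<infinity>x\<in>A. f x) = (\<Sum>\<^sub>\<infinity>n. ?g n)"
    by (rule infsum_reindex_bij_betw[OF bij, symmetric])
  also have "\<dots> = (\<Sum>n. ?g n)"
  proof (rule antisym)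
    show "(\<Sum>\<^sub>\<infinity>n. ?g n) \<le> (\<Sum>n. ?g n)"
      unfolding infsum_ennreal_eq_SUP by (rule SUP_least) (auto intro: sum_le_suminf)
    show "(\<Sum>n. ?g n) \<le> (\<Sum>\<^sub>\<infinity>n. ?g n)"
      unfolding suminf_eq_SUP by (rule SUP_least) (auto intro: sum_le_infsum_ennreal)
  qed
  also have "\<dots> = (\<integral>\<^sup>+n. ?g n \<partial>count_space UNIV)"
    by (simp add: nn_integral_count_space_nat)
  also have "\<dots> = (\<integral>\<^sup>+x. f x \<partial>count_space A)"
    by (rule nn_integral_bij_count_space[OF bij])
  finally show ?thesis .
qed

lemma infsum_cmult_ennreal:
  fixes f :: "'a \<Rightarrow> ennreal"
  assumes "countable A"
  shows "(\<Sum>\<^sub>\<infinity>x\<in>A. c * f x) = c * (\<Sum>\<^sub>\<infinity>x\<in>A. f x)"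
  using assms by (simp add: infsum_ennreal_eq_nn_integral nn_integral_cmult)

lemma nn_integral_infsum:
  fixes f :: "'i \<Rightarrow> 'a \<Rightarrow> ennreal"
  assumes "countable A" "\<And>i. i \<in> A \<Longrightarrow> f i \<in> borel_measurable M"
  shows "(\<integral>\<^sup>+x. (\<Sum>\<^sub>\<infinity>i\<in>A. f i x) \<partial>M) = (\<Sum>\<^sub>\<infinity>i\<in>A. \<integral>\<^sup>+x. f i x \<partial>M)"
  using nn_integral_count_space_nn_integral[OF assms] assms(1)
  by (simp add: infsum_ennreal_eq_nn_integral)

lemma infsum_swap_ennreal:
  fixes f :: "'i \<Rightarrow> 'j \<Rightarrow> ennreal"
  assumes "countable A" "countable B"
  shows "(\<Sum>\<^sub>\<infinity>i\<in>A. \<Sum>\<^sub>\<infinity>j\<in>B. f i j) = (\<Sum>\<^sub>\<infinity>j\<in>B. \<Sum>\<^sub>\<infinity>i\<in>A. f i j)"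
  using nn_integral_infsum[OF assms(2), of "\<lambda>j i. f i j" "count_space A"] assms
  by (simp add: infsum_ennreal_eq_nn_integral)

lemma borel_measurable_infsum_ennreal:
  fixes f :: "'i \<Rightarrow> 'a \<Rightarrow> ennreal"
  assumes A: "countable A" and [measurable]: "\<And>i. i \<in> A \<Longrightarrow> f i \<in> borel_measurable M"
  shows "(\<lambda>x. \<Sum>\<^sub>\<infinity>i\<in>A. f i x) \<in> borel_measurable M"
proof -
  interpret sigma_finite_measure "count_space A"
    using A by (rule sigma_finite_measure_count_space_countable)
  have "(\<lambda>(x, i). f i x) \<in> borel_measurable (M \<Otimes>\<^sub>M count_space A)"
    unfolding split_beta
    by (rule measurable_compose_countable'[where f = "\<lambda>i z. f i (fst z)" and g = snd and I = A])
      (use A in \<open>auto intro: measurable_compose[OF measurable_fst assms(2)]\<close>)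
  then have "(\<lambda>x. \<integral>\<^sup>+i. f i x \<partial>count_space A) \<in> borel_measurable M"
    by (rule borel_measurable_nn_integral)
  then show ?thesis
    using A by (simp add: infsum_ennreal_eq_nn_integral)
qed

lemma ennreal_infsum:
  fixes f :: "'a \<Rightarrow> real"
  assumes "f summable_on A" "\<And>x. x \<in> A \<Longrightarrow> 0 \<le> f x"
  shows "ennreal (infsum f A) = (\<Sum>\<^sub>\<infinity>x\<in>A. ennreal (f x))"
proof -
  have "ennreal (infsum f A) = (SUP F\<in>{F. finite F \<and> F \<subseteq> A}. ennreal (sum f F))"
    by (rule infsum_nonneg_is_SUPREMUM_ennreal[OF assms])
  also have "\<dots> = (SUP F\<in>{F. finite F \<and> F \<subseteq> A}. \<Sum>x\<in>F. ennreal (f x))"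
    by (rule arg_cong[where f = Sup], rule image_cong[OF refl], subst sum_ennreal)
      (use assms(2) in auto)
  finally show ?thesis
    unfolding infsum_ennreal_eq_SUP .
qed

lemma summable_on_if_infsum_ennreal_finite:
  assumes "(\<Sum>\<^sub>\<infinity>x\<in>A. ennreal (f x)) < \<infinity>" "\<And>x. x \<in> A \<Longrightarrow> 0 \<le> f x"
  shows "f summable_on A"
proof -
  obtain r where r: "0 \<le> r" "(\<Sum>\<^sub>\<infinity>x\<in>A. ennreal (f x)) = ennreal r"
    using assms(1) by (metis ennreal_cases infinity_ennreal_def less_irrefl)
  have "sum f F \<le> r" if "finite F" "F \<subseteq> A" for F
  proof -
    have "ennreal (sum f F) = (\<Sum>x\<in>F. ennreal (f x))"
      using that assms(2) by (subst sum_ennreal) auto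
    also have "\<dots> \<le> ennreal r"
      using sum_le_infsum_ennreal[OF that, of "\<lambda>x. ennreal (f x)"] r by simp
    finally show ?thesis using r by simp
  qed
  then show ?thesis
    using assms(2) by (intro nonneg_bdd_above_summable_on) (auto simp: bdd_above_def)
qed

lemma summable_on_imp_abs_summable_on:
  fixes f :: "'a \<Rightarrow> 'k::euclidean_space"
  assumes "f summable_on A"
  shows "(\<lambda>x. norm (f x)) summable_on A"
proof (rule Infinite_Sum.abs_summable_on_comparison_test')
  have comp: "(\<lambda>x. norm (f x \<bullet> b)) summable_on A" for b
  proof -
    have "(\<lambda>x. f x \<bullet> b) summable_on A"
      using summable_on_bounded_linear[OF bounded_linear_inner_left assms] by (simp add: o_def)
    then show ?thesis
      by (rule summable_on_iff_abs_summable_on_real[THEN iffD1])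
  qed
  have "(\<lambda>x. \<Sum>b\<in>B. norm (f x \<bullet> b)) summable_on A" if "finite B" for B
    using that by (induction B rule: finite_induct) (use comp in \<open>auto intro: summable_on_add\<close>)
  then show "(\<lambda>x. \<Sum>b\<in>Basis. norm (f x \<bullet> b)) summable_on A"
    by simp
  show "norm (f x) \<le> (\<Sum>b\<in>Basis. norm (f x \<bullet> b))" for x
    using norm_le_l1[of "f x"] by simp
qed

text \<open>
  Both sides vanish when the family is not summable. The equation reduces the measurability
  of a countable sum of functions to that of a parametric integral.
\<close>

lemma infsum_eq_integral_count_space:
  fixes f :: "'a \<Rightarrow> 'k::euclidean_space"
  shows "infsum f A = (\<integral>x. f x \<partial>count_space A)"
proof (cases "f summable_on A")
  case True
  then have "Infinite_Set_Sum.abs_summable_on f A"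
    using summable_on_imp_abs_summable_on abs_summable_equivalent by blast
  then show ?thesis
    using infsetsum_infsum[of f A] by (simp add: infsetsum_def)
next
  case False
  then have "\<not> integrable (count_space A) f"
    using abs_summable_equivalent[of f A] abs_summable_summable
    by (auto simp: Infinite_Set_Sum.abs_summable_on_def)
  then show ?thesis
    using False by (simp add: infsum_not_exists not_integrable_integral_eq)
qed

lemma borel_measurable_infsum:
  fixes f :: "'i \<Rightarrow> 'a \<Rightarrow> 'k::euclidean_space"
  assumes A: "countable A" and [measurable]: "\<And>i. i \<in> A \<Longrightarrow> f i \<in> borel_measurable M"
  shows "(\<lambda>x. \<Sum>\<^sub>\<infinity>i\<in>A. f i x) \<in> borel_measurable M"
proof -
  interpret sigma_finite_measure "count_space A"
    using A by (rule sigma_finite_measure_count_space_countable)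
  have "(\<lambda>(x, i). f i x) \<in> borel_measurable (M \<Otimes>\<^sub>M count_space A)"
    unfolding split_beta
    by (rule measurable_compose_countable'[where f = "\<lambda>i z. f i (fst z)" and g = snd and I = A])
      (use A in \<open>auto intro: measurable_compose[OF measurable_fst assms(2)]\<close>)
  then have "(\<lambda>x. \<integral>i. f i x \<partial>count_space A) \<in> borel_measurable M"
    by (rule borel_measurable_lebesgue_integral)
  then show ?thesis
    by (simp add: infsum_eq_integral_count_space)
qed

lemma ennreal_norm_infsum_le:
  fixes f :: "'a \<Rightarrow> 'k::euclidean_space"
  shows "ennreal (norm (infsum f A)) \<le> (\<Sum>\<^sub>\<infinity>x\<in>A. ennreal (norm (f x)))"
proof (cases "f summable_on A")
  case True
  then have s: "(\<lambda>x. norm (f x)) summable_on A"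
    by (rule summable_on_imp_abs_summable_on)
  have "ennreal (norm (infsum f A)) \<le> ennreal (\<Sum>\<^sub>\<infinity>x\<in>A. norm (f x))"
    by (rule ennreal_leI[OF norm_infsum_bound[OF s]])
  also have "\<dots> = (\<Sum>\<^sub>\<infinity>x\<in>A. ennreal (norm (f x)))"
    by (rule ennreal_infsum[OF s]) simp
  finally show ?thesis .
qed (simp add: infsum_not_exists)

section \<open>Power inequalities\<close>

lemma powr_tangent_le:
  fixes p a y :: real
  assumes "1 < p" "0 \<le> a" "0 \<le> y"
  shows "p * y powr (p - 1) * a \<le> a powr p + (p - 1) * y powr p"
proof -
  have conj: "1 / p + 1 / (p / (p - 1)) = 1"
    using assms by (simp add: field_simps)
  have "a * y powr (p - 1) \<le> a powr p / p + (y powr (p - 1)) powr (p / (p - 1)) / (p / (p - 1))"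
    by (rule Youngs_inequality[OF _ _ conj]) (use assms in auto)
  also have "(y powr (p - 1)) powr (p / (p - 1)) = y powr p"
    using assms by (simp add: powr_powr)
  finally show ?thesis
    using assms by (simp add: field_simps)
qed

lemma powr_add_le:
  fixes p a b :: real
  assumes "0 \<le> p" "0 \<le> a" "0 \<le> b"
  shows "(a + b) powr p \<le> 2 powr p * (a powr p + b powr p)"
proof -
  have "(a + b) powr p \<le> (2 * max a b) powr p"
    using assms by (intro powr_mono2) auto
  also have "\<dots> = 2 powr p * max a b powr p"
    using assms by (simp add: powr_mult)
  also have "max a b powr p \<le> a powr p + b powr p"
    by (simp add: max_def)
  finally show ?thesis by simp
qed

text \<open>
  Convexity of the power function, in the form that yields the triangle inequality in
  \<open>L\<^sup>p\<close> after integration, for the weight \<open>l\<close> that divides the two norms in proportion.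
\<close>

lemma powr_add_le_weighted:
  fixes p a b l :: real
  assumes "1 \<le> p" "0 < l" "l < 1" "0 \<le> a" "0 \<le> b"
  shows "(a + b) powr p \<le> l powr (1 - p) * a powr p + (1 - l) powr (1 - p) * b powr p"
proof -
  have scale: "u * (x / u) powr p = u powr (1 - p) * x powr p" if "0 < u" "0 \<le> x" for u x
    using that by (simp add: powr_divide powr_diff)
  have ge1: "1 \<le> u powr (1 - p)" if "0 < u" "u < 1" for u
    using powr_mono'[of "1 - p" 0 u] that assms(1) by simp
  consider "a = 0" | "b = 0" | "0 < a" "0 < b"
    using assms by linarith
  then show ?thesis
  proof cases
    case 1
    then show ?thesis
      using mult_right_mono[OF ge1[of "1 - l"], of "b powr p"] assms by simp
  next
    case 2
    then show ?thesis
      using mult_right_mono[OF ge1[of l], of "a powr p"] assms by simp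
  next
    case 3
    have "(l *\<^sub>R (a / l) + (1 - l) *\<^sub>R (b / (1 - l))) powr p
        \<le> l * (a / l) powr p + (1 - l) * (b / (1 - l)) powr p"
      using convex_onD[OF powr_convex[OF assms(1)], of "1 - l" "a / l" "b / (1 - l)"] 3 assms
      by simp
    then show ?thesis
      using assms by (simp add: scale)
  qed
qed

section \<open>Spaces of p-integrable functions over a measure\<close>

text \<open>
  The triangle inequality in \<open>L\<^sup>p\<close>. Positive bounds \<open>a\<close> and \<open>b\<close> in place of the norms themselves
  allow the weight \<open>a / (a + b)\<close> in the convexity inequality even when a norm vanishes.
\<close>

lemma nn_integral_powr_norm_add_le:
  fixes f g :: "'a \<Rightarrow> 'k::{second_countable_topology, real_normed_vector}"
  assumes p: "1 \<le> p" and ab: "0 < a" "0 < b"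
    and [measurable]: "f \<in> borel_measurable M" "g \<in> borel_measurable M"
    and f: "(\<integral>\<^sup>+x. ennreal (norm (f x) powr p) \<partial>M) \<le> ennreal (a powr p)"
    and g: "(\<integral>\<^sup>+x. ennreal (norm (g x) powr p) \<partial>M) \<le> ennreal (b powr p)"
  shows "(\<integral>\<^sup>+x. ennreal (norm (f x + g x) powr p) \<partial>M) \<le> ennreal ((a + b) powr p)"
proof -
  define l where "l = a / (a + b)"
  have l: "0 < l" "l < 1" "1 - l = b / (a + b)"
    using ab by (auto simp: l_def field_simps)
  have eq: "(u / (a + b)) powr (1 - p) * u powr p = u * (a + b) powr (p - 1)" if "0 < u" for u
  proof -
    have "u powr (1 - p) * u powr p = u"
      using that by (simp flip: powr_add)
    moreover have "(a + b) powr (p - 1) = 1 / (a + b) powr (1 - p)"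
      using powr_minus_divide[of "a + b" "1 - p"] by simp
    ultimately show ?thesis
      using that ab by (simp add: powr_divide)
  qed
  have "(\<integral>\<^sup>+x. ennreal (norm (f x + g x) powr p) \<partial>M)
      \<le> (\<integral>\<^sup>+x. ennreal (l powr (1 - p)) * ennreal (norm (f x) powr p)
              + ennreal ((1 - l) powr (1 - p)) * ennreal (norm (g x) powr p) \<partial>M)"
  proof (rule nn_integral_mono)
    fix x
    have "norm (f x + g x) powr p \<le> (norm (f x) + norm (g x)) powr p"
      using p by (intro powr_mono2 norm_triangle_ineq) auto
    also have "\<dots> \<le> l powr (1 - p) * norm (f x) powr p + (1 - l) powr (1 - p) * norm (g x) powr p"
      using l by (intro powr_add_le_weighted p) auto
    finally show "ennreal (norm (f x + g x) powr p) \<le> ennreal (l powr (1 - p)) * ennreal (norm (f x) powr p)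
        + ennreal ((1 - l) powr (1 - p)) * ennreal (norm (g x) powr p)"
      by (simp flip: ennreal_mult ennreal_plus)
  qed
  also have "\<dots> = ennreal (l powr (1 - p)) * (\<integral>\<^sup>+x. ennreal (norm (f x) powr p) \<partial>M)
      + ennreal ((1 - l) powr (1 - p)) * (\<integral>\<^sup>+x. ennreal (norm (g x) powr p) \<partial>M)"
    by (simp add: nn_integral_add nn_integral_cmult)
  also have "\<dots> \<le> ennreal (l powr (1 - p)) * ennreal (a powr p)
      + ennreal ((1 - l) powr (1 - p)) * ennreal (b powr p)"
    by (intro add_mono mult_left_mono f g) auto
  also have "\<dots> = ennreal (l powr (1 - p) * a powr p + (1 - l) powr (1 - p) * b powr p)"
    by (simp add: ennreal_mult ennreal_plus)
  also have "l powr (1 - p) * a powr p + (1 - l) powr (1 - p) * b powr p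
      = (a + b) * (a + b) powr (p - 1)"
    unfolding l(3) unfolding l_def using ab by (simp add: eq distrib_right)
  also have "\<dots> = (a + b) powr p"
    using ab by (simp add: powr_diff)
  finally show ?thesis .
qed

text \<open>
  Completeness. Along a subsequence the increments, weighted by \<open>2\<^sup>k\<^sup>p\<close>, have summable
  integrals, so almost everywhere they are dominated by a geometric series and the subsequence
  converges; Fatou's lemma then bounds the distance to the pointwise limit.
\<close>

lemma nn_integral_powr_norm_Cauchy_imp_convergent:
  fixes f :: "nat \<Rightarrow> 'a \<Rightarrow> 'k::{second_countable_topology, banach}"
  assumes p: "1 \<le> p" and meas[measurable]: "\<And>n. f n \<in> borel_measurable M"
    and Cauchy: "\<And>\<epsilon>. 0 < \<epsilon> \<Longrightarrow> \<exists>N. \<forall>m\<ge>N. \<forall>n\<ge>N.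
      (\<integral>\<^sup>+x. ennreal (norm (f m x - f n x) powr p) \<partial>M) \<le> ennreal \<epsilon>"
  obtains g where "g \<in> borel_measurable M"
    "\<And>\<epsilon>. 0 < \<epsilon> \<Longrightarrow> \<exists>N. \<forall>n\<ge>N. (\<integral>\<^sup>+x. ennreal (norm (f n x - g x) powr p) \<partial>M) \<le> ennreal \<epsilon>"
proof -
  define w :: "nat \<Rightarrow> real" where "w k = 2 powr (real k * p)" for k
  have w: "0 < w k" for k by (simp add: w_def)
  have "\<forall>k. \<exists>N. \<forall>m\<ge>N. \<forall>n\<ge>N.
      (\<integral>\<^sup>+x. ennreal (norm (f m x - f n x) powr p) \<partial>M) \<le> ennreal ((1/2) ^ k / w k)"
    using Cauchy w by auto
  then obtain N where N: "\<And>k m n. N k \<le> m \<Longrightarrow> N k \<le> n \<Longrightarrow>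
      (\<integral>\<^sup>+x. ennreal (norm (f m x - f n x) powr p) \<partial>M) \<le> ennreal ((1/2) ^ k / w k)"
    by metis
  define r where "r k = k + (\<Sum>i\<le>k. N i)" for k
  have r_ge: "N k \<le> r k" for k
    unfolding r_def by (rule trans_le_add2, rule member_le_sum) auto
  have r_Suc: "r k \<le> r (Suc k)" for k
    by (simp add: r_def)
  define d where "d k x = f (r (Suc k)) x - f (r k) x" for k x
  have [measurable]: "d k \<in> borel_measurable M" for k
    unfolding d_def by measurable
  have int_d: "(\<integral>\<^sup>+x. ennreal (w k * norm (d k x) powr p) \<partial>M) \<le> ennreal ((1/2) ^ k)" for k
  proof -
    have "(\<integral>\<^sup>+x. ennreal (w k * norm (d k x) powr p) \<partial>M)
        = ennreal (w k) * (\<integral>\<^sup>+x. ennreal (norm (d k x) powr p) \<partial>M)"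
      using w[of k] by (simp add: ennreal_mult nn_integral_cmult)
    also have "\<dots> \<le> ennreal (w k) * ennreal ((1/2) ^ k / w k)"
      unfolding d_def using r_ge[of k] r_Suc[of k] by (intro mult_left_mono N) auto
    also have "\<dots> = ennreal ((1/2) ^ k)"
      using w[of k] by (simp flip: ennreal_mult)
    finally show ?thesis .
  qed
  have "(\<integral>\<^sup>+x. (\<Sum>k. ennreal (w k * norm (d k x) powr p)) \<partial>M)
      = (\<Sum>k. \<integral>\<^sup>+x. ennreal (w k * norm (d k x) powr p) \<partial>M)"
    by (rule nn_integral_suminf) simp
  also have "\<dots> \<le> (\<Sum>k. ennreal ((1/2) ^ k))"
    by (intro suminf_le int_d) auto
  also have "\<dots> = ennreal (\<Sum>k. (1/2) ^ k)"
    by (intro suminf_ennreal2) auto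
  finally have "(\<integral>\<^sup>+x. (\<Sum>k. ennreal (w k * norm (d k x) powr p)) \<partial>M) \<noteq> \<infinity>"
    by (auto simp: top_unique)
  then have "AE x in M. (\<Sum>k. ennreal (w k * norm (d k x) powr p)) \<noteq> \<infinity>"
    by (intro nn_integral_PInf_AE) auto
  then have conv: "AE x in M. convergent (\<lambda>k. f (r k) x)"
  proof (rule AE_mp, intro AE_I2 impI)
    fix x assume "(\<Sum>k. ennreal (w k * norm (d k x) powr p)) \<noteq> \<infinity>"
    then obtain C where C: "0 \<le> C" "(\<Sum>k. ennreal (w k * norm (d k x) powr p)) = ennreal C"
      by (metis ennreal_cases infinity_ennreal_def)
    have "norm (d k x) \<le> C powr (1 / p) * (1/2) ^ k" for k
    proof -
      have "ennreal (w k * norm (d k x) powr p) \<le> ennreal C"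
        using sum_le_suminf[of "\<lambda>k. ennreal (w k * norm (d k x) powr p)" "{k}"] C by simp
      then have "w k * norm (d k x) powr p \<le> C"
        using C by simp
      then have "(w k * norm (d k x) powr p) powr (1 / p) \<le> C powr (1 / p)"
        using w[of k] p by (intro powr_mono2) auto
      also have "(w k * norm (d k x) powr p) powr (1 / p) = 2 ^ k * norm (d k x)"
        using w[of k] p by (simp add: powr_mult powr_powr w_def powr_realpow)
      finally show ?thesis
        by (simp add: field_simps power_divide)
    qed
    moreover have "summable (\<lambda>k. C powr (1 / p) * (1/2) ^ k)"
      by (rule summable_mult, rule summable_geometric) simp
    ultimately have "summable (\<lambda>k. d k x)"
      by (rule summable_comparison_test'[where N = 0, rotated])
    then have "convergent (\<lambda>n. \<Sum>k<n. d k x)"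
      by (simp add: summable_iff_convergent)
    also have "(\<lambda>n. \<Sum>k<n. d k x) = (\<lambda>n. f (r n) x - f (r 0) x)"
      unfolding d_def by (rule ext, rule sum_lessThan_telescope)
    finally have "convergent (\<lambda>n. (f (r n) x - f (r 0) x) + f (r 0) x)"
      by (rule convergent_add[OF _ convergent_const])
    then show "convergent (\<lambda>k. f (r k) x)"
      by simp
  qed
  define g where "g x = lim (\<lambda>k. f (r k) x)" for x
  have [measurable]: "g \<in> borel_measurable M"
    unfolding g_def by measurable
  show ?thesis
  proof (rule that)
    fix \<epsilon> :: real assume "0 < \<epsilon>"
    from Cauchy[OF this] obtain K where K: "\<And>m n. K \<le> m \<Longrightarrow> K \<le> n \<Longrightarrow>
        (\<integral>\<^sup>+x. ennreal (norm (f m x - f n x) powr p) \<partial>M) \<le> ennreal \<epsilon>"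
      by metis
    show "\<exists>N. \<forall>n\<ge>N. (\<integral>\<^sup>+x. ennreal (norm (f n x - g x) powr p) \<partial>M) \<le> ennreal \<epsilon>"
    proof (intro exI[of _ K] allI impI)
      fix n assume n: "K \<le> n"
      have "(\<integral>\<^sup>+x. ennreal (norm (f n x - g x) powr p) \<partial>M)
          \<le> (\<integral>\<^sup>+x. liminf (\<lambda>k. ennreal (norm (f n x - f (r k) x) powr p)) \<partial>M)"
      proof (rule nn_integral_mono_AE, rule AE_mp[OF conv], intro AE_I2 impI)
        fix x assume "convergent (\<lambda>k. f (r k) x)"
        then have "(\<lambda>k. f (r k) x) \<longlonglongrightarrow> g x"
          by (simp add: convergent_LIMSEQ_iff g_def)
        then have "(\<lambda>k. ennreal (norm (f n x - f (r k) x) powr p)) \<longlonglongrightarrow> ennreal (norm (f n x - g x) powr p)"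
          using p by (intro tendsto_ennrealI tendsto_powr2 tendsto_intros) auto
        then show "ennreal (norm (f n x - g x) powr p)
            \<le> liminf (\<lambda>k. ennreal (norm (f n x - f (r k) x) powr p))"
          by (rule eq_refl[OF lim_imp_Liminf[OF trivial_limit_sequentially, symmetric]])
      qed
      also have "\<dots> \<le> liminf (\<lambda>k. \<integral>\<^sup>+x. ennreal (norm (f n x - f (r k) x) powr p) \<partial>M)"
        by (rule nn_integral_liminf) simp
      also have "\<dots> \<le> ennreal \<epsilon>"
      proof (rule order_trans[OF Liminf_le_Limsup Limsup_bounded])
        show "\<forall>\<^sub>F k in sequentially. (\<integral>\<^sup>+x. ennreal (norm (f n x - f (r k) x) powr p) \<partial>M) \<le> ennreal \<epsilon>"
          unfolding eventually_sequentially using n by (intro exI[of _ K] allI impI K) (auto simp: r_def)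
      qed simp
      finally show "(\<integral>\<^sup>+x. ennreal (norm (f n x - g x) powr p) \<partial>M) \<le> ennreal \<epsilon>" .
    qed
  qed simp
qed

section \<open>Edges of an unrooted leafless tree\<close>

lemma infsum_fibres_ennreal:
  fixes g :: "'a \<Rightarrow> ennreal"
  assumes "countable U" "countable A" "\<And>k. k \<in> U \<Longrightarrow> \<phi> k \<in> A"
  shows "(\<Sum>\<^sub>\<infinity>j\<in>A. \<Sum>\<^sub>\<infinity>k\<in>{k \<in> U. \<phi> k = j}. g k) = (\<Sum>\<^sub>\<infinity>k\<in>U. g k)"
proof -
  have "(\<Sum>\<^sub>\<infinity>j\<in>A. \<Sum>\<^sub>\<infinity>k\<in>{k \<in> U. \<phi> k = j}. g k) = (\<Sum>\<^sub>\<infinity>j\<in>A. \<Sum>\<^sub>\<infinity>k\<in>U. if \<phi> k = j then g k else 0)"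
    by (intro infsum_cong infsum_cong_neutral) auto
  also have "\<dots> = (\<Sum>\<^sub>\<infinity>k\<in>U. \<Sum>\<^sub>\<infinity>j\<in>A. if \<phi> k = j then g k else 0)"
    by (rule infsum_swap_ennreal) fact+
  also have "\<dots> = (\<Sum>\<^sub>\<infinity>k\<in>U. \<Sum>\<^sub>\<infinity>j\<in>{\<phi> k}. g k)"
    using assms(3) by (intro infsum_cong infsum_cong_neutral) auto
  finally show ?thesis by simp
qed

text \<open>
  The tree is described by its edges and the map to the parent edge. In an unrooted leafless
  tree this map is a surjection of the edges onto themselves, and no iterate of it has a fixed point.
\<close>

locale edge_tree =
  fixes I :: "'i set" and e :: "'i \<Rightarrow> 'v \<times> 'v" and par :: "'i \<Rightarrow> 'i"
  assumes countable_index: "countable I"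
    and head_eq_tail_iff: "\<lbrakk>i \<in> I; j \<in> I\<rbrakk> \<Longrightarrow> snd (e i) = fst (e j) \<longleftrightarrow> par j = i"
    and par_in: "j \<in> I \<Longrightarrow> par j \<in> I"
    and child_exists: "i \<in> I \<Longrightarrow> \<exists>j\<in>I. par j = i"
    and par_acyclic: "\<lbrakk>i \<in> I; 0 < n\<rbrakk> \<Longrightarrow> (par ^^ n) i \<noteq> i"
begin

abbreviation D :: "nat \<Rightarrow> 'i \<Rightarrow> 'i set" where
  "D \<equiv> descendants I e"

lemma funpow_par_in: "j \<in> I \<Longrightarrow> (par ^^ n) j \<in> I"
  by (induction n) (auto intro: par_in)

lemma adj_pow_eq:
  "\<lbrakk>i \<in> I; j \<in> I\<rbrakk> \<Longrightarrow> adj_pow I e n i j = (if (par ^^ n) j = i then 1 else 0)"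
proof (induction n arbitrary: j)
  case (Suc n)
  have "adj_pow I e (Suc n) i j = (\<Sum>\<^sub>\<infinity>k\<in>{par j}. adj_pow I e n i k * adj e k j)"
    unfolding adj_pow.simps
  proof (rule infsum_cong_neutral)
    fix k assume "k \<in> I - {par j}"
    then have "adj e k j = 0"
      using head_eq_tail_iff[of k j] Suc.prems by (auto simp: adj_def)
    then show "adj_pow I e n i k * adj e k j = 0" by simp
  qed (use par_in Suc.prems in auto)
  also have "\<dots> = adj_pow I e n i (par j)"
    using head_eq_tail_iff[of "par j" j] par_in Suc.prems by (simp add: adj_def)
  also have "\<dots> = (if (par ^^ n) (par j) = i then 1 else 0)"
    using Suc par_in by blast
  finally show ?case
    by (simp add: funpow_swap1)
qed auto

lemma descendants_eq: "i \<in> I \<Longrightarrow> D n i = {j \<in> I. (par ^^ n) j = i}"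
  unfolding descendants_def by (auto simp: adj_pow_eq split: if_splits)

lemma ancestor_eq: "j \<in> I \<Longrightarrow> ancestor I e n j = (par ^^ n) j"
  unfolding ancestor_def by (rule the_equality) (auto simp: descendants_eq funpow_par_in)

lemma descendants_subset: "D n i \<subseteq> I"
  unfolding descendants_def by auto

lemma countable_descendants: "countable (D n i)"
  using countable_index descendants_subset countable_subset by blast

lemma descendants_add: "i \<in> I \<Longrightarrow> D (n + m) i = (\<Union>j\<in>D n i. D m j)"
  by (auto simp: descendants_eq funpow_add funpow_par_in)

lemma descendants_disjoint:
  "\<lbrakk>k \<in> D n i; k \<in> D n j; i \<in> I; j \<in> I\<rbrakk> \<Longrightarrow> i = j"
  by (auto simp: descendants_eq)

lemma infsum_descendants:
  fixes g :: "'i \<Rightarrow> ennreal"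
  shows "(\<Sum>\<^sub>\<infinity>i\<in>I. \<Sum>\<^sub>\<infinity>j\<in>D n i. g j) = (\<Sum>\<^sub>\<infinity>j\<in>I. g j)"
proof -
  have "(\<Sum>\<^sub>\<infinity>i\<in>I. \<Sum>\<^sub>\<infinity>j\<in>D n i. g j) = (\<Sum>\<^sub>\<infinity>i\<in>I. \<Sum>\<^sub>\<infinity>j\<in>{j \<in> I. (par ^^ n) j = i}. g j)"
    by (rule infsum_cong) (simp add: descendants_eq)
  then show ?thesis
    using infsum_fibres_ennreal[OF countable_index countable_index, of "par ^^ n" g] funpow_par_in
    by simp
qed

lemma
  shows finite_initial_edges: "finite {i \<in> I. to_nat_on I i < n}"
    and card_initial_edges: "card {i \<in> I. to_nat_on I i < n} \<le> n"
proof -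
  let ?F = "{i \<in> I. to_nat_on I i < n}"
  have inj: "inj_on (to_nat_on I) ?F"
    using inj_on_to_nat_on[OF countable_index] by (rule inj_on_subset) auto
  have img: "to_nat_on I ` ?F \<subseteq> {..<n}" by auto
  show "finite ?F" "card ?F \<le> n"
    using finite_imageD[OF finite_subset[OF img] inj] card_inj_on_le[OF inj img] by auto
qed

lemma generation_unique:
  assumes "i \<in> I" "j \<in> I" "(par ^^ n) j = i" "(par ^^ m) j = i"
  shows "n = m"
proof -
  have False if "a < b" "(par ^^ a) j = i" "(par ^^ b) j = i" for a b
  proof -
    have "(par ^^ (b - a)) i = (par ^^ ((b - a) + a)) j"
      using that by (simp only: funpow_add o_apply)
    then show False
      using that par_acyclic[OF assms(1), of "b - a"] by simp
  qed
  then show ?thesis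
    using assms(3,4) by (metis linorder_neqE_nat)
qed

lemma finite_generations_bounded:
  assumes "finite F" "F \<subseteq> I"
  shows "\<exists>N. \<forall>n\<ge>N. \<forall>i\<in>F. \<forall>j\<in>F. (par ^^ n) j \<noteq> i"
proof -
  have fin: "finite {n. \<exists>i\<in>F. \<exists>j\<in>F. (par ^^ n) j = i}"
  proof (rule finite_subset)
    have "finite {n. (par ^^ n) j = i}" if "i \<in> F" "j \<in> F" for i j
    proof (cases "\<exists>m. (par ^^ m) j = i")
      case True
      then obtain m where "(par ^^ m) j = i" by blast
      then have "{n. (par ^^ n) j = i} \<subseteq> {m}"
        using generation_unique that assms(2) by blast
      then show ?thesis by (rule finite_subset) simp
    qed simp
    then show "finite (\<Union>i\<in>F. \<Union>j\<in>F. {n. (par ^^ n) j = i})"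
      using assms(1) by blast
  qed auto
  then obtain N where "\<forall>n\<in>{n. \<exists>i\<in>F. \<exists>j\<in>F. (par ^^ n) j = i}. n < N"
    using finite_nat_set_iff_bounded by blast
  then show ?thesis
    by (metis (mono_tags, lifting) mem_Collect_eq not_less)
qed

end

text \<open>
  The tail of an edge is not a root, hence it is the head of a parent edge; its head is not a
  leaf, hence it is the tail of a child edge. An edge fixed by an iterate of the parent map would
  close a directed cycle through its tail.
\<close>

lemma edge_tree_exists:
  fixes E :: "('v \<times> 'v) set" and e :: "'i \<Rightarrow> 'v \<times> 'v"
  assumes "directed_tree V E" "unrooted V E" "leafless V E" "bij_betw e I E"
  obtains par where "edge_tree I e par"
proof -
  interpret directed_tree V E by fact
  have E: "e ` I = E" and inj: "inj_on e I"
    using assms(4) by (auto simp: bij_betw_def)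
  have eE: "e i \<in> E" if "i \<in> I" for i
    using that E by blast
  have V: "fst (e i) \<in> V" "snd (e i) \<in> V" if "i \<in> I" for i
    using eE[OF that] edges by auto
  have ex: "\<exists>k\<in>I. snd (e k) = fst (e j)" if j: "j \<in> I" for j
  proof -
    obtain u where "(u, fst (e j)) \<in> E"
      using V(1)[OF j] assms(2) by (auto simp: unrooted_def)
    then obtain k where "k \<in> I" "e k = (u, fst (e j))"
      using E by (metis imageE)
    then show ?thesis by (intro bexI[of _ k]) auto
  qed
  then obtain par where par: "\<And>j. j \<in> I \<Longrightarrow> par j \<in> I \<and> snd (e (par j)) = fst (e j)"
    by metis
  have "edge_tree I e par"
  proof
    have "countable E"
      using edges countable_vertices
      by (meson Diff_subset countable_SIGMA countable_subset order_trans)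
    then show "countable I"
      using assms(4) countableI_bij2 by blast
    show "snd (e i) = fst (e j) \<longleftrightarrow> par j = i" if "i \<in> I" "j \<in> I" for i j
    proof
      assume eq: "snd (e i) = fst (e j)"
      have "(fst (e i), fst (e j)) \<in> E" "(fst (e (par j)), fst (e j)) \<in> E"
        using eE[of i] eE[of "par j"] par[OF that(2)] that eq by (metis prod.collapse)+
      then have "fst (e i) = fst (e (par j))"
        by (rule parent_unique)
      then have "e i = e (par j)"
        using eq par[OF that(2)] by (simp add: prod_eq_iff)
      then show "par j = i"
        using inj that par[OF that(2)] by (auto dest: inj_onD)
    qed (use par that in auto)
    show "par j \<in> I" if "j \<in> I" for j
      using par that by blast
    show "\<exists>j\<in>I. par j = i" if i: "i \<in> I" for i
    proof -
      obtain w where "(snd (e i), w) \<in> E"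
        using V(2)[OF i] assms(3) by (auto simp: leafless_def)
      then obtain j where j: "j \<in> I" "e j = (snd (e i), w)"
        using E by (metis imageE)
      have "(fst (e i), snd (e i)) \<in> E" "(fst (e (par j)), snd (e i)) \<in> E"
        using eE[OF i] eE[of "par j"] par[OF j(1)] j by (metis prod.collapse fst_conv)+
      then have "fst (e i) = fst (e (par j))"
        by (rule parent_unique)
      then have "e i = e (par j)"
        using j par[OF j(1)] by (simp add: prod_eq_iff)
      then show ?thesis
        using inj i j par[OF j(1)] by (auto dest: inj_onD)
    qed
    have step: "(fst (e (par j)), fst (e j)) \<in> E" if "j \<in> I" for j
      using eE[of "par j"] par[OF that] by (metis prod.collapse)
    have in_I: "(par ^^ n) j \<in> I" if "j \<in> I" for n j
      using that par by (induction n) auto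
    have reach: "(fst (e ((par ^^ Suc n) j)), fst (e j)) \<in> E\<^sup>+" if "j \<in> I" for n j
    proof (induction n)
      case 0
      show ?case using step[OF that] by auto
    next
      case (Suc n)
      show ?case
        using step[OF in_I[OF that, of "Suc n"]] Suc by (simp add: trancl_into_trancl2)
    qed
    show "(par ^^ n) i \<noteq> i" if "i \<in> I" "0 < n" for i n
      using reach[OF that(1), of "n - 1"] no_cycles that by (auto simp: acyclic_def)
  qed
  then show ?thesis by (rule that)
qed

section \<open>The cost of a unit mass\<close>

text \<open>
  For \<open>p \<ge> 1\<close>, positive \<open>r\<close> and \<open>c > 0\<close>, the condition says that the infimum of
  \<open>\<Sum>j\<in>D. \<bar>x j\<bar> powr p * r j\<close> over all families with \<open>\<Sum>j\<in>D. x j = 1\<close> is at least \<open>c\<close>: this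
  infimum is \<open>inf r\<close> for \<open>p = 1\<close>, and is computed by Hoelder's inequality for \<open>p > 1\<close>. It makes the
  two cases of the theorem, and the two cases of admissibility, instances of one.
\<close>

definition mass_cost_ge :: "real \<Rightarrow> 'j set \<Rightarrow> ('j \<Rightarrow> real) \<Rightarrow> real \<Rightarrow> bool" where
  "mass_cost_ge p D r c \<longleftrightarrow>
     (if p = 1 then \<forall>j\<in>D. c \<le> r j
      else (\<Sum>\<^sub>\<infinity>j\<in>D. ennreal (r j powr (- 1 / (p - 1)))) \<le> ennreal (c powr (- 1 / (p - 1))))"

lemma mass_cost_ge_mono_set: "mass_cost_ge p D r c \<Longrightarrow> B \<subseteq> D \<Longrightarrow> mass_cost_ge p B r c"
  unfolding mass_cost_ge_def
  using infsum_ennreal_mono_set[of B D "\<lambda>j. ennreal (r j powr (- 1 / (p - 1)))"]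
  by (auto split: if_splits)

lemma mass_cost_ge_mono:
  assumes "1 \<le> p" "0 < c'" "c' \<le> c" "mass_cost_ge p D r c"
  shows "mass_cost_ge p D r c'"
proof (cases "p = 1")
  case False
  have "c powr (- 1 / (p - 1)) \<le> c' powr (- 1 / (p - 1))"
    using False assms by (intro powr_mono2') auto
  then show ?thesis
    using False assms(4) unfolding mass_cost_ge_def by (auto intro: order_trans ennreal_leI)
qed (use assms in \<open>auto simp: mass_cost_ge_def\<close>)

lemma mass_cost_ge_singleton:
  assumes "1 \<le> p" "0 < c" "0 < r j"
  shows "mass_cost_ge p {j} r c \<longleftrightarrow> c \<le> r j"
proof (cases "p = 1")
  case False
  have "r j powr (- 1 / (p - 1)) \<le> c powr (- 1 / (p - 1)) \<longleftrightarrow> c \<le> r j"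
  proof
    assume le: "r j powr (- 1 / (p - 1)) \<le> c powr (- 1 / (p - 1))"
    show "c \<le> r j"
    proof (rule ccontr)
      assume "\<not> c \<le> r j"
      then have "c powr (- 1 / (p - 1)) < r j powr (- 1 / (p - 1))"
        using False assms by (intro powr_less_mono2_neg) auto
      with le show False by simp
    qed
  qed (use False assms in \<open>auto intro!: powr_mono2'\<close>)
  then show ?thesis
    using False by (simp add: mass_cost_ge_def)
qed (simp add: mass_cost_ge_def)

text \<open>
  The nontrivial half of Hoelder's inequality, from the tangent of the power function at the
  minimiser of the cost.
\<close>

lemma mass_cost_ge_sum_le:
  assumes p: "1 \<le> p" and c: "0 < c" and heavy: "mass_cost_ge p D r c"
    and r: "\<And>j. j \<in> D \<Longrightarrow> 0 < r j" and a: "\<And>j. j \<in> D \<Longrightarrow> 0 \<le> a j"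
    and F: "finite F" "F \<subseteq> D"
  shows "c * (\<Sum>j\<in>F. a j) powr p \<le> (\<Sum>j\<in>F. a j powr p * r j)"
proof (cases "p = 1")
  case True
  have "c * (\<Sum>j\<in>F. a j) \<le> (\<Sum>j\<in>F. a j * r j)"
    unfolding sum_distrib_left
  proof (rule sum_mono)
    fix j assume "j \<in> F"
    then have "a j * c \<le> a j * r j"
      using True heavy F a by (intro mult_left_mono) (auto simp: mass_cost_ge_def)
    then show "c * a j \<le> a j * r j"
      by (simp add: mult.commute)
  qed
  moreover have "(\<Sum>j\<in>F. a j powr p * r j) = (\<Sum>j\<in>F. a j * r j)"
    using True F a by (intro sum.cong) auto
  moreover have "(\<Sum>j\<in>F. a j) powr p = (\<Sum>j\<in>F. a j)"
    using True F a by (simp add: sum_nonneg subset_iff)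
  ultimately show ?thesis by simp
next
  case False
  then have p1: "1 < p" using p by simp
  define q where "q = 1 / (p - 1)"
  have q: "q * (p - 1) = 1" "q * p = 1 + q"
    using p1 by (auto simp: q_def field_simps)
  define A where "A = (\<Sum>j\<in>F. a j)"
  have A: "0 \<le> A" unfolding A_def using a F by (auto intro: sum_nonneg)
  define l where "l = A * c powr q"
  have l: "0 \<le> l" "l powr (p - 1) = A powr (p - 1) * c" "l powr p = A powr p * (c * c powr q)"
    using A c q by (auto simp: l_def powr_mult powr_powr powr_add)
  have "ennreal (\<Sum>j\<in>F. r j powr - q) = (\<Sum>j\<in>F. ennreal (r j powr (- 1 / (p - 1))))"
    by (simp add: q_def)
  also have "\<dots> \<le> (\<Sum>\<^sub>\<infinity>j\<in>D. ennreal (r j powr (- 1 / (p - 1))))"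
    by (rule sum_le_infsum_ennreal[OF F])
  also have "\<dots> \<le> ennreal (c powr - q)"
    using heavy False by (simp add: mass_cost_ge_def q_def)
  finally have S: "(\<Sum>j\<in>F. r j powr - q) \<le> c powr - q"
    by simp
  have term_le: "p * l powr (p - 1) * a j \<le> a j powr p * r j + (p - 1) * l powr p * r j powr - q"
    if j: "j \<in> F" for j
  proof -
    have rj: "0 < r j" and aj: "0 \<le> a j"
      using j F r a by auto
    \<comment> \<open>The minimiser of the cost is proportional to \<open>r powr - q\<close>.\<close>
    define y where "y = l * r j powr - q"
    have y1: "y powr (p - 1) * r j = l powr (p - 1)"
    proof -
      have "(r j powr - q) powr (p - 1) * r j = 1"
      proof -
        have "(r j powr - q) powr (p - 1) = r j powr - 1"
          using q by (simp only: powr_powr mult_minus_left)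
        then show ?thesis using rj by (simp add: powr_minus)
      qed
      moreover have "y powr (p - 1) = l powr (p - 1) * (r j powr - q) powr (p - 1)"
        unfolding y_def by (rule powr_mult)
      ultimately show ?thesis
        by (simp only: mult.assoc mult_1_right)
    qed
    have y2: "y powr p * r j = l powr p * r j powr - q"
    proof -
      have "(r j powr - q) powr p * r j powr 1 = r j powr - q"
        using q by (simp only: powr_powr flip: powr_add) simp
      then show ?thesis
        using rj l by (simp add: y_def powr_mult)
    qed
    have "p * y powr (p - 1) * a j \<le> a j powr p + (p - 1) * y powr p"
      using p1 aj l by (intro powr_tangent_le) (auto simp: y_def)
    then have "(p * y powr (p - 1) * a j) * r j \<le> (a j powr p + (p - 1) * y powr p) * r j"
      using rj by (intro mult_right_mono) auto
    then have "p * (y powr (p - 1) * r j) * a j \<le> a j powr p * r j + (p - 1) * (y powr p * r j)"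
      by (simp add: algebra_simps)
    then show ?thesis
      by (simp add: y1 y2 mult.assoc)
  qed
  have "p * l powr (p - 1) * A = (\<Sum>j\<in>F. p * l powr (p - 1) * a j)"
    by (simp add: A_def sum_distrib_left)
  also have "\<dots> \<le> (\<Sum>j\<in>F. a j powr p * r j + (p - 1) * l powr p * r j powr - q)"
    by (rule sum_mono[OF term_le])
  also have "\<dots> = (\<Sum>j\<in>F. a j powr p * r j) + (p - 1) * l powr p * (\<Sum>j\<in>F. r j powr - q)"
    by (simp add: sum.distrib sum_distrib_left)
  also have "\<dots> \<le> (\<Sum>j\<in>F. a j powr p * r j) + (p - 1) * l powr p * c powr - q"
    using S p1 by (intro add_left_mono mult_left_mono) auto
  also have "(p - 1) * l powr p * c powr - q = (p - 1) * (c * A powr p)"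
    using c by (simp add: l powr_minus)
  also have "p * l powr (p - 1) * A = p * (c * A powr p)"
  proof -
    have "A powr (p - 1) * A = A powr p"
      using A by (cases "A = 0") (auto simp: powr_diff)
    then show ?thesis by (simp add: l)
  qed
  finally show ?thesis
    by (simp add: A_def algebra_simps)
qed

lemma mass_cost_ge_infsum_le:
  assumes p: "1 \<le> p" and c: "0 < c" and heavy: "mass_cost_ge p D r c"
    and r: "\<And>j. j \<in> D \<Longrightarrow> 0 < r j" and a: "\<And>j. j \<in> D \<Longrightarrow> 0 \<le> a j"
    and R: "0 \<le> R" "(\<Sum>\<^sub>\<infinity>j\<in>D. ennreal (a j powr p * r j)) \<le> ennreal R"
  shows "(\<Sum>\<^sub>\<infinity>j\<in>D. ennreal (a j)) \<le> ennreal ((R / c) powr (1 / p))"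
  unfolding infsum_ennreal_eq_SUP
proof (rule SUP_least, clarify)
  fix F assume F: "finite F" "F \<subseteq> D"
  have "ennreal (c * (\<Sum>j\<in>F. a j) powr p) \<le> ennreal (\<Sum>j\<in>F. a j powr p * r j)"
    by (rule ennreal_leI[OF mass_cost_ge_sum_le[OF p c heavy r a F]])
  also have "\<dots> = (\<Sum>j\<in>F. ennreal (a j powr p * r j))"
    using F r by (subst sum_ennreal) (auto intro!: mult_nonneg_nonneg less_imp_le[OF r])
  also have "\<dots> \<le> ennreal R"
    using sum_le_infsum_ennreal[OF F] R(2) by (rule order_trans)
  finally have "(\<Sum>j\<in>F. a j) powr p \<le> R / c"
    using c R by (simp add: field_simps)
  then have "((\<Sum>j\<in>F. a j) powr p) powr (1 / p) \<le> (R / c) powr (1 / p)"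
    using p by (intro powr_mono2) auto
  moreover have "((\<Sum>j\<in>F. a j) powr p) powr (1 / p) = (\<Sum>j\<in>F. a j)"
    using p F a by (simp add: powr_powr sum_nonneg subset_iff)
  moreover have "(\<Sum>j\<in>F. ennreal (a j)) = ennreal (\<Sum>j\<in>F. a j)"
    using F a by (subst sum_ennreal) auto
  ultimately show "(\<Sum>j\<in>F. ennreal (a j)) \<le> ennreal ((R / c) powr (1 / p))"
    by simp
qed

lemma mass_cost_ge_norm_infsum_le:
  fixes x :: "'j \<Rightarrow> 'k::euclidean_space"
  assumes p: "1 \<le> p" and c: "0 < c" and heavy: "mass_cost_ge p D r c"
    and r: "\<And>j. j \<in> D \<Longrightarrow> 0 < r j"
  shows "ennreal (c * norm (infsum x D) powr p) \<le> (\<Sum>\<^sub>\<infinity>j\<in>D. ennreal (norm (x j) powr p * r j))"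
    and "(\<Sum>\<^sub>\<infinity>j\<in>D. ennreal (norm (x j) powr p * r j)) < \<infinity> \<Longrightarrow> (\<lambda>j. norm (x j)) summable_on D"
proof -
  let ?S = "\<Sum>\<^sub>\<infinity>j\<in>D. ennreal (norm (x j) powr p * r j)"
  have bound: "(\<Sum>\<^sub>\<infinity>j\<in>D. ennreal (norm (x j))) \<le> ennreal ((R / c) powr (1 / p))"
    if "0 \<le> R" "?S \<le> ennreal R" for R
    by (rule mass_cost_ge_infsum_le[OF p c heavy r norm_ge_zero that])
  show "ennreal (c * norm (infsum x D) powr p) \<le> ?S"
  proof (cases ?S)
    case (real R)
    have "ennreal (norm (infsum x D)) \<le> (\<Sum>\<^sub>\<infinity>j\<in>D. ennreal (norm (x j)))"
      by (rule ennreal_norm_infsum_le)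
    also have "\<dots> \<le> ennreal ((R / c) powr (1 / p))"
      using real by (intro bound) auto
    finally have "norm (infsum x D) powr p \<le> ((R / c) powr (1 / p)) powr p"
      using p by (intro powr_mono2) auto
    also have "\<dots> = R / c"
      using p real c by (simp add: powr_powr)
    finally show ?thesis
      using real c by (simp add: ennreal_leI field_simps)
  qed simp
  show "(\<lambda>j. norm (x j)) summable_on D" if fin: "?S < \<infinity>"
  proof (rule summable_on_if_infsum_ennreal_finite)
    obtain R where "0 \<le> R" "?S = ennreal R"
      using fin by (cases ?S) auto
    then show "(\<Sum>\<^sub>\<infinity>j\<in>D. ennreal (norm (x j))) < \<infinity>"
      using bound[of R] by (auto intro: le_less_trans)
  qed simp
qed

text \<open>
  A mass on the union is split first over \<open>D\<close> and then, from every \<open>j\<close>, over \<open>B j\<close>. If a unit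
  mass on \<open>B j\<close> costs at least \<open>r j / C\<close>, the whole costs at least \<open>1 / C\<close> times what the totals
  over the sets \<open>B j\<close> cost on \<open>D\<close>.
\<close>

lemma mass_cost_ge_UN:
  assumes p: "1 \<le> p" and c: "0 < c" "0 < C"
    and D: "mass_cost_ge p D r (C * c)" "\<And>j. j \<in> D \<Longrightarrow> 0 < r j"
    and B: "\<And>j. j \<in> D \<Longrightarrow> mass_cost_ge p (B j) r' (r j / C)"
    and cnt: "countable D" "\<And>j. j \<in> D \<Longrightarrow> countable (B j)"
    and disj: "\<And>j j' k. \<lbrakk>j \<in> D; j' \<in> D; k \<in> B j; k \<in> B j'\<rbrakk> \<Longrightarrow> j = j'"
  shows "mass_cost_ge p (\<Union>j\<in>D. B j) r' c"
proof (cases "p = 1")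
  case True
  have "c \<le> r' k" if "j \<in> D" "k \<in> B j" for j k
  proof -
    have 1: "C * c \<le> r j" and 2: "r j / C \<le> r' k"
      using True D(1) B[OF that(1)] that by (auto simp: mass_cost_ge_def)
    from 1 have "c \<le> r j / C"
      using c by (simp add: pos_le_divide_eq mult.commute)
    with 2 show ?thesis by simp
  qed
  then show ?thesis
    using True by (auto simp: mass_cost_ge_def)
next
  case False
  define q where "q = - 1 / (p - 1)"
  define \<phi> where "\<phi> k = (THE j. j \<in> D \<and> k \<in> B j)" for k
  have \<phi>: "\<phi> k = j" if "j \<in> D" "k \<in> B j" for j k
    unfolding \<phi>_def using that disj by (intro the_equality) auto
  let ?U = "\<Union>j\<in>D. B j"
  have "(\<Sum>\<^sub>\<infinity>k\<in>?U. ennreal (r' k powr q)) = (\<Sum>\<^sub>\<infinity>j\<in>D. \<Sum>\<^sub>\<infinity>k\<in>{k \<in> ?U. \<phi> k = j}. ennreal (r' k powr q))"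
    by (rule infsum_fibres_ennreal[symmetric]) (use cnt \<phi> in auto)
  also have "\<dots> = (\<Sum>\<^sub>\<infinity>j\<in>D. \<Sum>\<^sub>\<infinity>k\<in>B j. ennreal (r' k powr q))"
  proof (rule infsum_cong)
    fix j assume "j \<in> D"
    then have "{k \<in> ?U. \<phi> k = j} = B j" using \<phi> by auto
    then show "(\<Sum>\<^sub>\<infinity>k\<in>{k \<in> ?U. \<phi> k = j}. ennreal (r' k powr q)) = (\<Sum>\<^sub>\<infinity>k\<in>B j. ennreal (r' k powr q))"
      by simp
  qed
  also have "\<dots> \<le> (\<Sum>\<^sub>\<infinity>j\<in>D. ennreal ((r j / C) powr q))"
    using B False by (intro infsum_ennreal_mono) (auto simp: mass_cost_ge_def q_def)
  also have "\<dots> = (\<Sum>\<^sub>\<infinity>j\<in>D. ennreal (1 / C powr q) * ennreal (r j powr q))"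
    using c D(2) by (intro infsum_cong) (auto simp: powr_divide less_imp_le simp flip: ennreal_mult)
  also have "\<dots> = ennreal (1 / C powr q) * (\<Sum>\<^sub>\<infinity>j\<in>D. ennreal (r j powr q))"
    by (rule infsum_cmult_ennreal[OF cnt(1)])
  also have "\<dots> \<le> ennreal (1 / C powr q) * ennreal ((C * c) powr q)"
    using D(1) False by (intro mult_left_mono) (auto simp: mass_cost_ge_def q_def)
  also have "\<dots> = ennreal (c powr q)"
    using c by (simp add: powr_mult flip: ennreal_mult)
  finally show ?thesis
    using False by (simp add: mass_cost_ge_def q_def)
qed

section \<open>Translation of functions on the metric tree\<close>

lemma measurable_lebesgue_shift: "(\<lambda>s::real. s + c) \<in> lebesgue \<rightarrow>\<^sub>M lebesgue"
  using lebesgue_affine_measurable[of "\<lambda>_. 1" c] by (simp add: add.commute)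

lemma nn_integral_lebesgue_shift:
  assumes "h \<in> borel_measurable lebesgue"
  shows "(\<integral>\<^sup>+s. h (s + c :: real) \<partial>lebesgue) = (\<integral>\<^sup>+s. h s \<partial>lebesgue)"
  using nn_integral_real_affine_lebesgue[OF assms, of 1 c] by (simp add: add.commute)

abbreviation edge_borel :: "(real \<Rightarrow> 'b::topological_space) set" where
  "edge_borel \<equiv> borel_measurable edge_measure"

text \<open>
  Moving forward by \<open>\<theta> < 1\<close> along an edge leads to the same edge or to the next one. Extended by zero,
  the two branches become translates of functions on the whole line.
\<close>

lemma edge_shift_measurable:
  fixes g g' :: "real \<Rightarrow> 'k::euclidean_space"
  assumes \<theta>: "0 \<le> \<theta>" "\<theta> < 1" and gs: "g \<in> edge_borel" "g' \<in> edge_borel"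
  shows "(\<lambda>s. if s + \<theta> < 1 then g (s + \<theta>) else g' (s + \<theta> - 1)) \<in> edge_borel"
proof -
  have S: "{0..<1::real} \<in> sets lebesgue" by simp
  let ?z = "\<lambda>g r. if r \<in> {0..<1::real} then g r else (0::'k)"
  have [measurable]: "?z g \<in> borel_measurable lebesgue" "?z g' \<in> borel_measurable lebesgue"
    using gs by (simp_all only: borel_measurable_if[OF S])
  have "(\<lambda>s. ?z g (s + \<theta>) + ?z g' (s + (\<theta> - 1))) \<in> borel_measurable lebesgue"
    by (intro borel_measurable_add measurable_compose[OF measurable_lebesgue_shift]) measurable
  then have "(\<lambda>s. ?z g (s + \<theta>) + ?z g' (s + (\<theta> - 1))) \<in> edge_borel"
    by (rule measurable_restrict_space1)
  then show ?thesis
    by (rule measurable_cong[THEN iffD1, rotated]) (use \<theta> in \<open>auto simp: algebra_simps\<close>)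
qed

lemma edge_shift_integral:
  fixes h h' :: "real \<Rightarrow> ennreal"
  assumes \<theta>: "0 \<le> \<theta>" "\<theta> < 1"
    and h: "h \<in> edge_borel" "h' \<in> edge_borel"
  shows "(\<lambda>s. if s + \<theta> < 1 then h (s + \<theta>) else h' (s + \<theta> - 1)) \<in> edge_borel"
    and "(\<integral>\<^sup>+s. (if s + \<theta> < 1 then h (s + \<theta>) else h' (s + \<theta> - 1)) \<partial>edge_measure)
      = (\<integral>\<^sup>+r. (if \<theta> \<le> r then h r else h' r) \<partial>edge_measure)"
proof -
  have S: "{0..<1::real} \<in> sets lebesgue" by simp
  have hz: "(\<lambda>r. h r * indicator {0..<1} r) \<in> borel_measurable lebesgue"
    "(\<lambda>r. h' r * indicator {0..<1} r) \<in> borel_measurable lebesgue"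
    using h by (simp_all add: borel_measurable_restrict_space_iff_ennreal)
  define z where "z r = (h r * indicator {0..<1} r) * indicator {\<theta>..<1} r" for r
  define z' where "z' r = (h' r * indicator {0..<1} r) * indicator {0..<\<theta>} r" for r
  have z[measurable]: "z \<in> borel_measurable lebesgue" "z' \<in> borel_measurable lebesgue"
    unfolding z_def z'_def
    by (rule borel_measurable_times_ennreal[OF hz(1) borel_measurable_indicator], simp)
      (rule borel_measurable_times_ennreal[OF hz(2) borel_measurable_indicator], simp)
  let ?L = "\<lambda>s. if s + \<theta> < 1 then h (s + \<theta>) else h' (s + \<theta> - 1)"
  have eq: "?L s * indicator {0..<1} s = z (s + \<theta>) + z' (s + (\<theta> - 1))" for s
    using \<theta> by (auto simp: z_def z'_def indicator_def algebra_simps)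
  have [measurable]: "(\<lambda>s. z (s + \<theta>)) \<in> borel_measurable lebesgue"
    "(\<lambda>s. z' (s + (\<theta> - 1))) \<in> borel_measurable lebesgue"
    by (rule measurable_compose[OF measurable_lebesgue_shift], rule z)+
  have "(\<lambda>s. ?L s * indicator {0..<1} s) \<in> borel_measurable lebesgue"
    unfolding eq by measurable
  then show "?L \<in> edge_borel"
    by (simp add: borel_measurable_restrict_space_iff_ennreal)
  have "(\<integral>\<^sup>+s. ?L s \<partial>edge_measure) = (\<integral>\<^sup>+s. ?L s * indicator {0..<1} s \<partial>lebesgue)"
    by (rule nn_integral_restrict_space) simp
  also have "\<dots> = (\<integral>\<^sup>+s. z (s + \<theta>) \<partial>lebesgue) + (\<integral>\<^sup>+s. z' (s + (\<theta> - 1)) \<partial>lebesgue)"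
    unfolding eq by (rule nn_integral_add) measurable
  also have "\<dots> = (\<integral>\<^sup>+s. z s \<partial>lebesgue) + (\<integral>\<^sup>+s. z' s \<partial>lebesgue)"
    by (simp only: nn_integral_lebesgue_shift z)
  also have "\<dots> = (\<integral>\<^sup>+s. z s + z' s \<partial>lebesgue)"
    by (rule nn_integral_add[symmetric]) measurable
  also have "\<dots> = (\<integral>\<^sup>+s. (if \<theta> \<le> s then h s else h' s) * indicator {0..<1} s \<partial>lebesgue)"
    using \<theta> by (intro nn_integral_cong) (auto simp: z_def z'_def indicator_def)
  also have "\<dots> = (\<integral>\<^sup>+s. (if \<theta> \<le> s then h s else h' s) \<partial>edge_measure)"
    by (rule nn_integral_restrict_space[symmetric]) simp
  finally show "(\<integral>\<^sup>+s. ?L s \<partial>edge_measure) = (\<integral>\<^sup>+r. (if \<theta> \<le> r then h r else h' r) \<partial>edge_measure)" .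
qed

text \<open>
  The point \<open>s\<close>, moved forward by \<open>t\<close>, crosses \<open>steps t s\<close> ends of edges and arrives at \<open>pos t s\<close>.
\<close>

abbreviation pos :: "real \<Rightarrow> real \<Rightarrow> real" where
  "pos t s \<equiv> t + s - real (steps t s)"

lemma steps_pos_eq:
  assumes "0 \<le> t" "0 \<le> s" "s < 1"
  shows "steps t s = (if s + frac t < 1 then nat \<lfloor>t\<rfloor> else Suc (nat \<lfloor>t\<rfloor>))"
    and "pos t s = (if s + frac t < 1 then s + frac t else s + frac t - 1)"
proof -
  define n \<theta> where "n = nat \<lfloor>t\<rfloor>" and "\<theta> = frac t"
  have t: "t = real n + \<theta>" and \<theta>: "0 \<le> \<theta>" "\<theta> < 1"
    using assms by (simp_all add: n_def \<theta>_def frac_def frac_lt_1) linarith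
  have "steps t s = (if s + \<theta> < 1 then n else Suc n) \<and>
      pos t s = (if s + \<theta> < 1 then s + \<theta> else s + \<theta> - 1)"
  proof (cases "s + \<theta> < 1")
    case True
    then have "\<lfloor>s + t\<rfloor> = int n"
      using assms \<theta> t by (intro floor_unique) auto
    then show ?thesis using True t by simp
  next
    case False
    then have "\<lfloor>s + t\<rfloor> = int (Suc n)"
      using assms \<theta> t by (intro floor_unique) auto
    then have "steps t s = Suc n" by simp
    then show ?thesis using False t by simp
  qed
  then show "steps t s = (if s + frac t < 1 then nat \<lfloor>t\<rfloor> else Suc (nat \<lfloor>t\<rfloor>))"
    and "pos t s = (if s + frac t < 1 then s + frac t else s + frac t - 1)"
    unfolding n_def \<theta>_def by blast+
qed

lemma pos_in:
  assumes "0 \<le> t" "0 \<le> s" "s < 1"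
  shows "0 \<le> pos t s" "pos t s < 1"
  using steps_pos_eq(2)[OF assms] assms frac_lt_1[of t] frac_ge_0[of t] by (auto split: if_splits)

lemma steps_pos_add:
  assumes "0 \<le> t" "0 \<le> u" "0 \<le> s" "s < 1"
  shows "steps (t + u) s = steps t s + steps u (pos t s)" and "pos (t + u) s = pos u (pos t s)"
proof -
  have "\<lfloor>s + (t + u)\<rfloor> = \<lfloor>pos t s + u\<rfloor> + int (steps t s)"
    using floor_add_int[of "pos t s + u" "int (steps t s)"] by (simp add: algebra_simps)
  then show 1: "steps (t + u) s = steps t s + steps u (pos t s)"
    using assms pos_in[OF assms(1,3,4)] by (simp add: nat_add_distrib)
  show "pos (t + u) s = pos u (pos t s)"
    unfolding 1 by simp
qed

context edge_tree
begin

abbreviation \<T> :: "real \<Rightarrow> ('i, 'k::real_normed_field) edge_fun \<Rightarrow> ('i, 'k) edge_fun" where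
  "\<T> \<equiv> translate I e"

lemma translate_eq:
  "i \<in> I \<Longrightarrow> \<T> t f i s = (\<Sum>\<^sub>\<infinity>j\<in>D (steps t s) i. f j (pos t s))"
  unfolding translate_def Let_def
  by (intro infsum_cong) (auto simp: adj_pow_eq descendants_eq)

lemma translate_measurable:
  fixes f :: "('i, 'k::{real_normed_field, euclidean_space}) edge_fun"
  assumes t: "0 \<le> t" and f: "\<And>i. i \<in> I \<Longrightarrow> f i \<in> edge_borel" and i: "i \<in> I"
  shows "\<T> t f i \<in> edge_borel"
proof -
  define g where "g n r = (\<Sum>\<^sub>\<infinity>j\<in>D n i. f j r)" for n r
  have [measurable]: "g n \<in> edge_borel" for n
    unfolding g_def using f descendants_subset
    by (intro borel_measurable_infsum countable_descendants) blast
  have "(\<lambda>s. if s + frac t < 1 then g (nat \<lfloor>t\<rfloor>) (s + frac t) else g (Suc (nat \<lfloor>t\<rfloor>)) (s + frac t - 1))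
      \<in> edge_borel"
    by (rule edge_shift_measurable) (simp_all add: frac_lt_1)
  then show ?thesis
    by (rule measurable_cong[THEN iffD1, rotated])
      (use t steps_pos_eq[OF t] in \<open>auto simp: translate_eq[OF i] g_def\<close>)
qed

text \<open>
  Going back by \<open>t\<close> maps the metric tree onto itself, and on every edge it is a translation, up
  to the cut at an integer point. Hence summing a nonnegative function over the fibres of this
  map does not change the total integral.
\<close>

lemma infsum_integral_translate:
  fixes h :: "'i \<Rightarrow> real \<Rightarrow> ennreal"
  assumes t: "0 \<le> t" and h: "\<And>j. j \<in> I \<Longrightarrow> h j \<in> edge_borel"
  shows "\<And>i. i \<in> I \<Longrightarrow>
      (\<lambda>s. \<Sum>\<^sub>\<infinity>j\<in>D (steps t s) i. h j (pos t s)) \<in> edge_borel"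
    and "(\<Sum>\<^sub>\<infinity>i\<in>I. \<integral>\<^sup>+s. (\<Sum>\<^sub>\<infinity>j\<in>D (steps t s) i. h j (pos t s)) \<partial>edge_measure)
      = (\<Sum>\<^sub>\<infinity>j\<in>I. \<integral>\<^sup>+r. h j r \<partial>edge_measure)"
proof -
  let ?a = "nat \<lfloor>t\<rfloor>"
  define H where "H n i r = (\<Sum>\<^sub>\<infinity>j\<in>D n i. h j r)" for n i r
  have H[measurable]: "H n i \<in> edge_borel" for n i
    unfolding H_def using h descendants_subset
    by (intro borel_measurable_infsum_ennreal countable_descendants) blast
  have eq: "(\<Sum>\<^sub>\<infinity>j\<in>D (steps t s) i. h j (pos t s)) =
      (if s + frac t < 1 then H ?a i (s + frac t) else H (Suc ?a) i (s + frac t - 1))"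
    if "s \<in> space edge_measure" for i s
    using that steps_pos_eq[OF t, of s] by (auto simp: H_def)
  note shift = edge_shift_integral[OF frac_ge_0 frac_lt_1 H H, of t]
  show "(\<lambda>s. \<Sum>\<^sub>\<infinity>j\<in>D (steps t s) i. h j (pos t s)) \<in> edge_borel" for i
    by (rule measurable_cong[OF eq, THEN iffD2]) (auto intro: shift)
  have "(\<Sum>\<^sub>\<infinity>i\<in>I. \<integral>\<^sup>+s. (\<Sum>\<^sub>\<infinity>j\<in>D (steps t s) i. h j (pos t s)) \<partial>edge_measure)
      = (\<Sum>\<^sub>\<infinity>i\<in>I. \<integral>\<^sup>+r. (if frac t \<le> r then H ?a i r else H (Suc ?a) i r) \<partial>edge_measure)"
    by (simp only: nn_integral_cong[OF eq] shift)
  also have "\<dots> = (\<integral>\<^sup>+r. (\<Sum>\<^sub>\<infinity>i\<in>I. if frac t \<le> r then H ?a i r else H (Suc ?a) i r) \<partial>edge_measure)"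
  proof (rule nn_integral_infsum[OF countable_index, symmetric])
    have "{r \<in> space edge_measure. frac t \<le> r} = {frac t..<1}"
      by (auto intro: order_trans[OF frac_ge_0])
    moreover have "{frac t..<1} \<in> sets edge_measure"
      by (auto simp: sets_restrict_space_iff intro: order_trans[OF frac_ge_0])
    ultimately show "(\<lambda>r. if frac t \<le> r then H ?a i r else H (Suc ?a) i r) \<in> edge_borel" for i
      by (intro measurable_If H) simp
  qed
  also have "\<dots> = (\<integral>\<^sup>+r. (\<Sum>\<^sub>\<infinity>j\<in>I. h j r) \<partial>edge_measure)"
  proof (rule nn_integral_cong)
    show "(\<Sum>\<^sub>\<infinity>i\<in>I. if frac t \<le> r then H ?a i r else H (Suc ?a) i r) = (\<Sum>\<^sub>\<infinity>j\<in>I. h j r)" for r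
      by (cases "frac t \<le> r") (simp_all add: H_def infsum_descendants)
  qed
  also have "\<dots> = (\<Sum>\<^sub>\<infinity>j\<in>I. \<integral>\<^sup>+r. h j r \<partial>edge_measure)"
    by (rule nn_integral_infsum[OF countable_index h])
  finally show "(\<Sum>\<^sub>\<infinity>i\<in>I. \<integral>\<^sup>+s. (\<Sum>\<^sub>\<infinity>j\<in>D (steps t s) i. h j (pos t s)) \<partial>edge_measure)
      = (\<Sum>\<^sub>\<infinity>j\<in>I. \<integral>\<^sup>+r. h j r \<partial>edge_measure)" .
qed

lemma translate_translate_eq:
  fixes f :: "('i, 'k::{real_normed_field, euclidean_space}) edge_fun"
  assumes tu: "0 \<le> t" "0 \<le> u" and s: "0 \<le> s" "s < 1" and i: "i \<in> I"
    and summable: "(\<lambda>k. f k (pos (t + u) s)) summable_on D (steps (t + u) s) i"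
  shows "\<T> t (\<T> u f) i s = \<T> (t + u) f i s"
proof -
  define n m v where "n = steps t s" and "m = steps u (pos t s)" and "v = pos u (pos t s)"
  have add: "steps (t + u) s = n + m" "pos (t + u) s = v"
    unfolding n_def m_def v_def by (rule steps_pos_add[OF tu s])+
  have bij: "bij_betw snd (Sigma (D n i) (D m)) (D (n + m) i)"
    unfolding bij_betw_def
  proof
    show "inj_on snd (Sigma (D n i) (D m))"
    proof (rule inj_onI)
      fix x y assume "x \<in> Sigma (D n i) (D m)" "y \<in> Sigma (D n i) (D m)" "snd x = snd y"
      then have "snd x \<in> D m (fst x)" "snd x \<in> D m (fst y)" "fst x \<in> I" "fst y \<in> I"
        by (auto dest: subsetD[OF descendants_subset])
      then show "x = y"
        using descendants_disjoint \<open>snd x = snd y\<close> by (simp add: prod_eq_iff)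
    qed
    show "snd ` Sigma (D n i) (D m) = D (n + m) i"
      unfolding descendants_add[OF i] by (auto simp: image_iff)
  qed
  have "(\<lambda>x. f (snd x) v) summable_on Sigma (D n i) (D m)"
    using summable_on_reindex_bij_betw[OF bij, of "\<lambda>k. f k v"] summable unfolding add(2) unfolding add(1) by blast
  then have "(\<lambda>(j, k). f k v) summable_on Sigma (D n i) (D m)"
    by (simp only: case_prod_unfold)
  then have "(\<Sum>\<^sub>\<infinity>j\<in>D n i. \<Sum>\<^sub>\<infinity>k\<in>D m j. f k v) = (\<Sum>\<^sub>\<infinity>(j, k)\<in>Sigma (D n i) (D m). f k v)"
    by (rule infsum_Sigma'_banach)
  also have "\<dots> = (\<Sum>\<^sub>\<infinity>k\<in>D (n + m) i. f k v)"
    using infsum_reindex_bij_betw[OF bij, of "\<lambda>k. f k v"] by (simp only: case_prod_unfold)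
  finally have "(\<Sum>\<^sub>\<infinity>j\<in>D n i. \<Sum>\<^sub>\<infinity>k\<in>D m j. f k v) = \<T> (t + u) f i s"
    unfolding translate_eq[OF i] add(2) unfolding add(1) .
  moreover have "\<T> t (\<T> u f) i s = (\<Sum>\<^sub>\<infinity>j\<in>D n i. \<Sum>\<^sub>\<infinity>k\<in>D m j. f k v)"
    unfolding translate_eq[OF i] n_def[symmetric]
  proof (rule infsum_cong)
    fix j assume "j \<in> D n i"
    then have "j \<in> I" using descendants_subset by blast
    show "\<T> u f j (t + s - real n) = (\<Sum>\<^sub>\<infinity>k\<in>D m j. f k v)"
      unfolding translate_eq[OF \<open>j \<in> I\<close>] m_def v_def n_def by (rule refl)
  qed
  ultimately show ?thesis by (simp only:)
qed

end

section \<open>Admissible weights\<close>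

text \<open>
  The growth factor \<open>(M * exp (w * t)) powr p\<close> of an admissible weight, made nondecreasing in \<open>t\<close>
  by taking \<open>\<bar>w\<bar>\<close> for \<open>w\<close>, becomes a function \<open>K\<close>.
\<close>

locale weighted_tree = edge_tree I e par
  for I :: "'i set" and e :: "'i \<Rightarrow> 'v \<times> 'v" and par :: "'i \<Rightarrow> 'i" +
  fixes p :: real and \<rho> :: "('i, real) edge_fun" and K :: "real \<Rightarrow> real"
  assumes p_ge_1: "1 \<le> p"
    and \<rho>_pos: "\<lbrakk>i \<in> I; 0 \<le> s; s < 1\<rbrakk> \<Longrightarrow> 0 < \<rho> i s"
    and \<rho>_integrable: "i \<in> I \<Longrightarrow> integrable edge_measure (\<rho> i)"
    and K_ge_1: "0 \<le> t \<Longrightarrow> 1 \<le> K t"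
    and K_mono: "\<lbrakk>0 \<le> t; t \<le> t'\<rbrakk> \<Longrightarrow> K t \<le> K t'"
    and descendants_cost: "\<lbrakk>i \<in> I; 0 \<le> s; s < 1; 0 \<le> t\<rbrakk> \<Longrightarrow>
      mass_cost_ge p (D (steps t s) i) (\<lambda>j. \<rho> j (pos t s)) (\<rho> i s / K t)"

lemma (in edge_tree) weighted_tree_exists:
  assumes "admissible I e p \<rho>"
  obtains K where "weighted_tree I e par p \<rho> K"
proof -
  have p: "1 \<le> p" and w: "weight I \<rho>" and pos: "\<And>i s. i \<in> I \<Longrightarrow> 0 \<le> s \<Longrightarrow> s < 1 \<Longrightarrow> 0 < \<rho> i s"
    using assms by (auto simp: admissible_def)
  have "\<exists>M\<ge>1. \<exists>w. \<forall>i\<in>I. \<forall>s\<in>{0..<1::real}. \<forall>t\<ge>0.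
      (p = 1 \<longrightarrow> ennreal (\<rho> i s) \<le> ennreal (M * exp (w * t)) *
          (INF j\<in>D (steps t s) i. ennreal (\<rho> j (s + t - real (steps t s))))) \<and>
      (1 < p \<longrightarrow> (\<lambda>j. \<rho> j (s + t - real (steps t s)) powr (- 1 / (p - 1))) summable_on D (steps t s) i \<and>
          (\<Sum>\<^sub>\<infinity>j\<in>D (steps t s) i. \<rho> j (s + t - real (steps t s)) powr (- 1 / (p - 1))) powr (p - 1)
            \<le> M powr p * exp (p * w * t) * (1 / \<rho> i s))"
    using assms unfolding admissible_def Let_def by (elim conjE)
  then obtain M w where M: "1 \<le> M" and adm: "\<forall>i\<in>I. \<forall>s\<in>{0..<1::real}. \<forall>t\<ge>0.
      (p = 1 \<longrightarrow> ennreal (\<rho> i s) \<le> ennreal (M * exp (w * t)) *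
          (INF j\<in>D (steps t s) i. ennreal (\<rho> j (s + t - real (steps t s))))) \<and>
      (1 < p \<longrightarrow> (\<lambda>j. \<rho> j (s + t - real (steps t s)) powr (- 1 / (p - 1))) summable_on D (steps t s) i \<and>
          (\<Sum>\<^sub>\<infinity>j\<in>D (steps t s) i. \<rho> j (s + t - real (steps t s)) powr (- 1 / (p - 1))) powr (p - 1)
            \<le> M powr p * exp (p * w * t) * (1 / \<rho> i s))"
    by (elim exE conjE)
  define K where "K t = M powr p * exp (p * \<bar>w\<bar> * t)" for t
  have K1: "1 \<le> K t" if "0 \<le> t" for t
    unfolding K_def using that M p mult_mono[of 1 "M powr p" 1 "exp (p * \<bar>w\<bar> * t)"]
    by (simp add: ge_one_powr_ge_zero)
  have "weighted_tree I e par p \<rho> K"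
  proof
    fix i and s t :: real assume i: "i \<in> I" and s: "0 \<le> s" "s < 1" and t: "0 \<le> t"
    let ?D = "D (steps t s) i" and ?r = "pos t s"
    have "s \<in> {0..<1}" using s by simp
    moreover have eq: "s + t - real (steps t s) = ?r" by simp
    ultimately have adm1: "p = 1 \<Longrightarrow> ennreal (\<rho> i s) \<le> ennreal (M * exp (w * t)) *
          (INF j\<in>?D. ennreal (\<rho> j ?r))"
      and adm2: "1 < p \<Longrightarrow> (\<lambda>j. \<rho> j ?r powr (- 1 / (p - 1))) summable_on ?D"
        "1 < p \<Longrightarrow> (\<Sum>\<^sub>\<infinity>j\<in>?D. \<rho> j ?r powr (- 1 / (p - 1))) powr (p - 1)
            \<le> M powr p * exp (p * w * t) * (1 / \<rho> i s)"
      using adm[THEN bspec, OF i, THEN bspec, of s, THEN spec, THEN mp, OF _ t, unfolded eq]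
      by blast+
    have r: "0 < \<rho> j ?r" if "j \<in> ?D" for j
      by (rule pos[OF subsetD[OF descendants_subset that] pos_in[OF t s]])
    show "mass_cost_ge p ?D (\<lambda>j. \<rho> j ?r) (\<rho> i s / K t)"
    proof (rule mass_cost_ge_mono[OF p])
      let ?k = "M powr p * exp (p * w * t)"
      have k: "0 < ?k" using M by simp
      have "w * t \<le> \<bar>w\<bar> * t"
        using t by (intro mult_right_mono) auto
      then have "p * w * t \<le> p * \<bar>w\<bar> * t"
        using p by (simp add: mult.assoc)
      then have kK: "?k \<le> K t"
        unfolding K_def using M by (intro mult_left_mono) auto
      show "0 < \<rho> i s / K t"
        using pos[OF i s] K1[OF t] by simp
      show "\<rho> i s / K t \<le> \<rho> i s / ?k"
        using pos[OF i s] kK k by (intro divide_left_mono) auto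
      show "mass_cost_ge p ?D (\<lambda>j. \<rho> j ?r) (\<rho> i s / ?k)"
      proof (cases "p = 1")
        case True
        have "\<rho> i s / ?k \<le> \<rho> j ?r" if j: "j \<in> ?D" for j
        proof -
          have "ennreal (\<rho> i s) \<le> ennreal (M * exp (w * t)) * (INF j\<in>?D. ennreal (\<rho> j ?r))"
            by (rule adm1[OF True])
          also have "\<dots> \<le> ennreal (M * exp (w * t)) * ennreal (\<rho> j ?r)"
            by (intro mult_left_mono INF_lower[OF j]) simp
          finally have "\<rho> i s \<le> M * exp (w * t) * \<rho> j ?r"
            using M r[OF j] by (simp flip: ennreal_mult)
          then show ?thesis
            using True k M by (simp add: divide_le_eq mult.commute)
        qed
        then show ?thesis using True by (simp add: mass_cost_ge_def)
      next
        case False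
        then have p1: "1 < p" using p by simp
        define S where "S = (\<Sum>\<^sub>\<infinity>j\<in>?D. \<rho> j ?r powr (- 1 / (p - 1)))"
        have S0: "0 \<le> S" unfolding S_def by (rule infsum_nonneg) simp
        have "S powr (p - 1) \<le> ?k / \<rho> i s"
          using adm2(2)[OF p1] by (simp add: S_def)
        then have "(S powr (p - 1)) powr (1 / (p - 1)) \<le> (?k / \<rho> i s) powr (1 / (p - 1))"
          using p1 by (intro powr_mono2) auto
        also have "(S powr (p - 1)) powr (1 / (p - 1)) = S"
          using p1 S0 by (simp add: powr_powr)
        also have "(?k / \<rho> i s) powr (1 / (p - 1)) = (\<rho> i s / ?k) powr (- 1 / (p - 1))"
          using k pos[OF i s] by (simp add: powr_divide powr_minus field_simps)
        finally have "ennreal S \<le> ennreal ((\<rho> i s / ?k) powr (- 1 / (p - 1)))"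
          by (rule ennreal_leI)
        moreover have "ennreal S = (\<Sum>\<^sub>\<infinity>j\<in>?D. ennreal (\<rho> j ?r powr (- 1 / (p - 1))))"
          unfolding S_def by (rule ennreal_infsum[OF adm2(1)[OF p1]]) simp
        ultimately show ?thesis
          using False by (simp add: mass_cost_ge_def)
      qed
    qed
  next
    fix t t' :: real assume "0 \<le> t" "t \<le> t'"
    then show "K t \<le> K t'"
      unfolding K_def using M p by (intro mult_left_mono) (auto intro: mult_left_mono)
  qed (use p w pos K1 in \<open>auto simp: weight_def\<close>)
  then show ?thesis by (rule that)
qed

context weighted_tree
begin

lemma \<rho>_measurable: "i \<in> I \<Longrightarrow> \<rho> i \<in> edge_borel"
  using \<rho>_integrable by auto

text \<open>
  Admissibility bounds the translation pointwise, before integration; here the sum that defines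
  it may be divergent, in which case its value is \<open>0\<close>.
\<close>

lemma norm_translate_powr_le:
  fixes f :: "('i, 'k::{real_normed_field, euclidean_space}) edge_fun"
  assumes i: "i \<in> I" and s: "0 \<le> s" "s < 1" and t: "0 \<le> t"
  shows "ennreal (norm (\<T> t f i s) powr p * \<rho> i s)
      \<le> ennreal (K t) * (\<Sum>\<^sub>\<infinity>j\<in>D (steps t s) i. ennreal (norm (f j (pos t s)) powr p * \<rho> j (pos t s)))"
    and "(\<Sum>\<^sub>\<infinity>j\<in>D (steps t s) i. ennreal (norm (f j (pos t s)) powr p * \<rho> j (pos t s))) < \<infinity> \<Longrightarrow>
      (\<lambda>j. norm (f j (pos t s))) summable_on D (steps t s) i"
proof -
  let ?D = "D (steps t s) i" and ?r = "pos t s"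
  let ?S = "\<Sum>\<^sub>\<infinity>j\<in>?D. ennreal (norm (f j ?r) powr p * \<rho> j ?r)"
  have K: "0 < K t" using K_ge_1[OF t] by simp
  have \<rho>: "0 < \<rho> i s" by (rule \<rho>_pos[OF i s])
  have \<rho>_r: "0 < \<rho> j ?r" if "j \<in> ?D" for j
    by (rule \<rho>_pos[OF subsetD[OF descendants_subset that] pos_in[OF t s]])
  note cost = mass_cost_ge_norm_infsum_le[OF p_ge_1 divide_pos_pos[OF \<rho> K] descendants_cost[OF i s t] \<rho>_r,
      of "\<lambda>j. f j ?r"]
  have "ennreal (norm (\<T> t f i s) powr p * \<rho> i s)
      = ennreal (K t) * ennreal (\<rho> i s / K t * norm (\<T> t f i s) powr p)"
    using K \<rho> by (simp add: mult.commute flip: ennreal_mult)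
  also have "\<dots> \<le> ennreal (K t) * ?S"
    unfolding translate_eq[OF i] by (intro mult_left_mono cost(1)) simp_all
  finally show "ennreal (norm (\<T> t f i s) powr p * \<rho> i s) \<le> ennreal (K t) * ?S" .
  show "(\<lambda>j. norm (f j ?r)) summable_on ?D" if "?S < \<infinity>"
    by (rule cost(2)) (use that in simp_all)
qed

lemma powr_measurable:
  fixes f :: "('i, 'k::{real_normed_vector, second_countable_topology}) edge_fun"
  assumes "f i \<in> edge_borel" "i \<in> I"
  shows "(\<lambda>s. ennreal (norm (f i s) powr p * \<rho> i s)) \<in> edge_borel"
  using assms \<rho>_measurable[of i] by measurable

lemma Lp_sum_translate_le:
  fixes f :: "('i, 'k::{real_normed_field, euclidean_space}) edge_fun"
  assumes t: "0 \<le> t" and f: "\<And>i. i \<in> I \<Longrightarrow> f i \<in> edge_borel"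
  shows "Lp_sum I \<rho> p (\<T> t f) \<le> ennreal (K t) * Lp_sum I \<rho> p f"
proof -
  let ?h = "\<lambda>j s. ennreal (norm (f j s) powr p * \<rho> j s)"
  have h: "?h j \<in> edge_borel" if "j \<in> I" for j
    using powr_measurable f that by blast
  let ?H = "\<lambda>i s. \<Sum>\<^sub>\<infinity>j\<in>D (steps t s) i. ?h j (pos t s)"
  have "Lp_sum I \<rho> p (\<T> t f) \<le> (\<Sum>\<^sub>\<infinity>i\<in>I. \<integral>\<^sup>+s. ennreal (K t) * ?H i s \<partial>edge_measure)"
    unfolding Lp_sum_def
    by (intro infsum_ennreal_mono nn_integral_mono norm_translate_powr_le t) auto
  also have "\<dots> = (\<Sum>\<^sub>\<infinity>i\<in>I. ennreal (K t) * (\<integral>\<^sup>+s. ?H i s \<partial>edge_measure))"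
    by (intro infsum_cong nn_integral_cmult infsum_integral_translate(1)[OF t h])
  also have "\<dots> = ennreal (K t) * (\<Sum>\<^sub>\<infinity>i\<in>I. \<integral>\<^sup>+s. ?H i s \<partial>edge_measure)"
    by (rule infsum_cmult_ennreal[OF countable_index])
  also have "\<dots> = ennreal (K t) * Lp_sum I \<rho> p f"
    unfolding Lp_sum_def using infsum_integral_translate(2)[OF t h] by simp
  finally show ?thesis .
qed

text \<open>
  The weighted sums over the fibres have a finite integral, hence they are finite almost
  everywhere; a positive cost then makes the fibres absolutely summable. Linearity and the
  semigroup law hold at these points.
\<close>

lemma AE_summable_translate:
  fixes f :: "('i, 'k::{real_normed_field, euclidean_space}) edge_fun"
  assumes t: "0 \<le> t" and f: "f \<in> Lp_fun I \<rho> p" and i: "i \<in> I"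
  shows "AE s in edge_measure. (\<lambda>j. f j (pos t s)) summable_on D (steps t s) i"
proof -
  let ?h = "\<lambda>j s. ennreal (norm (f j s) powr p * \<rho> j s)"
  have h: "?h j \<in> edge_borel" if "j \<in> I" for j
    using powr_measurable f that by (auto simp: Lp_fun_def)
  let ?H = "\<lambda>i s. \<Sum>\<^sub>\<infinity>j\<in>D (steps t s) i. ?h j (pos t s)"
  have "(\<integral>\<^sup>+s. ?H i s \<partial>edge_measure) \<le> Lp_sum I \<rho> p f"
    using le_infsum_ennreal[OF i, of "\<lambda>i. \<integral>\<^sup>+s. ?H i s \<partial>edge_measure"]
      infsum_integral_translate(2)[OF t h] by (simp add: Lp_sum_def)
  then have "(\<integral>\<^sup>+s. ?H i s \<partial>edge_measure) \<noteq> \<infinity>"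
    using f by (auto simp: Lp_fun_def top_unique)
  then have "AE s in edge_measure. ?H i s \<noteq> \<infinity>"
    by (intro nn_integral_PInf_AE infsum_integral_translate(1)[OF t h i])
  then show ?thesis
  proof (rule AE_mp, intro AE_I2 impI)
    fix s assume s: "s \<in> space edge_measure" "?H i s \<noteq> \<infinity>"
    then have "(\<lambda>j. norm (f j (pos t s))) summable_on D (steps t s) i"
      by (intro norm_translate_powr_le(2) i t) (auto simp: less_top)
    then show "(\<lambda>j. f j (pos t s)) summable_on D (steps t s) i"
      by (rule abs_summable_summable)
  qed
qed

lemma translate_in_Lp_fun:
  fixes f :: "('i, 'k::{real_normed_field, euclidean_space}) edge_fun"
  assumes t: "0 \<le> t" and f: "f \<in> Lp_fun I \<rho> p"
  shows "\<T> t f \<in> Lp_fun I \<rho> p"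
proof -
  have "Lp_sum I \<rho> p (\<T> t f) \<le> ennreal (K t) * Lp_sum I \<rho> p f"
    using f by (intro Lp_sum_translate_le t) (auto simp: Lp_fun_def)
  also have "\<dots> < \<infinity>"
    using f by (simp add: Lp_fun_def ennreal_mult_less_top)
  finally show ?thesis
    using translate_measurable[OF t] f by (auto simp: Lp_fun_def)
qed

lemma AE_translate_diff:
  fixes f g :: "('i, 'k::{real_normed_field, euclidean_space}) edge_fun"
  assumes t: "0 \<le> t" and "f \<in> Lp_fun I \<rho> p" "g \<in> Lp_fun I \<rho> p" and i: "i \<in> I"
  shows "AE s in edge_measure. \<T> t (\<lambda>i s. f i s - g i s) i s
      = \<T> t f i s - \<T> t g i s"
  using AE_summable_translate[OF t assms(2) i] AE_summable_translate[OF t assms(3) i]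
proof eventually_elim
  case (elim s)
  then show ?case
    using infsum_add[of "\<lambda>j. f j (pos t s)" "D (steps t s) i" "\<lambda>j. - g j (pos t s)"]
    by (simp add: translate_eq[OF i] infsum_uminus summable_on_uminus)
qed

lemma AE_translate_translate:
  fixes f :: "('i, 'k::{real_normed_field, euclidean_space}) edge_fun"
  assumes tu: "0 \<le> t" "0 \<le> u" and f: "f \<in> Lp_fun I \<rho> p" and i: "i \<in> I"
  shows "AE s in edge_measure. \<T> t (\<T> u f) i s = \<T> (t + u) f i s"
  using AE_summable_translate[OF add_nonneg_nonneg[OF tu] f i]
proof (rule AE_mp, intro AE_I2 impI)
  fix s assume "s \<in> space edge_measure" "(\<lambda>j. f j (pos (t + u) s)) summable_on D (steps (t + u) s) i"
  then show "\<T> t (\<T> u f) i s = \<T> (t + u) f i s"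
    by (intro translate_translate_eq[OF tu _ _ i]) auto
qed

end

section \<open>The space as a complete separable metric space\<close>

context weighted_tree
begin

text \<open>
  A family of functions on the edges is the same as one function on \<open>I \<times> [0, 1)\<close>, and the sum of
  weighted integrals is one integral. General facts about \<open>L\<^sup>p\<close> then apply.
\<close>

definition tree_measure :: "('i \<times> real) measure" where
  "tree_measure = density (count_space I \<Otimes>\<^sub>M edge_measure) (\<lambda>(i, s). ennreal (\<rho> i s))"

lemma tree_measurable_iff:
  fixes f :: "('i, 'k::{second_countable_topology, real_normed_vector}) edge_fun"
  shows "case_prod f \<in> borel_measurable tree_measure \<longleftrightarrow> (\<forall>i\<in>I. f i \<in> edge_borel)"
proof
  assume f: "case_prod f \<in> borel_measurable tree_measure"
  have "f i \<in> edge_borel" if "i \<in> I" for i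
  proof -
    have "Pair i \<in> edge_measure \<rightarrow>\<^sub>M tree_measure"
      using measurable_Pair1'[of i "count_space I" edge_measure] that
      by (simp add: tree_measure_def)
    from measurable_compose[OF this f] show ?thesis by simp
  qed
  then show "\<forall>i\<in>I. f i \<in> edge_borel" by blast
next
  assume "\<forall>i\<in>I. f i \<in> edge_borel"
  then show "case_prod f \<in> borel_measurable tree_measure"
    unfolding tree_measure_def
    by (simp add: measurable_pair_measure_countable1[OF countable_index])
qed

lemma Lp_sum_eq_integral:
  fixes f :: "('i, 'k::{second_countable_topology, real_normed_vector}) edge_fun"
  assumes f: "\<And>i. i \<in> I \<Longrightarrow> f i \<in> edge_borel"
  shows "Lp_sum I \<rho> p f = (\<integral>\<^sup>+x. ennreal (norm (case_prod f x) powr p) \<partial>tree_measure)"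
proof -
  let ?M = "count_space I \<Otimes>\<^sub>M edge_measure"
  have "emeasure edge_measure (space edge_measure) \<noteq> \<infinity>"
    by (simp add: emeasure_restrict_space)
  then interpret edge: finite_measure edge_measure
    by (rule finite_measureI)
  have m1: "(\<lambda>(i, s). ennreal (\<rho> i s)) \<in> borel_measurable ?M"
    using \<rho>_measurable by (intro measurable_pair_measure_countable1[OF countable_index]) simp
  have m2: "(\<lambda>x. ennreal (norm (case_prod f x) powr p)) \<in> borel_measurable ?M"
    using f by (intro measurable_pair_measure_countable1[OF countable_index]) simp
  have "(\<integral>\<^sup>+x. ennreal (norm (case_prod f x) powr p) \<partial>tree_measure)
      = (\<integral>\<^sup>+x. (\<lambda>(i, s). ennreal (\<rho> i s)) x * ennreal (norm (case_prod f x) powr p) \<partial>?M)"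
    unfolding tree_measure_def by (rule nn_integral_density[OF m1 m2])
  also have "\<dots> = (\<integral>\<^sup>+i. \<integral>\<^sup>+s. (\<lambda>(i, s). ennreal (\<rho> i s)) (i, s) * ennreal (norm (case_prod f (i, s)) powr p)
      \<partial>edge_measure \<partial>count_space I)"
    by (rule edge.nn_integral_fst[symmetric]) (intro borel_measurable_times_ennreal m1 m2)
  also have "\<dots> = (\<integral>\<^sup>+i. \<integral>\<^sup>+s. ennreal (norm (f i s) powr p * \<rho> i s) \<partial>edge_measure \<partial>count_space I)"
  proof (intro nn_integral_cong)
    fix i s assume "i \<in> space (count_space I)" "s \<in> space edge_measure"
    then have "0 \<le> \<rho> i s" by (simp add: \<rho>_pos less_imp_le)
    then show "(\<lambda>(i, s). ennreal (\<rho> i s)) (i, s) * ennreal (norm (case_prod f (i, s)) powr p)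
        = ennreal (norm (f i s) powr p * \<rho> i s)"
      by (simp add: ennreal_mult mult.commute)
  qed
  also have "\<dots> = Lp_sum I \<rho> p f"
    unfolding Lp_sum_def by (rule infsum_ennreal_eq_nn_integral[OF countable_index, symmetric])
  finally show ?thesis by simp
qed

abbreviation \<L> :: "('i, 'k::{real_normed_field, euclidean_space}) edge_fun set" where
  "\<L> \<equiv> Lp_fun I \<rho> p"

abbreviation N :: "('i, 'k::{real_normed_field, euclidean_space}) edge_fun \<Rightarrow> real" where
  "N \<equiv> Lp_norm I \<rho> p"

abbreviation dst :: "('i, 'k::{real_normed_field, euclidean_space}) edge_fun \<Rightarrow> ('i, 'k) edge_fun \<Rightarrow> real" where
  "dst f g \<equiv> N (\<lambda>i s. f i s - g i s)"

lemma N_nonneg: "0 \<le> N f"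
  by (simp add: Lp_norm_def)

lemma \<L>_measurable: "f \<in> \<L> \<Longrightarrow> i \<in> I \<Longrightarrow> f i \<in> edge_borel"
  by (simp add: Lp_fun_def)

lemma Lp_sum_eq_N:
  assumes "f \<in> \<L>"
  shows "Lp_sum I \<rho> p f = ennreal (N f powr p)"
proof -
  have "Lp_sum I \<rho> p f < top"
    using assms by (simp add: Lp_fun_def)
  moreover have "N f powr p = enn2real (Lp_sum I \<rho> p f)"
    using p_ge_1 by (simp add: Lp_norm_def powr_powr)
  ultimately show ?thesis by simp
qed

lemma N_le_I:
  assumes "\<And>i. i \<in> I \<Longrightarrow> f i \<in> edge_borel" "0 \<le> a"
    "Lp_sum I \<rho> p f \<le> ennreal (a powr p)"
  shows "f \<in> \<L>" and "N f \<le> a"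
proof -
  show "f \<in> \<L>"
    using assms by (auto simp: Lp_fun_def intro: le_less_trans)
  have "enn2real (Lp_sum I \<rho> p f) \<le> a powr p"
    using assms(3) by (auto intro: enn2real_leI)
  then have "enn2real (Lp_sum I \<rho> p f) powr (1 / p) \<le> (a powr p) powr (1 / p)"
    using p_ge_1 by (intro powr_mono2) auto
  then show "N f \<le> a"
    using p_ge_1 assms(2) by (simp add: Lp_norm_def powr_powr)
qed

lemma
  assumes f: "f \<in> \<L>" and g: "g \<in> \<L>"
  shows add_in_\<L>: "(\<lambda>i s. f i s + g i s) \<in> \<L>"
    and N_add_le: "N (\<lambda>i s. f i s + g i s) \<le> N f + N g"
proof -
  note fm = \<L>_measurable[OF f] and gm = \<L>_measurable[OF g]
  have m: "(\<lambda>s. f i s + g i s) \<in> edge_borel" if "i \<in> I" for i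
    using fm[OF that] gm[OF that] by simp
  have bound: "Lp_sum I \<rho> p (\<lambda>i s. f i s + g i s) \<le> ennreal ((N f + N g + \<epsilon>) powr p)" if "0 < \<epsilon>" for \<epsilon>
  proof -
    have *: "Lp_sum I \<rho> p u \<le> ennreal ((N u + \<epsilon> / 2) powr p)" if u: "u \<in> \<L>" for u
      using Lp_sum_eq_N[OF u] \<open>0 < \<epsilon>\<close> p_ge_1 N_nonneg[of u]
      by (auto intro!: ennreal_leI powr_mono2)
    have "(\<integral>\<^sup>+x. ennreal (norm (case_prod f x + case_prod g x) powr p) \<partial>tree_measure)
        \<le> ennreal (((N f + \<epsilon> / 2) + (N g + \<epsilon> / 2)) powr p)"
    proof (rule nn_integral_powr_norm_add_le[OF p_ge_1])
      show "case_prod f \<in> borel_measurable tree_measure" "case_prod g \<in> borel_measurable tree_measure"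
        using fm gm by (auto simp: tree_measurable_iff)
    qed (use *[OF f] *[OF g] N_nonneg[of f] N_nonneg[of g] \<open>0 < \<epsilon>\<close> Lp_sum_eq_integral[OF fm]
        Lp_sum_eq_integral[OF gm] in auto)
    moreover have "Lp_sum I \<rho> p (\<lambda>i s. f i s + g i s)
        = (\<integral>\<^sup>+x. ennreal (norm (case_prod f x + case_prod g x) powr p) \<partial>tree_measure)"
      by (subst Lp_sum_eq_integral[OF m]) (auto simp: case_prod_unfold)
    ultimately show ?thesis
      by (simp add: algebra_simps)
  qed
  have nn: "0 \<le> N f + N g + \<epsilon>" if "0 < \<epsilon>" for \<epsilon>
    using N_nonneg[of f] N_nonneg[of g] that by simp
  show "(\<lambda>i s. f i s + g i s) \<in> \<L>"
    using N_le_I(1)[of "\<lambda>i s. f i s + g i s", OF m nn[OF zero_less_one] bound[OF zero_less_one]] .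
  show "N (\<lambda>i s. f i s + g i s) \<le> N f + N g"
  proof (rule field_le_epsilon)
    fix \<epsilon> :: real assume "0 < \<epsilon>"
    then show "N (\<lambda>i s. f i s + g i s) \<le> N f + N g + \<epsilon>"
      using N_le_I(2)[of "\<lambda>i s. f i s + g i s", OF m nn bound] by blast
  qed
qed

lemma Lp_sum_minus: "Lp_sum I \<rho> p (\<lambda>i s. g i s - f i s) = Lp_sum I \<rho> p (\<lambda>i s. f i s - g i s)"
  by (simp add: Lp_sum_def norm_minus_commute)

lemma N_minus_commute: "dst f g = dst g f"
  by (simp add: Lp_norm_def Lp_sum_minus[of f g])

lemma uminus_in_\<L>: "f \<in> \<L> \<Longrightarrow> (\<lambda>i s. - f i s) \<in> \<L>"
  by (auto simp: Lp_fun_def Lp_sum_def)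

lemma diff_in_\<L>: "\<lbrakk>f \<in> \<L>; g \<in> \<L>\<rbrakk> \<Longrightarrow> (\<lambda>i s. f i s - g i s) \<in> \<L>"
  using add_in_\<L>[OF _ uminus_in_\<L>, of f g] by simp

lemma N_triangle:
  assumes "f \<in> \<L>" "g \<in> \<L>" "h \<in> \<L>"
  shows "dst f h \<le> dst f g + dst g h"
  using N_add_le[OF diff_in_\<L>[OF assms(1,2)] diff_in_\<L>[OF assms(2,3)]] by simp

lemma N_cong_AE:
  assumes "\<And>i. i \<in> I \<Longrightarrow> AE s in edge_measure. f i s = g i s"
  shows "N f = N g"
proof -
  have "Lp_sum I \<rho> p f = Lp_sum I \<rho> p g"
    unfolding Lp_sum_def
  proof (intro infsum_cong nn_integral_cong_AE)
    fix i assume i: "i \<in> I"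
    show "AE s in edge_measure. ennreal (norm (f i s) powr p * \<rho> i s) = ennreal (norm (g i s) powr p * \<rho> i s)"
      using assms[OF i] by eventually_elim simp
  qed
  then show ?thesis by (simp add: Lp_norm_def)
qed

lemma N_eq_0_imp_AE:
  assumes f: "f \<in> \<L>" and "N f = 0" and i: "i \<in> I"
  shows "AE s in edge_measure. f i s = 0"
proof -
  have "Lp_sum I \<rho> p f = 0"
    using Lp_sum_eq_N[OF f] assms(2) by simp
  then have "(\<integral>\<^sup>+s. ennreal (norm (f i s) powr p * \<rho> i s) \<partial>edge_measure) = 0"
    using le_infsum_ennreal[OF i, of "\<lambda>i. \<integral>\<^sup>+s. ennreal (norm (f i s) powr p * \<rho> i s) \<partial>edge_measure"]
    by (simp add: Lp_sum_def)
  then have "AE s in edge_measure. ennreal (norm (f i s) powr p * \<rho> i s) = 0"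
    by (subst (asm) nn_integral_0_iff_AE) (rule powr_measurable[of f i, OF \<L>_measurable[OF f i] i])
  then show ?thesis
  proof (rule AE_mp, intro AE_I2 impI)
    fix s assume "s \<in> space edge_measure" "ennreal (norm (f i s) powr p * \<rho> i s) = 0"
    then show "f i s = 0"
      using \<rho>_pos[OF i, of s] by (auto simp: ennreal_eq_0_iff mult_le_0_iff)
  qed
qed

subsection \<open>Classes of functions\<close>

definition cls :: "('i, 'k::{real_normed_field, euclidean_space}) edge_fun \<Rightarrow> ('i, 'k) edge_fun set" where
  "cls f = Lp_rel I \<rho> p `` {f}"

lemma equiv_Lp_rel:
  "equiv \<L> (Lp_rel I \<rho> p :: (('i, 'k::{real_normed_field, euclidean_space}) edge_fun \<times> _) set)"
    (is "equiv _ ?R")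
proof (rule equivI)
  show "?R \<subseteq> \<L> \<times> \<L>"
    by (auto simp: Lp_rel_def)
  show "refl_on \<L> ?R"
    by (auto simp: refl_on_def Lp_rel_def)
  show "sym ?R"
    by (auto simp: sym_def Lp_rel_def elim!: AE_mp)
  show "trans ?R"
  proof (rule transI)
    fix f g h assume a: "(f, g) \<in> ?R" "(g, h) \<in> ?R"
    have "AE s in edge_measure. f i s = h i s" if "i \<in> I" for i
    proof -
      have "AE s in edge_measure. f i s = g i s" "AE s in edge_measure. g i s = h i s"
        using a that by (auto simp: Lp_rel_def)
      then show ?thesis by eventually_elim simp
    qed
    then show "(f, h) \<in> ?R"
      using a by (auto simp: Lp_rel_def)
  qed
qed

lemma cls_in: "f \<in> \<L> \<Longrightarrow> cls f \<in> Lp_space I \<rho> p"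
  unfolding cls_def Lp_space_def by (rule quotientI)

lemma repr_in:
  assumes "C \<in> Lp_space I \<rho> p"
  shows "Lp_repr C \<in> \<L>" and "cls (Lp_repr C) = C"
proof -
  obtain f where f: "f \<in> \<L>" "C = Lp_rel I \<rho> p `` {f}"
    using assms by (auto simp: Lp_space_def elim: quotientE)
  then have "f \<in> C"
    using equiv_class_self[OF equiv_Lp_rel] by blast
  then have "Lp_repr C \<in> C"
    unfolding Lp_repr_def by (rule someI[of "\<lambda>f. f \<in> C"])
  then have rel: "(f, Lp_repr C) \<in> Lp_rel I \<rho> p"
    unfolding f(2) by blast
  then show "Lp_repr C \<in> \<L>"
    by (simp add: Lp_rel_def)
  have "cls (Lp_repr C) = Lp_rel I \<rho> p `` {f}"
    unfolding cls_def by (rule equiv_class_eq[OF equiv_Lp_rel rel, symmetric])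
  then show "cls (Lp_repr C) = C"
    by (simp only: f(2))
qed

lemma cls_eq_iff:
  assumes "f \<in> \<L>" "g \<in> \<L>"
  shows "cls f = cls g \<longleftrightarrow> (\<forall>i\<in>I. AE s in edge_measure. f i s = g i s)"
  unfolding cls_def eq_equiv_class_iff[OF equiv_Lp_rel assms] using assms by (simp add: Lp_rel_def)

lemma repr_cls:
  assumes "f \<in> \<L>" "i \<in> I"
  shows "AE s in edge_measure. Lp_repr (cls f) i s = f i s"
  using cls_eq_iff[OF repr_in(1)[OF cls_in[OF assms(1)]] assms(1)] repr_in(2)[OF cls_in[OF assms(1)]] assms(2)
  by blast

lemma dist_cls:
  assumes f: "f \<in> \<L>" and g: "g \<in> \<L>"
  shows "Lp_dist I \<rho> p (cls f) (cls g) = dst f g"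
  unfolding Lp_dist_def
proof (rule N_cong_AE)
  fix i assume i: "i \<in> I"
  show "AE s in edge_measure. Lp_repr (cls f) i s - Lp_repr (cls g) i s = f i s - g i s"
    using repr_cls[OF f i] repr_cls[OF g i] by eventually_elim simp
qed

lemma Lp_space_cases:
  assumes "C \<in> Lp_space I \<rho> p"
  obtains f where "f \<in> \<L>" "C = cls f"
  using repr_in[OF assms] that by metis

lemma Metric_space_Lp:
  "Metric_space (Lp_space I \<rho> p :: ('i, 'k::{real_normed_field, euclidean_space}) edge_fun set set) (Lp_dist I \<rho> p)"
proof
  fix C C' :: "('i, 'k) edge_fun set"
  show "0 \<le> Lp_dist I \<rho> p C C'"
    unfolding Lp_dist_def by (rule N_nonneg)
  show "Lp_dist I \<rho> p C C' = Lp_dist I \<rho> p C' C"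
    unfolding Lp_dist_def by (rule N_minus_commute)
next
  fix C C' :: "('i, 'k) edge_fun set"
  assume "C \<in> Lp_space I \<rho> p" "C' \<in> Lp_space I \<rho> p"
  then obtain f g where f: "f \<in> \<L>" "C = cls f" and g: "g \<in> \<L>" "C' = cls g"
    by (meson Lp_space_cases)
  show "Lp_dist I \<rho> p C C' = 0 \<longleftrightarrow> C = C'"
  proof
    assume "Lp_dist I \<rho> p C C' = 0"
    then have 0: "dst f g = 0"
      using f g by (simp add: dist_cls)
    have "\<forall>i\<in>I. AE s in edge_measure. f i s = g i s"
      using N_eq_0_imp_AE[OF diff_in_\<L>[OF f(1) g(1)] 0] by simp
    then show "C = C'"
      using f g by (simp add: cls_eq_iff)
  next
    assume "C = C'"
    then show "Lp_dist I \<rho> p C C' = 0"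
      using p_ge_1 by (simp add: Lp_dist_def Lp_norm_def Lp_sum_def)
  qed
next
  fix C1 C2 C3 :: "('i, 'k) edge_fun set"
  assume "C1 \<in> Lp_space I \<rho> p" "C2 \<in> Lp_space I \<rho> p" "C3 \<in> Lp_space I \<rho> p"
  then obtain f g h where "f \<in> \<L>" "C1 = cls f" "g \<in> \<L>" "C2 = cls g" "h \<in> \<L>" "C3 = cls h"
    by (meson Lp_space_cases)
  then show "Lp_dist I \<rho> p C1 C3 \<le> Lp_dist I \<rho> p C1 C2 + Lp_dist I \<rho> p C2 C3"
    by (simp add: dist_cls N_triangle)
qed

lemma mcomplete_Lp:
  "Metric_space.mcomplete (Lp_space I \<rho> p :: ('i, 'k::{real_normed_field, euclidean_space}) edge_fun set set) (Lp_dist I \<rho> p)"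
proof -
  interpret X: Metric_space "Lp_space I \<rho> p :: ('i, 'k) edge_fun set set" "Lp_dist I \<rho> p"
    by (rule Metric_space_Lp)
  show ?thesis
    unfolding X.mcomplete_def
  proof (intro allI impI)
    fix \<sigma> :: "nat \<Rightarrow> ('i, 'k) edge_fun set" assume \<sigma>: "X.MCauchy \<sigma>"
    define f where "f n = Lp_repr (\<sigma> n)" for n
    have in_X: "\<sigma> n \<in> Lp_space I \<rho> p" for n
      using \<sigma> by (auto simp: X.MCauchy_def)
    have f: "f n \<in> \<L>" "cls (f n) = \<sigma> n" for n
      using repr_in[OF in_X] by (auto simp: f_def)
    have sum_eq: "(\<integral>\<^sup>+x. ennreal (norm (case_prod u x - case_prod v x) powr p) \<partial>tree_measure)
        = Lp_sum I \<rho> p (\<lambda>i s. u i s - v i s)"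
      if "\<And>i. i \<in> I \<Longrightarrow> u i \<in> edge_borel" "\<And>i. i \<in> I \<Longrightarrow> v i \<in> edge_borel"
      for u v :: "('i, 'k) edge_fun"
      by (subst Lp_sum_eq_integral) (auto intro!: that borel_measurable_diff simp: case_prod_unfold)
    have sum_ff: "(\<integral>\<^sup>+x. ennreal (norm (case_prod (f m) x - case_prod (f n) x) powr p) \<partial>tree_measure)
        = Lp_sum I \<rho> p (\<lambda>i s. f m i s - f n i s)" for m n
      by (rule sum_eq) (rule \<L>_measurable[OF f(1)], assumption)+
    have Cauchy: "\<exists>n0. \<forall>m\<ge>n0. \<forall>n\<ge>n0.
        (\<integral>\<^sup>+x. ennreal (norm (case_prod (f m) x - case_prod (f n) x) powr p) \<partial>tree_measure) \<le> ennreal \<epsilon>"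
      if "0 < \<epsilon>" for \<epsilon>
    proof -
      have "0 < \<epsilon> powr (1 / p)" using that by simp
      then obtain n0 where n0: "\<And>m n. n0 \<le> m \<Longrightarrow> n0 \<le> n \<Longrightarrow> Lp_dist I \<rho> p (\<sigma> m) (\<sigma> n) < \<epsilon> powr (1 / p)"
        using \<sigma> unfolding X.MCauchy_def by metis
      show ?thesis
      proof (intro exI[of _ n0] allI impI)
        fix m n assume "n0 \<le> m" "n0 \<le> n"
        then have "dst (f m) (f n) \<le> \<epsilon> powr (1 / p)"
          using n0[of m n] f dist_cls[OF f(1) f(1), of m n] by simp
        then have "dst (f m) (f n) powr p \<le> (\<epsilon> powr (1 / p)) powr p"
          using p_ge_1 by (intro powr_mono2 N_nonneg) auto
        then show "(\<integral>\<^sup>+x. ennreal (norm (case_prod (f m) x - case_prod (f n) x) powr p) \<partial>tree_measure) \<le> ennreal \<epsilon>"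
          using p_ge_1 that unfolding sum_ff Lp_sum_eq_N[OF diff_in_\<L>[OF f(1) f(1)]]
          by (simp add: powr_powr)
      qed
    qed
    have fm: "case_prod (f n) \<in> borel_measurable tree_measure" for n
      using \<L>_measurable[OF f(1)] by (simp add: tree_measurable_iff)
    obtain G where G: "G \<in> borel_measurable tree_measure"
      and lim: "\<And>\<epsilon>. 0 < \<epsilon> \<Longrightarrow> \<exists>n0. \<forall>n\<ge>n0.
        (\<integral>\<^sup>+x. ennreal (norm (case_prod (f n) x - G x) powr p) \<partial>tree_measure) \<le> ennreal \<epsilon>"
      using nn_integral_powr_norm_Cauchy_imp_convergent[OF p_ge_1 fm Cauchy] by blast
    define g where "g = curry G"
    have G_eq: "G = case_prod g" by (simp add: g_def)
    have gm: "g i \<in> edge_borel" if "i \<in> I" for i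
      using G that unfolding G_eq tree_measurable_iff by blast
    have sum_fg: "(\<integral>\<^sup>+x. ennreal (norm (case_prod (f n) x - case_prod g x) powr p) \<partial>tree_measure)
        = Lp_sum I \<rho> p (\<lambda>i s. f n i s - g i s)" for n
      by (rule sum_eq) (rule \<L>_measurable[OF f(1)] gm, assumption)+
    have close: "\<exists>n0. \<forall>n\<ge>n0. (\<lambda>i s. f n i s - g i s) \<in> \<L> \<and> dst (f n) g \<le> \<epsilon>" if "0 < \<epsilon>" for \<epsilon>
    proof -
      have "0 < \<epsilon> powr p" using that by simp
      from lim[OF this] obtain n0 where n0: "\<And>n. n0 \<le> n \<Longrightarrow> Lp_sum I \<rho> p (\<lambda>i s. f n i s - g i s) \<le> ennreal (\<epsilon> powr p)"
        unfolding G_eq sum_fg by blast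
      have "(\<lambda>s. f n i s - g i s) \<in> edge_borel" if "i \<in> I" for n i
        using \<L>_measurable[OF f(1) that] gm[OF that] by simp
      then show ?thesis
        using N_le_I[OF _ less_imp_le[OF that] n0] by blast
    qed
    obtain n where "(\<lambda>i s. f n i s - g i s) \<in> \<L>"
      using close[of 1] by auto
    then have g: "g \<in> \<L>"
      using diff_in_\<L>[OF f(1)[of n]] by fastforce
    have "limitin X.mtopology \<sigma> (cls g) sequentially"
      unfolding X.limitin_metric
    proof (intro conjI allI impI cls_in g)
      fix \<epsilon> :: real assume "0 < \<epsilon>"
      then obtain n0 where n0: "\<And>n. n0 \<le> n \<Longrightarrow> dst (f n) g \<le> \<epsilon> / 2"
        using close[of "\<epsilon> / 2"] by auto
      show "\<forall>\<^sub>F n in sequentially. \<sigma> n \<in> Lp_space I \<rho> p \<and> Lp_dist I \<rho> p (\<sigma> n) (cls g) < \<epsilon>"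
        unfolding eventually_sequentially
      proof (intro exI[of _ n0] allI impI conjI in_X)
        fix n assume "n0 \<le> n"
        then show "Lp_dist I \<rho> p (\<sigma> n) (cls g) < \<epsilon>"
          using dist_cls[OF f(1) g, of n] f(2)[of n] n0[of n] \<open>0 < \<epsilon>\<close> by simp
      qed
    qed
    then show "\<exists>x. limitin X.mtopology \<sigma> x sequentially" by blast
  qed
qed

subsection \<open>The semigroup on classes\<close>

lemma N_translate_diff_le:
  assumes t: "0 \<le> t" and f: "f \<in> \<L>" and g: "g \<in> \<L>"
  shows "dst (\<T> t f) (\<T> t g)
      \<le> K t powr (1 / p) * dst f g"
proof -
  let ?d = "\<lambda>i s. f i s - g i s"
  have d: "?d \<in> \<L>" by (rule diff_in_\<L>[OF f g])
  have K: "1 \<le> K t" by (rule K_ge_1[OF t])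
  have "dst (\<T> t f) (\<T> t g) = N (\<T> t ?d)"
  proof (rule N_cong_AE)
    fix i assume "i \<in> I"
    from AE_translate_diff[OF t f g this]
    show "AE s in edge_measure. \<T> t f i s - \<T> t g i s = \<T> t ?d i s"
      by eventually_elim simp
  qed
  also have "\<dots> \<le> K t powr (1 / p) * N ?d"
  proof (rule N_le_I(2))
    show "\<T> t ?d i \<in> edge_borel" if "i \<in> I" for i
      by (rule translate_measurable[OF t \<L>_measurable[OF d] that])
    show "0 \<le> K t powr (1 / p) * N ?d"
      by (simp add: N_nonneg)
    have "Lp_sum I \<rho> p (\<T> t ?d) \<le> ennreal (K t) * Lp_sum I \<rho> p ?d"
      by (rule Lp_sum_translate_le[OF t \<L>_measurable[OF d]])
    also have "\<dots> = ennreal ((K t powr (1 / p) * N ?d) powr p)"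
      using K p_ge_1 by (simp add: Lp_sum_eq_N[OF d] powr_mult powr_powr ennreal_mult)
    finally show "Lp_sum I \<rho> p (\<T> t ?d) \<le> ennreal ((K t powr (1 / p) * N ?d) powr p)" .
  qed
  finally show ?thesis .
qed

lemma N_diff_eq_0_imp_cls_eq:
  assumes f: "f \<in> \<L>" and g: "g \<in> \<L>" and "dst f g = 0"
  shows "cls f = cls g"
  unfolding cls_eq_iff[OF f g]
  using N_eq_0_imp_AE[OF diff_in_\<L>[OF f g] assms(3)] by simp

lemma translation_semigroup_cls:
  assumes t: "0 \<le> t" and f: "f \<in> \<L>"
  shows "translation_semigroup I e \<rho> p t (cls f) = cls (\<T> t f)"
proof -
  have r: "Lp_repr (cls f) \<in> \<L>"
    by (rule repr_in(1)[OF cls_in[OF f]])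
  have "dst (Lp_repr (cls f)) f = dst f f"
  proof (rule N_cong_AE)
    fix i assume "i \<in> I"
    from repr_cls[OF f this] show "AE s in edge_measure. Lp_repr (cls f) i s - f i s = f i s - f i s"
      by eventually_elim simp
  qed
  also have "\<dots> = 0"
    using p_ge_1 by (simp add: Lp_norm_def Lp_sum_def)
  finally have "dst (\<T> t (Lp_repr (cls f))) (\<T> t f) = 0"
    using N_translate_diff_le[OF t r f] N_nonneg[of "\<lambda>i s. \<T> t (Lp_repr (cls f)) i s - \<T> t f i s"]
    by simp
  then have "cls (\<T> t (Lp_repr (cls f))) = cls (\<T> t f)"
    by (intro N_diff_eq_0_imp_cls_eq translate_in_Lp_fun[OF t] r f)
  then show ?thesis
    unfolding translation_semigroup_def cls_def .
qed


end

section \<open>Dense classes of functions\<close>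

lemma tendsto_0_imp_le_ennreal:
  assumes "(u \<longlongrightarrow> (0::ennreal)) sequentially" "0 < (\<epsilon>::real)"
  shows "\<exists>n::nat. u n \<le> ennreal \<epsilon>"
proof -
  have "\<forall>\<^sub>F n in sequentially. u n < ennreal \<epsilon>"
    using assms by (intro order_tendstoD) auto
  then obtain n where "u n < ennreal \<epsilon>"
    by (auto simp: eventually_sequentially)
  then show ?thesis by (auto intro: less_imp_le)
qed

text \<open>
  The step function with the values in \<open>L\<close> on consecutive intervals of equal length; the empty list
  stands for the zero function.
\<close>

definition step_fun :: "'k list \<Rightarrow> real \<Rightarrow> 'k::zero" where
  "step_fun L s = (if L = [] then 0 else L ! nat \<lfloor>real (length L) * s\<rfloor>)"

lemma step_fun_measurable:
  "step_fun L \<in> edge_borel" for L :: "'k::{zero, topological_space} list"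
proof -
  have "(\<lambda>s. \<lfloor>real (length L) * s\<rfloor>) \<in> borel \<rightarrow>\<^sub>M count_space UNIV"
    by measurable
  from measurable_compose[OF this, of "\<lambda>k. if L = [] then 0 else L ! nat k" borel]
  have "step_fun L \<in> borel_measurable borel"
    unfolding step_fun_def by simp
  then have "step_fun L \<in> borel_measurable lebesgue"
    by (auto intro!: measurable_completion)
  then show ?thesis
    by (rule measurable_restrict_space1)
qed

lemma step_fun_in:
  assumes "L \<noteq> []" "0 \<le> s" "s < 1"
  shows "nat \<lfloor>real (length L) * s\<rfloor> < length L" and "step_fun L s \<in> set L"
proof -
  have "real (length L) * s < real (length L) * 1"
    using assms by (intro mult_strict_left_mono) auto
  then show *: "nat \<lfloor>real (length L) * s\<rfloor> < length L"
    using assms by (simp add: nat_less_iff floor_less_iff)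
  show "step_fun L s \<in> set L"
    using * assms(1) by (simp add: step_fun_def)
qed

context weighted_tree
begin

definition bounded_on :: "'i set \<Rightarrow> real \<Rightarrow> ('i, 'k::{real_normed_field, euclidean_space}) edge_fun \<Rightarrow> bool" where
  "bounded_on F B f \<longleftrightarrow> (\<forall>i\<in>I. f i \<in> edge_borel \<and>
     (\<forall>s\<in>{0..<1}. norm (f i s) \<le> (if i \<in> F then B else 0)))"

lemma bounded_on_mono: "bounded_on F B f \<Longrightarrow> F \<subseteq> F' \<Longrightarrow> B \<le> B' \<Longrightarrow> 0 \<le> B' \<Longrightarrow> bounded_on F' B' f"
  unfolding bounded_on_def by (fastforce split: if_splits intro: order_trans)

lemma Lp_sum_finite:
  fixes f :: "('i, 'k::{real_normed_field, euclidean_space}) edge_fun"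
  assumes "finite F" "F \<subseteq> I" "\<And>i s. i \<in> I - F \<Longrightarrow> 0 \<le> s \<Longrightarrow> s < 1 \<Longrightarrow> f i s = 0"
  shows "Lp_sum I \<rho> p f = (\<Sum>i\<in>F. \<integral>\<^sup>+s. ennreal (norm (f i s) powr p * \<rho> i s) \<partial>edge_measure)"
proof -
  have "Lp_sum I \<rho> p f = (\<Sum>\<^sub>\<infinity>i\<in>F. \<integral>\<^sup>+s. ennreal (norm (f i s) powr p * \<rho> i s) \<partial>edge_measure)"
    unfolding Lp_sum_def
  proof (rule infsum_cong_neutral)
    fix i assume "i \<in> I - F"
    then have "(\<integral>\<^sup>+s. ennreal (norm (f i s) powr p * \<rho> i s) \<partial>edge_measure) = (\<integral>\<^sup>+s. 0 \<partial>edge_measure)"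
      by (intro nn_integral_cong) (simp add: assms(3))
    then show "(\<integral>\<^sup>+s. ennreal (norm (f i s) powr p * \<rho> i s) \<partial>edge_measure) = 0" by simp
  qed (use assms in auto)
  then show ?thesis using assms(1) by simp
qed

lemma nn_integral_\<rho>:
  assumes i: "i \<in> I" and "0 \<le> c"
  shows "(\<integral>\<^sup>+s. ennreal (c * \<rho> i s) \<partial>edge_measure) = ennreal (c * (\<integral>s. \<rho> i s \<partial>edge_measure))"
proof -
  have "AE s in edge_measure. 0 \<le> c * \<rho> i s"
    using \<rho>_pos[OF i] assms(2) by (intro AE_I2) (simp add: less_imp_le)
  then show ?thesis
    using nn_integral_eq_integral[of edge_measure "\<lambda>s. c * \<rho> i s"] \<rho>_integrable[OF i] by simp
qed

lemma integral_\<rho>_nonneg: "i \<in> I \<Longrightarrow> 0 \<le> (\<integral>s. \<rho> i s \<partial>edge_measure)"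
  using \<rho>_pos by (intro integral_nonneg_AE AE_I2) (simp add: less_imp_le)

lemma bounded_on_integral_le:
  assumes f: "bounded_on F B f" and i: "i \<in> I" and B: "0 \<le> B"
  shows "(\<integral>\<^sup>+s. ennreal (norm (f i s) powr p * \<rho> i s) \<partial>edge_measure)
      \<le> ennreal (B powr p * (\<integral>s. \<rho> i s \<partial>edge_measure))"
proof -
  have "(\<integral>\<^sup>+s. ennreal (norm (f i s) powr p * \<rho> i s) \<partial>edge_measure)
      \<le> (\<integral>\<^sup>+s. ennreal (B powr p * \<rho> i s) \<partial>edge_measure)"
  proof (rule nn_integral_mono)
    fix s assume "s \<in> space edge_measure"
    then have s: "0 \<le> s" "s < 1" by auto
    then have "norm (f i s) \<le> B"
      using f i B unfolding bounded_on_def by (fastforce split: if_splits)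
    then have "norm (f i s) powr p \<le> B powr p"
      using p_ge_1 by (intro powr_mono2) auto
    then show "ennreal (norm (f i s) powr p * \<rho> i s) \<le> ennreal (B powr p * \<rho> i s)"
      using \<rho>_pos[OF i s] by (intro ennreal_leI mult_right_mono) auto
  qed
  also have "\<dots> = ennreal (B powr p * (\<integral>s. \<rho> i s \<partial>edge_measure))"
    by (rule nn_integral_\<rho>[OF i]) simp
  finally show ?thesis .
qed

lemma bounded_on_zero: "bounded_on F B f \<Longrightarrow> i \<in> I - F \<Longrightarrow> 0 \<le> s \<Longrightarrow> s < 1 \<Longrightarrow> f i s = 0"
  unfolding bounded_on_def by fastforce

lemma bounded_on_measurable: "bounded_on F B f \<Longrightarrow> i \<in> I \<Longrightarrow> f i \<in> edge_borel"
  unfolding bounded_on_def by blast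

lemma bounded_on_in_\<L>:
  assumes f: "bounded_on F B f" and F: "finite F" "F \<subseteq> I" and B: "0 \<le> B"
  shows "f \<in> \<L>"
proof -
  have "Lp_sum I \<rho> p f = (\<Sum>i\<in>F. \<integral>\<^sup>+s. ennreal (norm (f i s) powr p * \<rho> i s) \<partial>edge_measure)"
    by (rule Lp_sum_finite[OF F]) (rule bounded_on_zero[OF f])
  also have "\<dots> < \<infinity>"
  proof -
    have "(\<integral>\<^sup>+s. ennreal (norm (f i s) powr p * \<rho> i s) \<partial>edge_measure) < top" if "i \<in> F" for i
      using F that by (intro le_less_trans[OF bounded_on_integral_le[OF f _ B] ennreal_less_top]) auto
    then show ?thesis
      using F by simp
  qed
  finally show ?thesis
    using bounded_on_measurable[OF f] by (simp add: Lp_fun_def)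
qed

text \<open>
  Cutting off both the values and the edges in an enumeration, by dominated convergence.
\<close>

lemma truncation_dense:
  fixes f :: "('i, 'k::{real_normed_field, euclidean_space}) edge_fun"
  assumes f: "f \<in> \<L>" and \<epsilon>: "0 < \<epsilon>"
  obtains F B g where "finite F" "F \<subseteq> I" "0 \<le> B" "bounded_on F B g" "dst f g \<le> \<epsilon>"
proof -
  define F where "F n = {i \<in> I. to_nat_on I i < n}" for n
  have F: "finite (F n)" "F n \<subseteq> I" for n
    using finite_initial_edges by (auto simp: F_def)
  define g where "g n i s = (if i \<in> F n \<and> norm (f i s) \<le> real n then f i s else 0)" for n i s
  have fm: "f i \<in> edge_borel" if "i \<in> I" for i
    by (rule \<L>_measurable[OF f that])
  have gm: "g n i \<in> edge_borel" if "i \<in> I" for n i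
  proof -
    have [measurable]: "f i \<in> edge_borel" by (rule fm[OF that])
    show ?thesis unfolding g_def by measurable
  qed
  have bounded: "bounded_on (F n) (real n) (g n)" for n
    unfolding bounded_on_def using gm by (auto simp: g_def)
  have dm: "(\<lambda>s. f i s - g n i s) \<in> edge_borel" if "i \<in> I" for n i
    using fm[OF that] gm[OF that] by simp
  let ?u = "\<lambda>n x. ennreal (norm (case_prod (\<lambda>i s. f i s - g n i s) x) powr p)"
  have "(\<lambda>n. \<integral>\<^sup>+x. ?u n x \<partial>tree_measure) \<longlonglongrightarrow> (\<integral>\<^sup>+x. 0 \<partial>tree_measure)"
  proof (rule nn_integral_dominated_convergence)
    have [measurable]: "case_prod (\<lambda>i s. f i s - g n i s) \<in> borel_measurable tree_measure" for n
      unfolding tree_measurable_iff using dm by blast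
    show "?u n \<in> borel_measurable tree_measure" for n
      by measurable
    have [measurable]: "case_prod f \<in> borel_measurable tree_measure"
      unfolding tree_measurable_iff using fm by blast
    show "(\<lambda>x. ennreal (norm (case_prod f x) powr p)) \<in> borel_measurable tree_measure"
      by measurable
    show "AE x in tree_measure. ?u n x \<le> ennreal (norm (case_prod f x) powr p)" for n
      using p_ge_1 by (intro AE_I2) (auto simp: g_def split: prod.splits)
    show "(\<integral>\<^sup>+x. ennreal (norm (case_prod f x) powr p) \<partial>tree_measure) < \<infinity>"
      using f Lp_sum_eq_integral[OF fm] by (simp add: Lp_fun_def)
    show "AE x in tree_measure. (\<lambda>n. ?u n x) \<longlonglongrightarrow> 0"
    proof (rule AE_I2)
      fix x assume "x \<in> space tree_measure"
      then obtain i s where x: "x = (i, s)" "i \<in> I"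
        by (auto simp: tree_measure_def space_pair_measure)
      obtain m where m: "norm (f i s) \<le> real m"
        using real_arch_simple by blast
      have "?u n x = 0" if "max m (Suc (to_nat_on I i)) \<le> n" for n
        using x that m p_ge_1 by (auto simp: g_def F_def)
      then have "\<forall>\<^sub>F n in sequentially. ?u n x = 0"
        unfolding eventually_sequentially by blast
      then show "(\<lambda>n. ?u n x) \<longlonglongrightarrow> 0"
        by (rule tendsto_eventually)
    qed
  qed simp
  then have "(\<lambda>n. Lp_sum I \<rho> p (\<lambda>i s. f i s - g n i s)) \<longlonglongrightarrow> 0"
    by (simp add: Lp_sum_eq_integral[OF dm])
  from tendsto_0_imp_le_ennreal[OF this, of "\<epsilon> powr p"] \<epsilon>
  obtain n where n: "Lp_sum I \<rho> p (\<lambda>i s. f i s - g n i s) \<le> ennreal (\<epsilon> powr p)"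
    by auto
  have "dst f (g n) \<le> \<epsilon>"
    by (rule N_le_I(2)[OF dm _ n]) (use \<epsilon> in auto)
  then show ?thesis
    using that[OF F _ bounded] by simp
qed

text \<open>
  On one edge a bounded measurable function is an almost everywhere limit of bounded continuous
  functions, and these are uniform limits of step functions.
\<close>

lemma step_fun_dense:
  fixes g :: "real \<Rightarrow> 'k::{real_normed_field, euclidean_space}"
  assumes i: "i \<in> I" and gm: "g \<in> edge_borel"
    and B: "0 \<le> B" "\<And>s. 0 \<le> s \<Longrightarrow> s < 1 \<Longrightarrow> norm (g s) \<le> B"
    and Q: "\<And>X. open X \<Longrightarrow> X \<noteq> {} \<Longrightarrow> \<exists>q\<in>Q. q \<in> X" and \<eta>: "0 < \<eta>"
  shows "\<exists>L\<in>lists Q. (\<integral>\<^sup>+s. ennreal (norm (g s - step_fun L s) powr p * \<rho> i s) \<partial>edge_measure) \<le> ennreal \<eta>"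
proof -
  let ?c = "closest_point (cball 0 B) :: 'k \<Rightarrow> 'k"
  have cont_c: "continuous_on UNIV ?c"
    using B(1) by (intro continuous_on_closest_point) auto
  have norm_c: "norm (?c x) \<le> B" for x
    using closest_point_in_set[of "cball 0 B" x] B(1) by simp
  have "g measurable_on {0..<1}"
    using gm by (subst measurable_on_iff_borel_measurable) auto
  then obtain Z \<gamma> where Z: "negligible Z" and \<gamma>: "\<And>n. continuous_on UNIV (\<gamma> n)"
    and lim: "\<forall>x. x \<notin> Z \<longrightarrow> (\<lambda>n. \<gamma> n x) \<longlonglongrightarrow> (if x \<in> {0..<1} then g x else 0)"
    unfolding measurable_on_def by (elim exE conjE) (rule that, assumption, erule spec, assumption)
  define h where "h n s = ?c (\<gamma> n s)" for n s
  have h_cont: "continuous_on UNIV (h n)" for n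
    unfolding h_def using continuous_on_compose2[OF cont_c \<gamma>] by simp
  have h_meas: "h n \<in> edge_borel" for n
  proof -
    have "h n \<in> borel_measurable borel"
      by (rule borel_measurable_continuous_onI[OF h_cont])
    then have "h n \<in> borel_measurable lebesgue"
      by (auto intro!: measurable_completion)
    then show ?thesis by (rule measurable_restrict_space1)
  qed
  have AE_Z: "AE s in edge_measure. s \<notin> Z"
  proof -
    have *: "AE s in lebesgue. s \<notin> Z"
      using Z by (intro AE_not_in) (simp add: negligible_iff_null_sets)
    show ?thesis
      by (subst AE_restrict_space_iff, simp, rule eventually_mono[OF *], simp)
  qed
  define r where "r = (\<integral>s. \<rho> i s \<partial>edge_measure)"
  have r: "0 \<le> r" unfolding r_def by (rule integral_\<rho>_nonneg[OF i])
  have [measurable]: "\<rho> i \<in> edge_borel" "g \<in> edge_borel"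
    by (rule \<rho>_measurable[OF i], rule gm)
  note [measurable] = h_meas step_fun_measurable
  have "(\<lambda>n. \<integral>\<^sup>+s. ennreal (norm (g s - h n s) powr p * \<rho> i s) \<partial>edge_measure) \<longlonglongrightarrow> (\<integral>\<^sup>+s. 0 \<partial>edge_measure)"
  proof (rule nn_integral_dominated_convergence)
    show "(\<integral>\<^sup>+s. ennreal ((2 * B) powr p * \<rho> i s) \<partial>edge_measure) < \<infinity>"
      by (simp add: nn_integral_\<rho>[OF i])
    show "AE s in edge_measure. ennreal (norm (g s - h n s) powr p * \<rho> i s) \<le> ennreal ((2 * B) powr p * \<rho> i s)" for n
    proof (rule AE_I2)
      fix s assume "s \<in> space edge_measure"
      then have s: "0 \<le> s" "s < 1" by auto
      have "norm (g s - h n s) \<le> norm (g s) + norm (h n s)"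
        by (rule norm_triangle_ineq4)
      also have "\<dots> \<le> 2 * B"
        using B(2)[OF s] norm_c[of "\<gamma> n s"] by (simp add: h_def)
      finally have "norm (g s - h n s) powr p \<le> (2 * B) powr p"
        using p_ge_1 by (intro powr_mono2) auto
      then show "ennreal (norm (g s - h n s) powr p * \<rho> i s) \<le> ennreal ((2 * B) powr p * \<rho> i s)"
        using \<rho>_pos[OF i s] by (intro ennreal_leI mult_right_mono) auto
    qed
    show "AE s in edge_measure. (\<lambda>n. ennreal (norm (g s - h n s) powr p * \<rho> i s)) \<longlonglongrightarrow> 0"
      using AE_Z AE_space
    proof eventually_elim
      case (elim s)
      then have "(\<lambda>n. \<gamma> n s) \<longlonglongrightarrow> g s"
        using lim[rule_format, of s] by simp
      then have "(\<lambda>n. h n s) \<longlonglongrightarrow> ?c (g s)"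
        unfolding h_def using cont_c
        by (intro isCont_tendsto_compose[of _ ?c]) (auto simp: continuous_on_eq_continuous_at)
      moreover have "?c (g s) = g s"
        using B(2)[of s] elim by (intro closest_point_self) auto
      ultimately have "(\<lambda>n. h n s) \<longlonglongrightarrow> g s" by simp
      then have "(\<lambda>n. norm (g s - h n s)) \<longlonglongrightarrow> norm (g s - g s)"
        by (intro tendsto_intros)
      then have "(\<lambda>n. norm (g s - h n s) powr p) \<longlonglongrightarrow> norm (g s - g s) powr p"
        using p_ge_1 by (intro tendsto_powr2) auto
      then have "(\<lambda>n. norm (g s - h n s) powr p * \<rho> i s) \<longlonglongrightarrow> norm (g s - g s) powr p * \<rho> i s"
        by (rule tendsto_mult_right)
      moreover have "norm (g s - g s) powr p * \<rho> i s = 0"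
        using p_ge_1 by simp
      ultimately have "(\<lambda>n. norm (g s - h n s) powr p * \<rho> i s) \<longlonglongrightarrow> 0"
        by (simp only:)
      from tendsto_ennrealI[OF this] show ?case
        by (simp only: ennreal_0)
    qed
  qed measurable
  then have "(\<lambda>n. \<integral>\<^sup>+s. ennreal (norm (g s - h n s) powr p * \<rho> i s) \<partial>edge_measure) \<longlonglongrightarrow> 0" by simp
  from tendsto_0_imp_le_ennreal[OF this, of "\<eta> / (2 * 2 powr p)"] \<eta>
  obtain n where n: "(\<integral>\<^sup>+s. ennreal (norm (g s - h n s) powr p * \<rho> i s) \<partial>edge_measure) \<le> ennreal (\<eta> / (2 * 2 powr p))"
    by auto
  define \<delta> where "\<delta> = (\<eta> / (2 * 2 powr p * (r + 1))) powr (1 / p)"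
  have \<delta>: "0 < \<delta>" using \<eta> r by (simp add: \<delta>_def)
  have \<delta>p: "\<delta> powr p = \<eta> / (2 * 2 powr p * (r + 1))"
    using \<eta> r p_ge_1 by (simp add: \<delta>_def powr_powr)
  have "uniformly_continuous_on {0..1} (h n)"
    using h_cont[of n] by (intro compact_uniformly_continuous) (auto intro: continuous_on_subset)
  then obtain d where d: "0 < d"
    "\<forall>x\<in>{0..1}. \<forall>y\<in>{0..1}. dist y x < d \<longrightarrow> dist (h n y) (h n x) < \<delta> / 2"
    unfolding uniformly_continuous_on_def using half_gt_zero[OF \<delta>] by blast
  obtain m where m: "0 < m" "1 / real m < d"
    using ex_inverse_of_nat_less[OF d(1)] by (auto simp: inverse_eq_divide)
  have "\<exists>q\<in>Q. dist (h n (real k / real m)) q < \<delta> / 2" for k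
    using Q[of "ball (h n (real k / real m)) (\<delta> / 2)"] \<delta> by auto
  then obtain q where q: "\<And>k. q k \<in> Q" "\<And>k. dist (h n (real k / real m)) (q k) < \<delta> / 2"
    by metis
  define L where "L = map q [0..<m]"
  have L: "L \<in> lists Q" "length L = m" "L \<noteq> []"
    using q(1) m by (auto simp: L_def)
  have close: "norm (h n s - step_fun L s) \<le> \<delta>" if s: "0 \<le> s" "s < 1" for s
  proof -
    define k where "k = nat \<lfloor>real m * s\<rfloor>"
    have k: "k < m" using step_fun_in(1)[OF L(3) s] by (simp add: L k_def)
    have eq: "step_fun L s = q k"
      using k L(3) unfolding step_fun_def L(2) k_def[symmetric] by (simp add: L_def)
    have "real k \<le> real m * s" "real m * s < real k + 1"
      using s by (auto simp: k_def)
    then have km: "real k / real m \<le> s" "s < real k / real m + 1 / real m"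
      using m(1) by (auto simp: field_simps)
    have "dist (h n s) (h n (real k / real m)) < \<delta> / 2"
      using km m s k by (intro d(2)[rule_format]) (auto simp: dist_real_def)
    with q(2)[of k] have "dist (h n s) (q k) < \<delta>"
      using dist_triangle_half_l[of "h n s" "h n (real k / real m)" \<delta> "q k"] by (simp add: dist_commute)
    then show ?thesis by (simp add: eq dist_norm)
  qed
  have "(\<integral>\<^sup>+s. ennreal (norm (g s - step_fun L s) powr p * \<rho> i s) \<partial>edge_measure)
      \<le> (\<integral>\<^sup>+s. ennreal (2 powr p) * ennreal (norm (g s - h n s) powr p * \<rho> i s)
            + ennreal (2 powr p * \<delta> powr p * \<rho> i s) \<partial>edge_measure)"
  proof (rule nn_integral_mono)
    fix s assume "s \<in> space edge_measure"
    then have s: "0 \<le> s" "s < 1" by auto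
    have "norm (g s - step_fun L s) \<le> norm (g s - h n s) + \<delta>"
      using norm_triangle_ineq[of "g s - h n s" "h n s - step_fun L s"] close[OF s] by simp
    then have "norm (g s - step_fun L s) powr p \<le> (norm (g s - h n s) + \<delta>) powr p"
      using p_ge_1 by (intro powr_mono2) auto
    also have "\<dots> \<le> 2 powr p * (norm (g s - h n s) powr p + \<delta> powr p)"
      using p_ge_1 \<delta> by (intro powr_add_le) auto
    finally have "norm (g s - step_fun L s) powr p * \<rho> i s
        \<le> 2 powr p * (norm (g s - h n s) powr p + \<delta> powr p) * \<rho> i s"
      using \<rho>_pos[OF i s] by (intro mult_right_mono) auto
    also have "\<dots> = 2 powr p * (norm (g s - h n s) powr p * \<rho> i s) + 2 powr p * \<delta> powr p * \<rho> i s"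
      by (simp add: algebra_simps)
    finally show "ennreal (norm (g s - step_fun L s) powr p * \<rho> i s)
        \<le> ennreal (2 powr p) * ennreal (norm (g s - h n s) powr p * \<rho> i s)
            + ennreal (2 powr p * \<delta> powr p * \<rho> i s)"
      using \<rho>_pos[OF i s] by (simp add: less_imp_le flip: ennreal_mult ennreal_plus)
  qed
  also have "\<dots> = ennreal (2 powr p) * (\<integral>\<^sup>+s. ennreal (norm (g s - h n s) powr p * \<rho> i s) \<partial>edge_measure)
      + (\<integral>\<^sup>+s. ennreal (2 powr p * \<delta> powr p * \<rho> i s) \<partial>edge_measure)"
    by (subst nn_integral_add) (auto simp: nn_integral_cmult)
  also have "\<dots> \<le> ennreal (2 powr p) * ennreal (\<eta> / (2 * 2 powr p)) + ennreal (2 powr p * \<delta> powr p * r)"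
    unfolding r_def by (intro add_mono mult_left_mono n) (simp_all add: nn_integral_\<rho>[OF i])
  also have "\<dots> = ennreal (\<eta> / 2 + (\<eta> / 2) * (r / (r + 1)))"
  proof -
    have "2 powr p * (\<eta> / (2 * 2 powr p)) = \<eta> / 2" by simp
    moreover have "2 powr p * \<delta> powr p * r = (\<eta> / 2) * (r / (r + 1))"
    proof -
      define P :: real where "P = 2 powr p"
      have "0 < P" by (simp add: P_def)
      then have "P * (\<eta> / (2 * P * (r + 1))) = \<eta> / (2 * (r + 1))"
        by (simp add: mult.assoc mult.left_commute[of P])
      then show ?thesis
        by (simp add: \<delta>p P_def)
    qed
    ultimately show ?thesis
      using \<eta> r by (simp flip: ennreal_mult ennreal_plus)
  qed
  also have "\<dots> \<le> ennreal \<eta>"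
  proof (rule ennreal_leI)
    have "r / (r + 1) \<le> 1" using r by simp
    then have "(\<eta> / 2) * (r / (r + 1)) \<le> (\<eta> / 2) * 1"
      using \<eta> by (intro mult_left_mono) auto
    then show "\<eta> / 2 + (\<eta> / 2) * (r / (r + 1)) \<le> \<eta>" by linarith
  qed
  finally show ?thesis using L(1) by blast
qed


text \<open>
  The place of an edge in the enumeration of \<open>I\<close> selects its step function, so that values from a
  countable set yield countably many functions.
\<close>

definition step_family :: "'k list list \<Rightarrow> ('i, 'k::{real_normed_field, euclidean_space}) edge_fun" where
  "step_family Ls = (\<lambda>i. if to_nat_on I i < length Ls then step_fun (Ls ! to_nat_on I i) else (\<lambda>s. 0))"

lemma step_family_in_\<L>: "step_family Ls \<in> \<L>"
proof -
  define F where "F = {i \<in> I. to_nat_on I i < length Ls}"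
  define B where "B = Max (insert 0 (norm ` (\<Union>L\<in>set Ls. set L)))"
  have F: "finite F" "F \<subseteq> I"
    using finite_initial_edges by (auto simp: F_def)
  have B0: "0 \<le> B"
    unfolding B_def by (rule Max_ge) auto
  have "norm (step_fun (Ls ! n) s) \<le> B" if "n < length Ls" "0 \<le> s" "s < 1" for n s
  proof (cases "Ls ! n = []")
    case False
    then have "step_fun (Ls ! n) s \<in> (\<Union>L\<in>set Ls. set L)"
      using step_fun_in(2)[OF False that(2,3)] that(1) nth_mem by blast
    then show ?thesis
      unfolding B_def by (intro Max_ge) auto
  qed (simp add: step_fun_def B0)
  then have "bounded_on F B (step_family Ls)"
    unfolding bounded_on_def step_family_def by (auto simp: step_fun_measurable F_def)
  then show ?thesis
    by (rule bounded_on_in_\<L>[OF _ F B0])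
qed

lemma step_families_dense:
  fixes f :: "('i, 'k::{real_normed_field, euclidean_space}) edge_fun"
  assumes f: "f \<in> \<L>" and \<epsilon>: "0 < \<epsilon>"
    and Q: "\<And>X :: 'k set. open X \<Longrightarrow> X \<noteq> {} \<Longrightarrow> \<exists>q\<in>Q. q \<in> X"
  shows "\<exists>Ls\<in>lists (lists Q). dst f (step_family Ls) \<le> \<epsilon>"
proof -
  obtain F B g where F: "finite F" "F \<subseteq> I" and B: "0 \<le> B" and g: "bounded_on F B g"
    and fg: "dst f g \<le> \<epsilon> / 2"
    using truncation_dense[OF f, of "\<epsilon> / 2"] \<epsilon> by auto
  obtain n where n: "\<And>i. i \<in> F \<Longrightarrow> to_nat_on I i < n"
    using finite_nat_set_iff_bounded[of "to_nat_on I ` F"] F(1) by auto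
  define \<eta> where "\<eta> = (\<epsilon> / 2) powr p / (real n + 1)"
  have \<eta>: "0 < \<eta>" using \<epsilon> by (simp add: \<eta>_def)
  have "\<exists>L\<in>lists Q. i \<in> I \<longrightarrow>
      (\<integral>\<^sup>+s. ennreal (norm (g i s - step_fun L s) powr p * \<rho> i s) \<partial>edge_measure) \<le> ennreal \<eta>" for i
  proof (cases "i \<in> I")
    case True
    have "norm (g i s) \<le> B" if "0 \<le> s" "s < 1" for s
      using g True that B unfolding bounded_on_def by (fastforce split: if_splits)
    then show ?thesis
      using step_fun_dense[OF True bounded_on_measurable[OF g True] B _ Q \<eta>] by blast
  qed (auto intro: bexI[of _ "[]"])
  then obtain L where L: "\<And>i. L i \<in> lists Q" "\<And>i. i \<in> I \<Longrightarrow>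
      (\<integral>\<^sup>+s. ennreal (norm (g i s - step_fun (L i) s) powr p * \<rho> i s) \<partial>edge_measure) \<le> ennreal \<eta>"
    by metis
  define Ls where "Ls = map (\<lambda>k. L (from_nat_into I k)) [0..<n]"
  define G where "G = {i \<in> I. to_nat_on I i < n}"
  have G: "finite G" "G \<subseteq> I" "card G \<le> n"
    using finite_initial_edges card_initial_edges by (auto simp: G_def)
  have on_G: "step_family Ls i = step_fun (L i)" if "i \<in> G" for i
    using that countable_index by (simp add: step_family_def Ls_def G_def)
  have off_G: "step_family Ls i s = 0" if "i \<in> I - G" for i s
    using that by (simp add: step_family_def Ls_def G_def)
  have gL: "g \<in> \<L>" by (rule bounded_on_in_\<L>[OF g F B])
  have "Lp_sum I \<rho> p (\<lambda>i s. g i s - step_family Ls i s)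
      = (\<Sum>i\<in>G. \<integral>\<^sup>+s. ennreal (norm (g i s - step_family Ls i s) powr p * \<rho> i s) \<partial>edge_measure)"
  proof (rule Lp_sum_finite[OF G(1,2)])
    fix i s assume "i \<in> I - G" "0 \<le> (s::real)" "s < 1"
    then show "g i s - step_family Ls i s = 0"
      using bounded_on_zero[OF g, of i s] n off_G[of i s] by (auto simp: G_def)
  qed
  also have "\<dots> \<le> (\<Sum>i\<in>G. ennreal \<eta>)"
    using G(2) L(2) on_G by (intro sum_mono) auto
  also have "\<dots> = ennreal (real (card G) * \<eta>)"
    using \<eta> by (simp add: ennreal_mult ennreal_of_nat_eq_real_of_nat)
  also have "\<dots> \<le> ennreal ((\<epsilon> / 2) powr p)"
  proof (rule ennreal_leI)
    have "real (card G) * \<eta> \<le> (real n + 1) * \<eta>"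
      using G(3) \<eta> by (intro mult_right_mono) auto
    then show "real (card G) * \<eta> \<le> (\<epsilon> / 2) powr p" by (simp add: \<eta>_def)
  qed
  finally have "dst g (step_family Ls) \<le> \<epsilon> / 2"
    using \<epsilon> \<L>_measurable[OF gL] \<L>_measurable[OF step_family_in_\<L>]
    by (intro N_le_I(2) borel_measurable_diff) auto
  then have "dst f (step_family Ls) \<le> \<epsilon>"
    using N_triangle[OF f gL step_family_in_\<L>[of Ls]] fg by simp
  moreover have "Ls \<in> lists (lists Q)"
  proof (rule in_listsI, rule ballI)
    fix M assume "M \<in> set Ls"
    then obtain k where "M = L (from_nat_into I k)" by (auto simp: Ls_def)
    then show "M \<in> lists Q" using L(1) by simp
  qed
  ultimately show ?thesis by blast
qed

section \<open>Hypercyclicity and weak mixing in terms of functions\<close>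

lemma topspace_Lp: "topspace (Lp_topology I \<rho> p :: ('i, 'k::{real_normed_field, euclidean_space}) edge_fun set topology) = Lp_space I \<rho> p"
  unfolding Lp_topology_def by (rule Metric_space.topspace_mtopology[OF Metric_space_Lp])

lemma hypercyclic_iff:
  "hypercyclic (Lp_topology I \<rho> p :: ('i, 'k::{real_normed_field, euclidean_space}) edge_fun set topology)
      (translation_semigroup I e \<rho> p) \<longleftrightarrow>
    (\<exists>x::('i, 'k) edge_fun. x \<in> \<L> \<and>
      (\<forall>y\<in>\<L>. \<forall>\<epsilon>>0. \<exists>t\<ge>0. dst y (\<T> t x) < \<epsilon>))" (is "?L \<longleftrightarrow> ?R")
proof -
  interpret X: Metric_space "Lp_space I \<rho> p :: ('i, 'k) edge_fun set set" "Lp_dist I \<rho> p"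
    by (rule Metric_space_Lp)
  let ?T = "translation_semigroup I e \<rho> p"
  have orbit: "X.mtopology closure_of ((\<lambda>t. ?T t (cls x)) ` {0..}) = Lp_space I \<rho> p \<longleftrightarrow>
      (\<forall>y\<in>\<L>. \<forall>\<epsilon>>0. \<exists>t\<ge>0. dst y (\<T> t x) < \<epsilon>)"
    if x: "x \<in> \<L>" for x :: "('i, 'k) edge_fun"
  proof -
    have ball: "?T t (cls x) \<in> X.mball (cls y) \<epsilon> \<longleftrightarrow> dst y (\<T> t x) < \<epsilon>"
      if "y \<in> \<L>" "0 \<le> t" for y :: "('i, 'k) edge_fun" and \<epsilon> t
      using that x by (simp add: translation_semigroup_cls cls_in translate_in_Lp_fun dist_cls)
    have "X.mtopology closure_of ((\<lambda>t. ?T t (cls x)) ` {0..}) = Lp_space I \<rho> p \<longleftrightarrow>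
        (\<forall>C\<in>Lp_space I \<rho> p. \<forall>\<epsilon>>0. \<exists>t\<ge>0. ?T t (cls x) \<in> X.mball C \<epsilon>)"
      unfolding X.metric_closure_of by fastforce
    also have "\<dots> \<longleftrightarrow> (\<forall>y\<in>\<L>. \<forall>\<epsilon>>0. \<exists>t\<ge>0. ?T t (cls x) \<in> X.mball (cls y) \<epsilon>)"
      by (metis Lp_space_cases cls_in)
    also have "\<dots> \<longleftrightarrow> (\<forall>y\<in>\<L>. \<forall>\<epsilon>>0. \<exists>t\<ge>0. dst y (\<T> t x) < \<epsilon>)"
      using ball by meson
    finally show ?thesis .
  qed
  show ?thesis
  proof
    assume ?L
    then obtain C where C: "C \<in> Lp_space I \<rho> p"
      "X.mtopology closure_of ((\<lambda>t. ?T t C) ` {0..}) = Lp_space I \<rho> p"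
      unfolding hypercyclic_def topspace_Lp by (auto simp: Lp_topology_def)
    then obtain x where "x \<in> \<L>" "C = cls x" by (meson Lp_space_cases)
    then show ?R using C(2) orbit by blast
  next
    assume ?R
    then obtain x :: "('i, 'k) edge_fun" where x: "x \<in> \<L>"
      "\<forall>y\<in>\<L>. \<forall>\<epsilon>>0. \<exists>t\<ge>0. dst y (\<T> t x) < \<epsilon>" by blast
    then show ?L
      unfolding hypercyclic_def topspace_Lp using orbit[OF x(1)] cls_in[OF x(1)]
      by (auto simp: Lp_topology_def)
  qed
qed

lemma weakly_mixing_I:
  assumes "\<And>(u1 :: ('i, 'k::{real_normed_field, euclidean_space}) edge_fun) (u2 :: ('i, 'k) edge_fun)
      (v1 :: ('i, 'k) edge_fun) (v2 :: ('i, 'k) edge_fun) \<epsilon>.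
    \<lbrakk>u1 \<in> \<L>; u2 \<in> \<L>; v1 \<in> \<L>; v2 \<in> \<L>; 0 < \<epsilon>\<rbrakk> \<Longrightarrow> \<exists>t\<ge>0. \<exists>f1\<in>\<L>. \<exists>f2\<in>\<L>.
      dst u1 f1 < \<epsilon> \<and> dst u2 f2 < \<epsilon> \<and>
      dst v1 (\<T> t f1) < \<epsilon> \<and> dst v2 (\<T> t f2) < \<epsilon>"
  shows "weakly_mixing (Lp_topology I \<rho> p :: ('i, 'k) edge_fun set topology) (translation_semigroup I e \<rho> p)"
proof -
  interpret X: Metric_space "Lp_space I \<rho> p :: ('i, 'k) edge_fun set set" "Lp_dist I \<rho> p"
    by (rule Metric_space_Lp)
  let ?T = "translation_semigroup I e \<rho> p"
  have balls: "\<exists>u1 u2 \<epsilon>. u1 \<in> \<L> \<and> u2 \<in> \<L> \<and> 0 < \<epsilon> \<and> X.mball (cls u1) \<epsilon> \<times> X.mball (cls u2) \<epsilon> \<subseteq> U"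
    if U: "openin (prod_topology X.mtopology X.mtopology) U" "U \<noteq> {}" for U
  proof -
    obtain C1 C2 where "(C1, C2) \<in> U" using U(2) by auto
    then obtain A1 A2 where A: "openin X.mtopology A1" "openin X.mtopology A2" "C1 \<in> A1" "C2 \<in> A2" "A1 \<times> A2 \<subseteq> U"
      using U(1)[unfolded openin_prod_topology_alt, rule_format, of C1 C2] by blast
    then obtain e1 e2 where e: "0 < e1" "X.mball C1 e1 \<subseteq> A1" "0 < e2" "X.mball C2 e2 \<subseteq> A2"
      unfolding X.openin_mtopology by blast
    have "C1 \<in> Lp_space I \<rho> p" "C2 \<in> Lp_space I \<rho> p"
      using A unfolding X.openin_mtopology by blast+
    then obtain u1 u2 where u: "u1 \<in> \<L>" "C1 = cls u1" "u2 \<in> \<L>" "C2 = cls u2"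
      by (meson Lp_space_cases)
    have "X.mball C1 (min e1 e2) \<subseteq> X.mball C1 e1" "X.mball C2 (min e1 e2) \<subseteq> X.mball C2 e2"
      by (auto intro!: X.mball_subset_concentric)
    then have "X.mball (cls u1) (min e1 e2) \<times> X.mball (cls u2) (min e1 e2) \<subseteq> U"
      using u e A(5) by blast
    then show ?thesis
      using u e by (intro exI[of _ u1] exI[of _ u2] exI[of _ "min e1 e2"]) auto
  qed
  show ?thesis
    unfolding weakly_mixing_def topologically_transitive_def Lp_topology_def
  proof (intro allI impI, elim conjE)
    fix U W :: "(('i, 'k) edge_fun set \<times> ('i, 'k) edge_fun set) set"
    assume "openin (prod_topology X.mtopology X.mtopology) U" "U \<noteq> {}"
    then obtain u1 u2 \<epsilon>1 where u: "u1 \<in> \<L>" "u2 \<in> \<L>" "0 < \<epsilon>1" "X.mball (cls u1) \<epsilon>1 \<times> X.mball (cls u2) \<epsilon>1 \<subseteq> U"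
      using balls by blast
    assume "openin (prod_topology X.mtopology X.mtopology) W" "W \<noteq> {}"
    then obtain v1 v2 \<epsilon>2 where v: "v1 \<in> \<L>" "v2 \<in> \<L>" "0 < \<epsilon>2" "X.mball (cls v1) \<epsilon>2 \<times> X.mball (cls v2) \<epsilon>2 \<subseteq> W"
      using balls by blast
    obtain t f1 f2 where t: "0 \<le> t" and f: "f1 \<in> \<L>" "f2 \<in> \<L>"
      and close: "dst u1 f1 < min \<epsilon>1 \<epsilon>2" "dst u2 f2 < min \<epsilon>1 \<epsilon>2"
        "dst v1 (\<T> t f1) < min \<epsilon>1 \<epsilon>2"
        "dst v2 (\<T> t f2) < min \<epsilon>1 \<epsilon>2"
      using assms[OF u(1,2) v(1,2), of "min \<epsilon>1 \<epsilon>2"] u(3) v(3) by auto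
    have "(cls f1, cls f2) \<in> U"
      using close u f by (intro subsetD[OF u(4)]) (simp add: cls_in dist_cls)
    moreover have "(?T t (cls f1), ?T t (cls f2)) \<in> W"
      using close v f t
      by (intro subsetD[OF v(4)]) (simp add: cls_in dist_cls translation_semigroup_cls translate_in_Lp_fun)
    ultimately show "\<exists>t\<ge>0. (\<lambda>(x, y). (?T t x, ?T t y)) ` U \<inter> W \<noteq> {}"
      using t by blast
  qed
qed

lemma weakly_mixing_imp_transitive:
  assumes "weakly_mixing (Lp_topology I \<rho> p :: ('i, 'k::{real_normed_field, euclidean_space}) edge_fun set topology)
      (translation_semigroup I e \<rho> p)"
  shows "topologically_transitive (Lp_topology I \<rho> p :: ('i, 'k) edge_fun set topology) (translation_semigroup I e \<rho> p)"
  unfolding topologically_transitive_def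
proof (intro allI impI, elim conjE)
  let ?X = "Lp_topology I \<rho> p :: ('i, 'k) edge_fun set topology" and ?T = "translation_semigroup I e \<rho> p"
  fix U W assume "openin ?X U" "U \<noteq> {}" "openin ?X W" "W \<noteq> {}"
  then have "openin (prod_topology ?X ?X) (U \<times> U) \<and> U \<times> U \<noteq> {} \<and>
      openin (prod_topology ?X ?X) (W \<times> W) \<and> W \<times> W \<noteq> {}"
    by (simp add: openin_prod_Times_iff)
  from assms[unfolded weakly_mixing_def topologically_transitive_def, THEN spec, THEN spec, THEN mp, OF this]
  obtain t where t: "0 \<le> t" "(\<lambda>(x, y). (?T t x, ?T t y)) ` (U \<times> U) \<inter> (W \<times> W) \<noteq> {}"
    by (elim exE conjE)
  then obtain x where "x \<in> U" "?T t x \<in> W" by auto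
  then show "\<exists>t\<ge>0. ?T t ` U \<inter> W \<noteq> {}" using t(1) by blast
qed

text \<open>
  Birkhoff's transitivity theorem: the vectors whose orbit meets a given ball form an open dense
  set, and countably many balls suffice.
\<close>

lemma transitive_imp_hypercyclic:
  assumes trans: "topologically_transitive (Lp_topology I \<rho> p :: ('i, 'k::{real_normed_field, euclidean_space}) edge_fun set topology)
      (translation_semigroup I e \<rho> p)"
  shows "hypercyclic (Lp_topology I \<rho> p :: ('i, 'k) edge_fun set topology) (translation_semigroup I e \<rho> p)"
proof -
  interpret X: Metric_space "Lp_space I \<rho> p :: ('i, 'k) edge_fun set set" "Lp_dist I \<rho> p"
    by (rule Metric_space_Lp)
  let ?M = "Lp_space I \<rho> p :: ('i, 'k) edge_fun set set"
  let ?T = "translation_semigroup I e \<rho> p"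
  obtain Q :: "'k set" where Q: "countable Q" "\<And>X. open X \<Longrightarrow> X \<noteq> {} \<Longrightarrow> \<exists>q\<in>Q. q \<in> X"
    by (rule countable_dense_setE) blast
  define O' where "O' q m = {C \<in> ?M. \<exists>t\<ge>0. ?T t C \<in> X.mball (cls q) (1 / (real m + 1))}"
    for q :: "('i, 'k) edge_fun" and m :: nat
  have O_open: "openin X.mtopology (O' q m)" if q: "q \<in> \<L>" for q m
    unfolding X.openin_mtopology
  proof (intro conjI allI impI)
    show "O' q m \<subseteq> ?M" by (auto simp: O'_def)
    fix C assume "C \<in> O' q m"
    then obtain t where C: "C \<in> ?M" and t: "0 \<le> t" and in_ball: "?T t C \<in> X.mball (cls q) (1 / (real m + 1))"
      unfolding O'_def by blast
    from C obtain f where f: "f \<in> \<L>" "C = cls f" by (rule Lp_space_cases)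
    from in_ball have lt: "dst q (\<T> t f) < 1 / (real m + 1)"
      using q f t by (simp add: translation_semigroup_cls cls_in translate_in_Lp_fun dist_cls)
    define k where "k = K t powr (1 / p)"
    have k: "0 < k" using K_ge_1[OF t] by (simp add: k_def)
    define r where "r = (1 / (real m + 1) - dst q (\<T> t f)) / k"
    have "X.mball C r \<subseteq> O' q m"
    proof
      fix C' assume C': "C' \<in> X.mball C r"
      then have "C' \<in> ?M" by simp
      then obtain g where g: "g \<in> \<L>" "C' = cls g" by (rule Lp_space_cases)
      have "dst f g < r"
        using C' f g by (simp add: dist_cls)
      then have "k * dst f g < k * r"
        using k by (rule mult_strict_left_mono)
      also have "k * r = 1 / (real m + 1) - dst q (\<T> t f)"
        using k by (simp add: r_def)
      finally have "k * dst f g < 1 / (real m + 1) - dst q (\<T> t f)" .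
      moreover have "dst q (\<T> t g) \<le> dst q (\<T> t f)
          + dst (\<T> t f) (\<T> t g)"
        by (intro N_triangle q translate_in_Lp_fun[OF t] f g)
      moreover have "dst (\<T> t f) (\<T> t g) \<le> k * dst f g"
        unfolding k_def by (rule N_translate_diff_le[OF t f(1) g(1)])
      ultimately have "dst q (\<T> t g) < 1 / (real m + 1)"
        by simp
      then show "C' \<in> O' q m"
        using g q t unfolding O'_def
        by (auto simp: translation_semigroup_cls cls_in translate_in_Lp_fun dist_cls intro!: exI[of _ t])
    qed
    moreover have "0 < r" using lt k by (simp add: r_def)
    ultimately show "\<exists>r>0. X.mball C r \<subseteq> O' q m" by blast
  qed
  have O_dense: "X.mtopology closure_of (O' q m) = ?M" if q: "q \<in> \<L>" for q m
    unfolding X.metric_closure_of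
  proof (intro equalityI subsetI CollectI conjI allI impI)
    fix C r assume C: "C \<in> ?M" and r: "0 < (r::real)"
    have "0 < 1 / (real m + 1)" by (intro divide_pos_pos) auto
    then have "cls q \<in> X.mball (cls q) (1 / (real m + 1))" "C \<in> X.mball C r"
      using C r cls_in[OF q] by simp_all
    then have "openin X.mtopology (X.mball C r) \<and> X.mball C r \<noteq> {} \<and>
        openin X.mtopology (X.mball (cls q) (1 / (real m + 1))) \<and> X.mball (cls q) (1 / (real m + 1)) \<noteq> {}"
      using X.openin_mball by blast
    from trans[unfolded topologically_transitive_def Lp_topology_def, rule_format, OF this]
    obtain t where "0 \<le> t" "?T t ` X.mball C r \<inter> X.mball (cls q) (1 / (real m + 1)) \<noteq> {}"
      by blast
    then obtain C' where "C' \<in> X.mball C r" "?T t C' \<in> X.mball (cls q) (1 / (real m + 1))" by blast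
    then show "\<exists>y\<in>O' q m. y \<in> X.mball C r"
      using \<open>0 \<le> t\<close> by (intro bexI[of _ C']) (auto simp: O'_def)
  qed auto
  let ?G = "(\<lambda>(Ls, m). O' (step_family Ls) m) ` (lists (lists Q) \<times> UNIV)"
  have "countable ?G"
    using Q(1) by (intro countable_image countable_SIGMA countable_lists) auto
  then have "X.mtopology closure_of \<Inter>?G = ?M"
  proof (rule X.metric_Baire_category[OF mcomplete_Lp])
    fix A assume "A \<in> ?G"
    then show "openin X.mtopology A \<and> X.mtopology closure_of A = ?M"
      using O_open[OF step_family_in_\<L>] O_dense[OF step_family_in_\<L>] by auto
  qed
  moreover have "?M \<noteq> {}"
    using cls_in[OF step_family_in_\<L>[of "[]"]] by blast
  ultimately have "\<Inter>?G \<noteq> {}"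
    using closure_of_empty by force
  then obtain C where "C \<in> \<Inter>?G" by blast
  then have C: "C \<in> O' (step_family Ls) m" if "Ls \<in> lists (lists Q)" for Ls m
    using that by force
  have "C \<in> ?M"
    using C[of "[]" 0] by (simp add: O'_def)
  then obtain x where x: "x \<in> \<L>" "C = cls x" by (rule Lp_space_cases)
  show ?thesis
    unfolding hypercyclic_iff
  proof (intro exI[of _ x] conjI x ballI allI impI)
    fix y :: "('i, 'k) edge_fun" and \<epsilon> :: real assume y: "y \<in> \<L>" and \<epsilon>: "0 < \<epsilon>"
    obtain Ls where Ls: "Ls \<in> lists (lists Q)" "dst y (step_family Ls) \<le> \<epsilon> / 2"
      using step_families_dense[OF y _ Q(2), of "\<epsilon> / 2"] \<epsilon> by auto
    obtain m :: nat where m: "1 / (real m + 1) < \<epsilon> / 2"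
      using reals_Archimedean[of "\<epsilon> / 2"] \<epsilon> by (auto simp: inverse_eq_divide add.commute)
    from C[OF Ls(1), of m] obtain t where t: "0 \<le> t"
      and "dst (step_family Ls) (\<T> t x) < 1 / (real m + 1)"
      using x by (auto simp: O'_def translation_semigroup_cls cls_in translate_in_Lp_fun dist_cls step_family_in_\<L>)
    moreover have "dst y (\<T> t x) \<le> dst y (step_family Ls)
        + dst (step_family Ls) (\<T> t x)"
      by (intro N_triangle y step_family_in_\<L> translate_in_Lp_fun[OF t] x)
    ultimately have "dst y (\<T> t x) < \<epsilon>"
      using Ls(2) m by simp
    then show "\<exists>t\<ge>0. dst y (\<T> t x) < \<epsilon>"
      using t by blast
  qed
qed

end

section \<open>The condition on the weight\<close>

context weighted_tree
begin

abbreviation cost_ge :: "nat \<Rightarrow> 'i \<Rightarrow> real \<Rightarrow> real \<Rightarrow> bool" where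
  "cost_ge n i s c \<equiv> mass_cost_ge p (D n i) (\<lambda>j. \<rho> j s) c"

text \<open>
  Contrapositively, a low cost for \<open>i'\<close> at a single point \<open>s\<close> gives a low cost for the parent edge
  at every point \<open>r\<close>. Indeed a point and any point of a child edge are less than \<open>2\<close> apart, and
  admissibility compares the weights at such a distance.
\<close>

lemma cost_ge_child:
  assumes i': "i' \<in> I" "par i' = i" and r: "0 \<le> r" "r < 1" and s: "0 \<le> s" "s < 1"
    and c: "0 < c" and cost: "cost_ge n i r (K 2 * c)"
  shows "cost_ge n i' s c"
proof -
  have i: "i \<in> I" using i' par_in by blast
  have K2: "1 \<le> K 2" by (rule K_ge_1) simp
  let ?t = "1 + s - r"
  have t: "0 \<le> ?t" "?t \<le> 2" using r s by auto
  have "\<lfloor>r + ?t\<rfloor> = 1" using s by (intro floor_unique) auto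
  then have steps: "steps ?t r = 1" by simp
  have pos: "pos ?t r = s" unfolding steps by simp
  have "mass_cost_ge p (\<Union>j\<in>D n i. D 1 j) (\<lambda>k. \<rho> k s) c"
  proof (rule mass_cost_ge_UN[OF p_ge_1 c _ cost])
    show "mass_cost_ge p (D 1 j) (\<lambda>k. \<rho> k s) (\<rho> j r / K 2)" if "j \<in> D n i" for j
    proof -
      have j: "j \<in> I" using that descendants_subset by blast
      have "0 < \<rho> j r" by (rule \<rho>_pos[OF j r])
      moreover have "1 \<le> K ?t" "K ?t \<le> K 2" by (rule K_ge_1[OF t(1)], rule K_mono[OF t])
      ultimately have "\<rho> j r / K 2 \<le> \<rho> j r / K ?t" "0 < \<rho> j r / K 2"
        using K2 by (auto intro!: divide_left_mono)
      moreover have "mass_cost_ge p (D 1 j) (\<lambda>k. \<rho> k s) (\<rho> j r / K ?t)"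
        using descendants_cost[OF j r t(1)] unfolding pos unfolding steps .
      ultimately show ?thesis
        using mass_cost_ge_mono[OF p_ge_1] by blast
    qed
    show "0 < \<rho> j r" if "j \<in> D n i" for j
      using that descendants_subset by (intro \<rho>_pos[OF _ r]) blast
    show "j = j'" if "j \<in> D n i" "j' \<in> D n i" "k \<in> D 1 j" "k \<in> D 1 j'" for j j' k
      using that descendants_subset descendants_disjoint by blast
  qed (use K2 in \<open>auto intro: countable_descendants\<close>)
  moreover have "D n i' \<subseteq> (\<Union>j\<in>D n i. D 1 j)"
    unfolding descendants_add[OF i, symmetric] using i i' by (auto simp: descendants_eq)
  ultimately show ?thesis by (rule mass_cost_ge_mono_set)
qed

text \<open>
  This is the case \<open>n = 0\<close> of the preceding comparison, where the only descendant is the edge itself.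
\<close>

lemma weight_le_child:
  assumes i': "i' \<in> I" and r: "0 \<le> r" "r < 1" and s: "0 \<le> s" "s < 1"
  shows "\<rho> (par i') r \<le> K 2 * \<rho> i' s"
proof -
  have i: "par i' \<in> I" by (rule par_in[OF i'])
  have K2: "1 \<le> K 2" by (rule K_ge_1) simp
  define c where "c = \<rho> (par i') r / K 2"
  have c: "0 < c" "K 2 * c = \<rho> (par i') r"
    using \<rho>_pos[OF i r] K2 by (auto simp: c_def)
  have D0: "D 0 j = {j}" if "j \<in> I" for j
    using that by (auto simp: descendants_eq)
  have "cost_ge 0 (par i') r (K 2 * c)"
    using c K2 \<rho>_pos[OF i r] by (simp add: D0[OF i] mass_cost_ge_singleton[OF p_ge_1])
  then have "cost_ge 0 i' s c"
    by (rule cost_ge_child[OF i' refl r s c(1)])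
  then have "c \<le> \<rho> i' s"
    by (simp add: D0[OF i'] mass_cost_ge_singleton[where j = i' and r = "\<lambda>j. \<rho> j s", OF p_ge_1 c(1) \<rho>_pos[OF i' s]])
  then show ?thesis
    using K2 by (simp add: c_def field_simps)
qed

text \<open>
  The edge \<open>i\<close> can be reached cheaply in \<open>n\<close> steps, and what starts on \<open>i\<close> can be disposed of cheaply
  after \<open>n\<close> steps: either because the image lives where the weight is small, or because the image
  can be cancelled by that of a cheap mass. Single points of the edges suffice here.
\<close>

definition cheap :: "nat \<Rightarrow> 'i \<Rightarrow> real \<Rightarrow> bool" where
  "cheap n i c \<longleftrightarrow> (\<exists>s\<in>{0..<1}. \<not> cost_ge n i s c) \<and>
     (\<exists>s\<in>{0..<1}. \<rho> ((par ^^ n) i) s < c \<or> \<not> cost_ge n ((par ^^ n) i) s c)"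

definition uniformly_cheap :: "nat \<Rightarrow> 'i \<Rightarrow> real \<Rightarrow> bool" where
  "uniformly_cheap n i c \<longleftrightarrow> (\<forall>s\<in>{0..<1}. \<not> cost_ge n i s c) \<and>
     ((\<forall>s\<in>{0..<1}. \<rho> ((par ^^ n) i) s \<le> c) \<or> (\<forall>s\<in>{0..<1}. \<not> cost_ge n ((par ^^ n) i) s c))"

text \<open>
  The \<open>n\<close>-th ancestor of \<open>i\<close> is the parent of the \<open>n\<close>-th ancestor of the child \<open>i'\<close>, so the same \<open>n\<close>
  serves both edges, and the comparison with child edges applies on either side.
\<close>

lemma cheap_child_imp_uniformly_cheap:
  assumes i': "i' \<in> I" "par i' = i" and c: "0 < c" and cheap: "cheap n i' (c / K 2)"
  shows "uniformly_cheap n i c"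
proof -
  have K2: "1 \<le> K 2" by (rule K_ge_1) simp
  define c' where "c' = c / K 2"
  have c': "0 < c'" "K 2 * c' = c" using c K2 by (auto simp: c'_def)
  note cheap = cheap[folded c'_def]
  have up: "\<not> cost_ge n j r c" if "k \<in> I" "par k = j" "0 \<le> s" "s < 1" "\<not> cost_ge n k s c'" "0 \<le> r" "r < 1" for k j r s
    using cost_ge_child[OF that(1,2,6,7,3,4) c'(1)] that(5) c'(2) by auto
  let ?k = "(par ^^ n) i'"
  have k: "?k \<in> I" "par ?k = (par ^^ n) i"
    using funpow_par_in[OF i'(1)] i'(2) funpow_swap1[of par n i'] by auto
  have "\<forall>s\<in>{0..<1}. \<not> cost_ge n i s c"
    using cheap up[OF i'] unfolding cheap_def by auto
  moreover obtain s where s: "0 \<le> s" "s < 1" "\<rho> ?k s < c' \<or> \<not> cost_ge n ?k s c'"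
    using cheap unfolding cheap_def by auto
  have "(\<forall>r\<in>{0..<1}. \<rho> ((par ^^ n) i) r \<le> c) \<or> (\<forall>r\<in>{0..<1}. \<not> cost_ge n ((par ^^ n) i) r c)"
    using s(3)
  proof
    assume less: "\<rho> ?k s < c'"
    have "\<rho> ((par ^^ n) i) r \<le> c" if r: "0 \<le> r" "r < 1" for r
    proof -
      have "\<rho> ((par ^^ n) i) r \<le> K 2 * \<rho> ?k s"
        using weight_le_child[OF k(1) r s(1,2)] k(2) by simp
      also have "\<dots> \<le> K 2 * c'" using less K2 by (intro mult_left_mono) auto
      finally show ?thesis by (simp add: c')
    qed
    then show ?thesis by auto
  next
    assume "\<not> cost_ge n ?k s c'"
    then show ?thesis using up[OF k s(1,2)] by auto
  qed
  ultimately show ?thesis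
    unfolding uniformly_cheap_def by blast
qed

section \<open>Cheap preimages under the semigroup\<close>

lemma bounded_on_norm_le:
  "bounded_on F B f \<Longrightarrow> i \<in> I \<Longrightarrow> 0 \<le> s \<Longrightarrow> s < 1 \<Longrightarrow> norm (f i s) \<le> (if i \<in> F then B else 0)"
  unfolding bounded_on_def by simp

lemma steps_of_nat: "0 \<le> s \<Longrightarrow> s < 1 \<Longrightarrow> steps (real n) s = n"
  by (simp add: floor_eq_iff nat_eq_iff)

lemma translate_of_nat:
  assumes "i \<in> I" "0 \<le> s" "s < 1"
  shows "\<T> (real n) f i s = (\<Sum>\<^sub>\<infinity>j\<in>D n i. f j s)"
  unfolding translate_eq[OF assms(1)] steps_of_nat[OF assms(2,3)] by simp

lemma cheap_unit_mass:
  assumes k: "k \<in> I" and c: "0 < c" and cheap: "\<And>s. 0 \<le> s \<Longrightarrow> s < 1 \<Longrightarrow> \<not> cost_ge n k s c"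
  obtains \<alpha> :: "'i \<Rightarrow> real \<Rightarrow> real" where
    "\<And>j. j \<in> D n k \<Longrightarrow> \<alpha> j \<in> edge_borel"
    "\<And>s. 0 \<le> s \<Longrightarrow> s < 1 \<Longrightarrow> ((\<lambda>j. \<alpha> j s) has_sum 1) (D n k)"
    "\<And>s. 0 \<le> s \<Longrightarrow> s < 1 \<Longrightarrow> (\<Sum>\<^sub>\<infinity>j\<in>D n k. ennreal (\<bar>\<alpha> j s\<bar> powr p * \<rho> j s)) \<le> ennreal c"
proof (cases "p = 1")
  case True
  \<comment> \<open>The whole mass sits on the first edge, in a fixed enumeration, where the weight is small.\<close>
  let ?D = "D n k"
  define idx where "idx = to_nat_on I"
  have inj: "inj_on idx I"
    unfolding idx_def by (rule inj_on_to_nat_on[OF countable_index])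
  define B where "B j = {l \<in> ?D. idx l < idx j}" for j
  have B: "finite (B j)" "B j \<subseteq> I" for j
  proof -
    have "B j \<subseteq> {i \<in> I. to_nat_on I i < idx j}"
      by (auto simp: B_def idx_def dest: subsetD[OF descendants_subset])
    from finite_subset[OF this finite_initial_edges] this
    show "finite (B j)" "B j \<subseteq> I" by auto
  qed
  define \<alpha> where "\<alpha> j s = (if \<rho> j s < c then 1 else 0) * (\<Prod>l\<in>B j. if \<rho> l s < c then 0 else (1::real))" for j s
  have first: "\<exists>j0\<in>?D. \<rho> j0 s < c \<and> (\<forall>j\<in>?D. \<alpha> j s = (if j = j0 then 1 else 0))" if s: "0 \<le> s" "s < 1" for s
  proof -
    let ?P = "\<lambda>m. \<exists>j\<in>?D. \<rho> j s < c \<and> idx j = m"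
    have "\<exists>m. ?P m"
      using cheap[OF s] True by (auto simp: mass_cost_ge_def not_le)
    then obtain j0 where j0: "j0 \<in> ?D" "\<rho> j0 s < c" "idx j0 = (LEAST m. ?P m)"
      using LeastI_ex[of ?P] by blast
    have least: "idx j0 \<le> idx j" if "j \<in> ?D" "\<rho> j s < c" for j
      unfolding j0(3) using that by (intro Least_le) blast
    have "\<alpha> j s = (if j = j0 then 1 else 0)" if j: "j \<in> ?D" for j
    proof (cases "j = j0")
      case True
      have "(\<Prod>l\<in>B j0. if \<rho> l s < c then 0 else (1::real)) = 1"
        using least by (intro prod.neutral) (force simp: B_def)
      then show ?thesis using True j0(2) by (simp add: \<alpha>_def)
    next
      case False
      show ?thesis
      proof (cases "\<rho> j s < c")
        case small: True
        have "idx j0 \<noteq> idx j"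
          using inj j j0(1) False descendants_subset by (metis inj_onD subsetD)
        then have "j0 \<in> B j"
          using least[OF j small] j0(1) by (simp add: B_def)
        then have "(\<Prod>l\<in>B j. if \<rho> l s < c then 0 else (1::real)) = 0"
          using B(1) j0(2) by (intro prod_zero) auto
        then show ?thesis using False by (simp add: \<alpha>_def)
      qed (simp add: \<alpha>_def False)
    qed
    with j0 show ?thesis by blast
  qed
  show ?thesis
  proof (rule that[of \<alpha>])
    fix j assume "j \<in> ?D"
    then have [measurable]: "\<rho> j \<in> edge_borel"
      using descendants_subset by (intro \<rho>_measurable) blast
    have "(\<lambda>s. \<Prod>l\<in>B j. if \<rho> l s < c then 0 else (1::real)) \<in> edge_borel"
    proof (rule borel_measurable_prod)
      fix l assume "l \<in> B j"
      then have [measurable]: "\<rho> l \<in> edge_borel"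
        using B(2) by (intro \<rho>_measurable) blast
      show "(\<lambda>s. if \<rho> l s < c then 0 else (1::real)) \<in> edge_borel" by measurable
    qed
    then show "\<alpha> j \<in> edge_borel"
      unfolding \<alpha>_def by measurable
  next
    fix s :: real assume s: "0 \<le> s" "s < 1"
    obtain j0 where j0: "j0 \<in> ?D" "\<rho> j0 s < c" "\<And>j. j \<in> ?D \<Longrightarrow> \<alpha> j s = (if j = j0 then 1 else 0)"
      using first[OF s] by blast
    have "((\<lambda>j. \<alpha> j s) has_sum 1) {j0}"
      using has_sum_finite[of "{j0}" "\<lambda>j. \<alpha> j s"] j0 by simp
    then show "((\<lambda>j. \<alpha> j s) has_sum 1) ?D"
      by (rule has_sum_cong_neutral[THEN iffD1, rotated -1]) (use j0 in auto)
    have "(\<Sum>\<^sub>\<infinity>j\<in>?D. ennreal (\<bar>\<alpha> j s\<bar> powr p * \<rho> j s)) = (\<Sum>\<^sub>\<infinity>j\<in>{j0}. ennreal (\<bar>\<alpha> j s\<bar> powr p * \<rho> j s))"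
      by (rule infsum_cong_neutral) (use j0 p_ge_1 in auto)
    then show "(\<Sum>\<^sub>\<infinity>j\<in>?D. ennreal (\<bar>\<alpha> j s\<bar> powr p * \<rho> j s)) \<le> ennreal c"
      using j0 by (simp add: ennreal_leI)
  qed
next
  case False
  \<comment> \<open>The minimiser of the cost, from the equality case of Hoelder's inequality.\<close>
  let ?D = "D n k"
  have p1: "1 < p" using False p_ge_1 by simp
  define q where "q = 1 / (p - 1)"
  have q: "0 < q" "q * p = 1 + q" "q * (p - 1) = 1" "- 1 / (p - 1) = - q"
    using p1 by (auto simp: q_def field_simps)
  define S where "S s = (\<Sum>\<^sub>\<infinity>j\<in>?D. ennreal (\<rho> j s powr - q))" for s
  have \<rho>: "0 < \<rho> j s" if "j \<in> ?D" "0 \<le> s" "s < 1" for j s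
    using that descendants_subset by (intro \<rho>_pos) auto
  have S_fin: "S s < \<infinity>" if s: "0 \<le> s" "s < 1" for s
  proof -
    have "cost_ge n k s (\<rho> k s / K (real n))"
      using descendants_cost[OF k s, of "real n"] unfolding steps_of_nat[OF s] by simp
    then have "S s \<le> ennreal ((\<rho> k s / K (real n)) powr - q)"
      unfolding mass_cost_ge_def S_def q(4) using False by simp
    then show ?thesis by (auto intro: le_less_trans)
  qed
  define R where "R s = enn2real (S s)" for s
  have S_R: "S s = ennreal (R s)" if "0 \<le> s" "s < 1" for s
    using S_fin[OF that] by (simp add: R_def)
  have R: "c powr - q < R s" if s: "0 \<le> s" "s < 1" for s
  proof -
    have "ennreal (c powr - q) < ennreal (R s)"
      using cheap[OF s] False
      unfolding mass_cost_ge_def S_R[OF s, symmetric] S_def q(4) by (simp add: not_le)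
    then show ?thesis by (simp add: ennreal_less_iff)
  qed
  then have R0: "0 < R s" if "0 \<le> s" "s < 1" for s
    using that powr_ge_zero[of c "- q"] by (metis less_le_trans le_less_trans)
  define \<alpha> where "\<alpha> j s = \<rho> j s powr - q / R s" for j s
  have [measurable]: "R \<in> edge_borel"
  proof -
    have "S \<in> edge_borel"
      unfolding S_def
    proof (rule borel_measurable_infsum_ennreal[OF countable_descendants])
      fix j assume "j \<in> ?D"
      then have [measurable]: "\<rho> j \<in> edge_borel"
        using descendants_subset by (intro \<rho>_measurable) blast
      show "(\<lambda>s. ennreal (\<rho> j s powr - q)) \<in> edge_borel" by measurable
    qed
    then show ?thesis unfolding R_def by measurable
  qed
  show ?thesis
  proof (rule that[of \<alpha>])
    fix j assume "j \<in> ?D"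
    then have [measurable]: "\<rho> j \<in> edge_borel"
      using descendants_subset by (intro \<rho>_measurable) blast
    show "\<alpha> j \<in> edge_borel" unfolding \<alpha>_def by measurable
  next
    fix s :: real assume s: "0 \<le> s" "s < 1"
    have summable: "(\<lambda>j. \<rho> j s powr - q) summable_on ?D"
      by (rule summable_on_if_infsum_ennreal_finite) (use S_fin[OF s] in \<open>auto simp: S_def\<close>)
    have "ennreal (\<Sum>\<^sub>\<infinity>j\<in>?D. \<rho> j s powr - q) = ennreal (R s)"
      using ennreal_infsum[OF summable] S_R[OF s] by (simp add: S_def)
    then have "(\<Sum>\<^sub>\<infinity>j\<in>?D. \<rho> j s powr - q) = R s"
      using R0[OF s] by (subst (asm) ennreal_inj) (auto intro: infsum_nonneg)
    then have "((\<lambda>j. \<rho> j s powr - q) has_sum R s) ?D"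
      using has_sum_infsum[OF summable] by simp
    then have "((\<lambda>j. \<rho> j s powr - q * (1 / R s)) has_sum R s * (1 / R s)) ?D"
      by (rule has_sum_cmult_left)
    then show "((\<lambda>j. \<alpha> j s) has_sum 1) ?D"
      using R0[OF s] by (simp add: \<alpha>_def)
    have "ennreal (\<bar>\<alpha> j s\<bar> powr p * \<rho> j s) = ennreal (R s powr - p) * ennreal (\<rho> j s powr - q)"
      if j: "j \<in> ?D" for j
    proof -
      have "(\<rho> j s powr - q) powr p * \<rho> j s powr 1 = \<rho> j s powr - q"
        using q(2) by (simp only: powr_powr mult_minus_left flip: powr_add) simp
      then have 1: "(\<rho> j s powr - q) powr p * \<rho> j s = \<rho> j s powr - q"
        using \<rho>[OF j s] by simp
      have 2: "\<bar>\<alpha> j s\<bar> powr p = (\<rho> j s powr - q) powr p / R s powr p"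
        using R0[OF s] by (simp add: \<alpha>_def powr_divide)
      have "\<bar>\<alpha> j s\<bar> powr p * \<rho> j s = R s powr - p * ((\<rho> j s powr - q) powr p * \<rho> j s)"
        unfolding 2 powr_minus_divide[of "R s" p] by (simp only: times_divide_eq_left mult_1_left)
      then have "\<bar>\<alpha> j s\<bar> powr p * \<rho> j s = R s powr - p * \<rho> j s powr - q"
        by (simp only: 1)
      then show ?thesis by (simp flip: ennreal_mult)
    qed
    then have "(\<Sum>\<^sub>\<infinity>j\<in>?D. ennreal (\<bar>\<alpha> j s\<bar> powr p * \<rho> j s))
        = (\<Sum>\<^sub>\<infinity>j\<in>?D. ennreal (R s powr - p) * ennreal (\<rho> j s powr - q))"
      by (rule infsum_cong)
    also have "\<dots> = ennreal (R s powr - p) * S s"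
      unfolding S_def by (rule infsum_cmult_ennreal[OF countable_descendants])
    also have "\<dots> = ennreal (R s powr - (p - 1))"
    proof -
      have "R s powr - p * R s powr 1 = R s powr (- p + 1)" by (simp only: powr_add)
      then have "R s powr - p * R s = R s powr - (p - 1)" using R0[OF s] by simp
      then show ?thesis
        using R0[OF s] by (simp add: S_R[OF s] flip: ennreal_mult)
    qed
    also have "\<dots> \<le> ennreal c"
    proof (rule ennreal_leI)
      have "R s powr - (p - 1) \<le> (c powr - q) powr - (p - 1)"
        using R[OF s] c p1 by (intro powr_mono2') auto
      also have "\<dots> = c"
        using q(3) c by (simp only: powr_powr minus_mult_minus) simp
      finally show "R s powr - (p - 1) \<le> c" .
    qed
    finally show "(\<Sum>\<^sub>\<infinity>j\<in>?D. ennreal (\<bar>\<alpha> j s\<bar> powr p * \<rho> j s)) \<le> ennreal c" .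
  qed
qed

text \<open>
  Distribute the values of \<open>g\<close> on every edge \<open>k\<close> over the descendants of \<open>k\<close> in the proportions of a
  cheap unit mass; the translation by \<open>n\<close> adds them up again.
\<close>

lemma cheap_preimage:
  fixes g :: "('i, 'k::{real_normed_field, euclidean_space}) edge_fun"
  assumes G: "finite G" "G \<subseteq> I" and B: "0 \<le> B" and g: "bounded_on G B g" and c: "0 < c"
    and cheap: "\<And>k s. k \<in> G \<Longrightarrow> 0 \<le> s \<Longrightarrow> s < 1 \<Longrightarrow> \<not> cost_ge n k s c"
  obtains w :: "('i, 'k) edge_fun" where "w \<in> \<L>"
    "Lp_sum I \<rho> p w \<le> ennreal (real (card G) * (B powr p * c))"
    "\<And>i s. i \<in> I \<Longrightarrow> 0 \<le> s \<Longrightarrow> s < 1 \<Longrightarrow> \<T> (real n) w i s = g i s"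
proof -
  have "\<forall>k\<in>G. \<exists>\<alpha>. (\<forall>j\<in>D n k. \<alpha> j \<in> edge_borel) \<and>
      (\<forall>s\<in>{0..<1}. ((\<lambda>j. \<alpha> j s) has_sum (1::real)) (D n k) \<and>
        (\<Sum>\<^sub>\<infinity>j\<in>D n k. ennreal (\<bar>\<alpha> j s\<bar> powr p * \<rho> j s)) \<le> ennreal c)"
  proof
    fix k assume k: "k \<in> G"
    have "k \<in> I" using k G by blast
    obtain \<alpha> :: "'i \<Rightarrow> real \<Rightarrow> real" where
      "\<And>j. j \<in> D n k \<Longrightarrow> \<alpha> j \<in> edge_borel"
      "\<And>s. 0 \<le> s \<Longrightarrow> s < 1 \<Longrightarrow> ((\<lambda>j. \<alpha> j s) has_sum 1) (D n k)"
      "\<And>s. 0 \<le> s \<Longrightarrow> s < 1 \<Longrightarrow> (\<Sum>\<^sub>\<infinity>j\<in>D n k. ennreal (\<bar>\<alpha> j s\<bar> powr p * \<rho> j s)) \<le> ennreal c"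
      using cheap_unit_mass[OF \<open>k \<in> I\<close> c cheap[OF k]] by blast
    then show "\<exists>\<alpha>. (\<forall>j\<in>D n k. \<alpha> j \<in> edge_borel) \<and>
      (\<forall>s\<in>{0..<1}. ((\<lambda>j. \<alpha> j s) has_sum (1::real)) (D n k) \<and>
        (\<Sum>\<^sub>\<infinity>j\<in>D n k. ennreal (\<bar>\<alpha> j s\<bar> powr p * \<rho> j s)) \<le> ennreal c)"
      by (intro exI[of _ \<alpha>]) auto
  qed
  then obtain \<alpha> :: "'i \<Rightarrow> 'i \<Rightarrow> real \<Rightarrow> real" where
    \<alpha>: "\<forall>k\<in>G. (\<forall>j\<in>D n k. \<alpha> k j \<in> edge_borel) \<and>
      (\<forall>s\<in>{0..<1}. ((\<lambda>j. \<alpha> k j s) has_sum 1) (D n k) \<and>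
        (\<Sum>\<^sub>\<infinity>j\<in>D n k. ennreal (\<bar>\<alpha> k j s\<bar> powr p * \<rho> j s)) \<le> ennreal c)"
    by (rule bchoice[THEN exE])
  define a where "a j = (par ^^ n) j" for j
  define w where "w j s = (if a j \<in> G then \<alpha> (a j) j s *\<^sub>R g (a j) s else 0)" for j s
  have a: "a j = k" if "j \<in> D n k" "k \<in> I" for j k
    using that by (simp add: a_def descendants_eq)
  have wm: "w j \<in> edge_borel" if j: "j \<in> I" for j
  proof (cases "a j \<in> G")
    case True
    have "j \<in> D n (a j)" using j funpow_par_in[OF j] by (simp add: descendants_eq a_def)
    then have [measurable]: "\<alpha> (a j) j \<in> edge_borel" using \<alpha> True by blast
    have [measurable]: "g (a j) \<in> edge_borel"
      using bounded_on_measurable[OF g] True G by blast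
    show ?thesis using True unfolding w_def by simp
  next
    case False
    then show ?thesis unfolding w_def by simp
  qed
  have wk: "w j s = \<alpha> k j s *\<^sub>R g k s" if "j \<in> D n k" "k \<in> G" for j k s
    using a[OF that(1)] that G by (auto simp: w_def)
  have w0: "w j s = 0" if "j \<in> D n k" "k \<in> I - G" for j k s
    using a[OF that(1)] that by (auto simp: w_def)
  have "\<T> (real n) w i s = g i s" if i: "i \<in> I" and s: "0 \<le> s" "s < 1" for i s
  proof (cases "i \<in> G")
    case True
    have "((\<lambda>j. \<alpha> i j s) has_sum 1) (D n i)" using \<alpha> True s by auto
    then have "(\<Sum>\<^sub>\<infinity>j\<in>D n i. \<alpha> i j s *\<^sub>R g i s) = 1 *\<^sub>R g i s"
      by (subst infsum_scaleR_left) (auto simp: infsumI dest: has_sum_imp_summable)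
    moreover have "(\<Sum>\<^sub>\<infinity>j\<in>D n i. w j s) = (\<Sum>\<^sub>\<infinity>j\<in>D n i. \<alpha> i j s *\<^sub>R g i s)"
      using wk True by (intro infsum_cong) blast
    ultimately show ?thesis by (simp add: translate_of_nat[OF i s])
  next
    case False
    have "(\<Sum>\<^sub>\<infinity>j\<in>D n i. w j s) = 0"
      using w0 i False by (intro infsum_0) blast
    then show ?thesis
      using bounded_on_zero[OF g] i False s by (simp add: translate_of_nat[OF i s])
  qed
  moreover have sum_le: "Lp_sum I \<rho> p w \<le> ennreal (real (card G) * (B powr p * c))"
  proof -
    let ?A = "\<lambda>j s. ennreal (norm (w j s) powr p * \<rho> j s)"
    have Am: "?A j \<in> edge_borel" if "j \<in> I" for j
      by (rule powr_measurable[of w j, OF wm[OF that] that])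
    have "Lp_sum I \<rho> p w = (\<Sum>\<^sub>\<infinity>k\<in>I. \<Sum>\<^sub>\<infinity>j\<in>D n k. \<integral>\<^sup>+s. ?A j s \<partial>edge_measure)"
      unfolding Lp_sum_def by (rule infsum_descendants[symmetric])
    also have "\<dots> = (\<Sum>\<^sub>\<infinity>k\<in>I. \<integral>\<^sup>+s. (\<Sum>\<^sub>\<infinity>j\<in>D n k. ?A j s) \<partial>edge_measure)"
      using Am descendants_subset by (intro infsum_cong nn_integral_infsum[symmetric] countable_descendants) blast
    also have "\<dots> = (\<Sum>\<^sub>\<infinity>k\<in>G. \<integral>\<^sup>+s. (\<Sum>\<^sub>\<infinity>j\<in>D n k. ?A j s) \<partial>edge_measure)"
    proof (rule infsum_cong_neutral)
      fix k assume k: "k \<in> I - G"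
      have "(\<Sum>\<^sub>\<infinity>j\<in>D n k. ?A j s) = 0" for s
        using w0[OF _ k] p_ge_1 by (intro infsum_0) simp
      then show "(\<integral>\<^sup>+s. (\<Sum>\<^sub>\<infinity>j\<in>D n k. ?A j s) \<partial>edge_measure) = 0" by simp
    qed (use G in auto)
    also have "\<dots> = (\<Sum>k\<in>G. \<integral>\<^sup>+s. (\<Sum>\<^sub>\<infinity>j\<in>D n k. ?A j s) \<partial>edge_measure)"
      using G(1) by simp
    also have "\<dots> \<le> (\<Sum>k\<in>G. ennreal (B powr p * c))"
    proof (rule sum_mono)
      fix k assume k: "k \<in> G"
      have "(\<integral>\<^sup>+s. (\<Sum>\<^sub>\<infinity>j\<in>D n k. ?A j s) \<partial>edge_measure) \<le> (\<integral>\<^sup>+s. ennreal (B powr p * c) \<partial>edge_measure)"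
      proof (rule nn_integral_mono)
        fix s assume "s \<in> space edge_measure"
        then have s: "0 \<le> s" "s < 1" by auto
        have "norm (g k s) \<le> B"
          using bounded_on_norm_le[OF g _ s, of k] k G by auto
        then have gB: "norm (g k s) powr p \<le> B powr p"
          using p_ge_1 by (intro powr_mono2) auto
        have "(\<Sum>\<^sub>\<infinity>j\<in>D n k. ?A j s) \<le> (\<Sum>\<^sub>\<infinity>j\<in>D n k. ennreal (B powr p) * ennreal (\<bar>\<alpha> k j s\<bar> powr p * \<rho> j s))"
        proof (rule infsum_ennreal_mono)
          fix j assume j: "j \<in> D n k"
          have \<rho>: "0 < \<rho> j s" using j descendants_subset by (intro \<rho>_pos s) blast
          have "norm (w j s) powr p * \<rho> j s = norm (g k s) powr p * (\<bar>\<alpha> k j s\<bar> powr p * \<rho> j s)"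
            using wk[OF j k] by (simp add: powr_mult algebra_simps)
          also have "\<dots> \<le> B powr p * (\<bar>\<alpha> k j s\<bar> powr p * \<rho> j s)"
            using gB \<rho> by (intro mult_right_mono) auto
          finally show "?A j s \<le> ennreal (B powr p) * ennreal (\<bar>\<alpha> k j s\<bar> powr p * \<rho> j s)"
            using \<rho> by (simp add: ennreal_leI flip: ennreal_mult)
        qed
        also have "\<dots> = ennreal (B powr p) * (\<Sum>\<^sub>\<infinity>j\<in>D n k. ennreal (\<bar>\<alpha> k j s\<bar> powr p * \<rho> j s))"
          by (rule infsum_cmult_ennreal[OF countable_descendants])
        also have "\<dots> \<le> ennreal (B powr p) * ennreal c"
          using \<alpha> k s by (intro mult_left_mono) auto
        also have "\<dots> = ennreal (B powr p * c)"
          using c by (simp add: ennreal_mult)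
        finally show "(\<Sum>\<^sub>\<infinity>j\<in>D n k. ?A j s) \<le> ennreal (B powr p * c)" .
      qed
      then show "(\<integral>\<^sup>+s. (\<Sum>\<^sub>\<infinity>j\<in>D n k. ?A j s) \<partial>edge_measure) \<le> ennreal (B powr p * c)"
        by (simp add: emeasure_restrict_space)
    qed
    also have "\<dots> = ennreal (real (card G) * (B powr p * c))"
      using c by (simp add: ennreal_mult ennreal_of_nat_eq_real_of_nat)
    finally show ?thesis .
  qed
  moreover have "w \<in> \<L>"
    using sum_le wm by (auto simp: Lp_fun_def intro: le_less_trans)
  ultimately show ?thesis
    using that by blast
qed


lemma bounded_on_translate:
  assumes F: "finite F" "F \<subseteq> I" and B: "0 \<le> B" and u: "bounded_on F B u"
  shows "bounded_on ((\<lambda>i. (par ^^ n) i) ` F) (real (card F) * B) (\<T> (real n) u)"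
  unfolding bounded_on_def
proof (intro ballI conjI)
  fix k assume k: "k \<in> I"
  show "\<T> (real n) u k \<in> edge_borel"
    by (rule translate_measurable[OF _ bounded_on_measurable[OF u] k]) simp_all
  fix s :: real assume "s \<in> {0..<1}"
  then have s: "0 \<le> s" "s < 1" by auto
  have "(\<Sum>\<^sub>\<infinity>j\<in>D n k. u j s) = (\<Sum>\<^sub>\<infinity>j\<in>D n k \<inter> F. u j s)"
    using bounded_on_zero[OF u] s
    by (intro infsum_cong_neutral) (auto dest: subsetD[OF descendants_subset])
  also have "\<dots> = (\<Sum>j\<in>D n k \<inter> F. u j s)"
    using F by simp
  finally have eq: "\<T> (real n) u k s = (\<Sum>j\<in>D n k \<inter> F. u j s)"
    by (simp add: translate_of_nat[OF k s])
  show "norm (\<T> (real n) u k s) \<le> (if k \<in> (\<lambda>i. (par ^^ n) i) ` F then real (card F) * B else 0)"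
  proof (cases "k \<in> (\<lambda>i. (par ^^ n) i) ` F")
    case True
    have "norm (\<Sum>j\<in>D n k \<inter> F. u j s) \<le> (\<Sum>j\<in>D n k \<inter> F. B)"
    proof (rule sum_norm_le)
      fix j assume "j \<in> D n k \<inter> F"
      then show "norm (u j s) \<le> B"
        using bounded_on_norm_le[OF u _ s, of j] F by auto
    qed
    also have "\<dots> \<le> real (card F) * B"
      using B F by (auto intro!: mult_right_mono card_mono)
    finally show ?thesis using True by (simp add: eq)
  next
    case False
    then have "D n k \<inter> F = {}"
      using k F by (auto simp: descendants_eq)
    then show ?thesis using False by (simp add: eq)
  qed
qed

text \<open>
  The perturbation of \<open>u\<close> consists of a cheap preimage of \<open>v\<close>, together with a cheap preimage of
  the negative of the part of the image of \<open>u\<close> that lives where the weight is not small.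
\<close>

lemma uniformly_cheap_connects:
  fixes u v :: "('i, 'k::{real_normed_field, euclidean_space}) edge_fun"
  assumes F: "finite F" "F \<subseteq> I" and B: "0 \<le> B" and u: "bounded_on F B u" and v: "bounded_on F B v"
    and c: "0 < c" and cheap: "\<And>i. i \<in> F \<Longrightarrow> uniformly_cheap n i c"
    and \<epsilon>: "0 \<le> \<epsilon>" "real (2 * card F) * ((B + real (card F) * B) powr p * c) \<le> \<epsilon> powr p"
  shows "\<exists>f\<in>\<L>. dst u f \<le> \<epsilon> \<and> dst v (\<T> (real n) f) \<le> \<epsilon>"
proof -
  let ?T = "\<T> (real n)"
  let ?a = "\<lambda>i. (par ^^ n) i"
  define B1 where "B1 = real (card F) * B"
  have B1: "0 \<le> B1" using B by (simp add: B1_def)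
  define G2 where "G2 = {k \<in> ?a ` F. \<forall>s\<in>{0..<1}. \<not> cost_ge n k s c}"
  have light: "\<rho> k s \<le> c" if "k \<in> ?a ` F - G2" "0 \<le> s" "s < 1" for k s
    using that cheap unfolding uniformly_cheap_def G2_def by fastforce
  have aF: "finite (?a ` F)" "?a ` F \<subseteq> I" "card (?a ` F) \<le> card F"
    using F funpow_par_in by (auto intro: card_image_le)
  define G where "G = F \<union> G2"
  have G: "finite G" "G \<subseteq> I"
    using F aF by (auto simp: G_def G2_def)
  have "card G \<le> card F + card G2"
    unfolding G_def by (rule card_Un_le)
  also have "card G2 \<le> card (?a ` F)"
    using aF(1) by (intro card_mono) (auto simp: G2_def)
  finally have cardG: "card G \<le> 2 * card F"
    using aF(3) by simp
  have Tu: "bounded_on (?a ` F) B1 (?T u)"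
    unfolding B1_def by (rule bounded_on_translate[OF F B u])
  define g where "g i s = v i s - (if i \<in> G2 then ?T u i s else 0)" for i s
  have gm: "g i \<in> edge_borel" if i: "i \<in> I" for i
  proof -
    have [measurable]: "v i \<in> edge_borel" "?T u i \<in> edge_borel"
      using bounded_on_measurable[OF v i] bounded_on_measurable[OF Tu i] by auto
    show ?thesis unfolding g_def by measurable
  qed
  have g: "bounded_on G (B + B1) g"
    unfolding bounded_on_def
  proof (intro ballI conjI gm)
    fix i s assume i: "i \<in> I" and "s \<in> {0..<1::real}"
    then have s: "0 \<le> s" "s < 1" by auto
    have "norm (v i s) \<le> (if i \<in> F then B else 0)"
      by (rule bounded_on_norm_le[OF v i s])
    moreover have "norm (if i \<in> G2 then ?T u i s else 0) \<le> (if i \<in> G2 then B1 else 0)"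
      using bounded_on_norm_le[OF Tu i s] B1 by (auto split: if_splits)
    ultimately have "norm (g i s) \<le> (if i \<in> F then B else 0) + (if i \<in> G2 then B1 else 0)"
      unfolding g_def by (intro order_trans[OF norm_triangle_ineq4] add_mono)
    then show "norm (g i s) \<le> (if i \<in> G then B + B1 else 0)"
      using B B1 by (auto simp: G_def split: if_splits)
  qed
  have cheapG: "\<not> cost_ge n k s c" if "k \<in> G" "0 \<le> s" "s < 1" for k s
    using that cheap unfolding G_def G2_def uniformly_cheap_def by auto
  obtain w :: "('i, 'k) edge_fun" where w: "w \<in> \<L>"
    "Lp_sum I \<rho> p w \<le> ennreal (real (card G) * ((B + B1) powr p * c))"
    "\<And>i s. i \<in> I \<Longrightarrow> 0 \<le> s \<Longrightarrow> s < 1 \<Longrightarrow> ?T w i s = g i s"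
    using cheap_preimage[OF G add_nonneg_nonneg[OF B B1] g c cheapG] by blast
  have uL: "u \<in> \<L>" by (rule bounded_on_in_\<L>[OF u F B])
  have vL: "v \<in> \<L>" by (rule bounded_on_in_\<L>[OF v F B])
  define f where "f i s = u i s - - w i s" for i s
  have f: "f \<in> \<L>"
    unfolding f_def by (rule diff_in_\<L>[OF uL uminus_in_\<L>[OF w(1)]])
  have bound: "real m * (b powr p * c) \<le> \<epsilon> powr p" if "m \<le> 2 * card F" "0 \<le> b" "b \<le> B + B1" for m b
  proof -
    have "real m * (b powr p * c) \<le> real (2 * card F) * ((B + B1) powr p * c)"
      using that c p_ge_1 by (intro mult_mono mult_right_mono powr_mono2) auto
    then show ?thesis using \<epsilon>(2) by (simp add: B1_def)
  qed
  have "dst u f \<le> \<epsilon>"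
  proof (rule N_le_I(2)[OF _ \<epsilon>(1)])
    show "(\<lambda>s. u i s - f i s) \<in> edge_borel" if "i \<in> I" for i
      using \<L>_measurable[OF uL that] \<L>_measurable[OF f that] by simp
    have "Lp_sum I \<rho> p (\<lambda>i s. u i s - f i s) = Lp_sum I \<rho> p w"
      by (simp add: Lp_sum_def f_def)
    also have "\<dots> \<le> ennreal (real (card G) * ((B + B1) powr p * c))" by (rule w(2))
    also have "\<dots> \<le> ennreal (\<epsilon> powr p)"
      using cardG B B1 by (intro ennreal_leI bound) auto
    finally show "Lp_sum I \<rho> p (\<lambda>i s. u i s - f i s) \<le> ennreal (\<epsilon> powr p)" .
  qed
  moreover have "dst v (?T f) \<le> \<epsilon>"
  proof -
    define r where "r i s = (if i \<in> G2 then 0 else ?T u i s)" for i s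
    have "dst v (?T f) = N (\<lambda>i s. - r i s)"
    proof (rule N_cong_AE)
      fix i assume i: "i \<in> I"
      have "AE s in edge_measure. ?T (\<lambda>i s. u i s - - w i s) i s = ?T u i s - ?T (\<lambda>i s. - w i s) i s"
        by (rule AE_translate_diff[OF _ uL uminus_in_\<L>[OF w(1)] i]) simp
      then show "AE s in edge_measure. v i s - ?T f i s = - r i s"
        using AE_space
      proof eventually_elim
        case (elim s)
        then have s: "0 \<le> s" "s < 1" by auto
        have "?T (\<lambda>i s. - w i s) i s = - ?T w i s"
          by (simp add: translate_of_nat[OF i s] infsum_uminus)
        then have "?T f i s = ?T u i s + g i s"
          using elim(1) w(3)[OF i s] unfolding f_def by simp
        then show ?case by (simp add: g_def r_def)
      qed
    qed
    also have "\<dots> \<le> \<epsilon>"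
    proof (rule N_le_I(2)[OF _ \<epsilon>(1)])
      show "(\<lambda>s. - r i s) \<in> edge_borel" if i: "i \<in> I" for i
        using bounded_on_measurable[OF Tu i] unfolding r_def by simp
      have "Lp_sum I \<rho> p (\<lambda>i s. - r i s)
          = (\<Sum>k\<in>?a ` F. \<integral>\<^sup>+s. ennreal (norm (- r k s) powr p * \<rho> k s) \<partial>edge_measure)"
        using bounded_on_zero[OF Tu] by (intro Lp_sum_finite aF) (auto simp: r_def)
      also have "\<dots> \<le> (\<Sum>k\<in>?a ` F. ennreal (B1 powr p * c))"
      proof (rule sum_mono)
        fix k assume k: "k \<in> ?a ` F"
        then have kI: "k \<in> I" using aF by blast
        have "(\<integral>\<^sup>+s. ennreal (norm (- r k s) powr p * \<rho> k s) \<partial>edge_measure)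
            \<le> (\<integral>\<^sup>+s. ennreal (B1 powr p * c) \<partial>edge_measure)"
        proof (rule nn_integral_mono, rule ennreal_leI)
          fix s assume "s \<in> space edge_measure"
          then have s: "0 \<le> s" "s < 1" by auto
          show "norm (- r k s) powr p * \<rho> k s \<le> B1 powr p * c"
          proof (cases "k \<in> G2")
            case True
            then show ?thesis using c p_ge_1 by (simp add: r_def)
          next
            case False
            have "norm (r k s) \<le> B1"
              using bounded_on_norm_le[OF Tu kI s] False k by (simp add: r_def)
            then show ?thesis
              using light[of k s] \<rho>_pos[OF kI s] False k s p_ge_1
              by (intro mult_mono powr_mono2) auto
          qed
        qed
        then show "(\<integral>\<^sup>+s. ennreal (norm (- r k s) powr p * \<rho> k s) \<partial>edge_measure) \<le> ennreal (B1 powr p * c)"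
          by (simp add: emeasure_restrict_space)
      qed
      also have "\<dots> = ennreal (real (card (?a ` F)) * (B1 powr p * c))"
        using c by (simp add: ennreal_mult ennreal_of_nat_eq_real_of_nat)
      also have "\<dots> \<le> ennreal (\<epsilon> powr p)"
        using aF(3) B B1 by (intro ennreal_leI bound) auto
      finally show "Lp_sum I \<rho> p (\<lambda>i s. - r i s) \<le> ennreal (\<epsilon> powr p)" .
    qed
    finally show ?thesis .
  qed
  ultimately show ?thesis using f by blast
qed

definition cheap_returns :: bool where
  "cheap_returns \<longleftrightarrow> (\<forall>F c m. finite F \<and> F \<subseteq> I \<and> 0 < c \<longrightarrow> (\<exists>n\<ge>m. \<forall>i\<in>F. cheap n i c))"

lemma cheap_returns_uniform:
  assumes "cheap_returns" "finite F" "F \<subseteq> I" "0 < c"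
  shows "\<exists>n. \<forall>i\<in>F. uniformly_cheap n i c"
proof -
  obtain ch where ch: "\<And>i. i \<in> I \<Longrightarrow> ch i \<in> I \<and> par (ch i) = i"
    using child_exists by metis
  have "1 \<le> K 2" by (rule K_ge_1) simp
  then have "0 < c / K 2" using assms(4) by simp
  moreover have "finite (ch ` F)" "ch ` F \<subseteq> I" using assms(2,3) ch by auto
  ultimately obtain n where "\<forall>i\<in>ch ` F. cheap n i (c / K 2)"
    using assms(1) unfolding cheap_returns_def by blast
  then have "uniformly_cheap n i c" if "i \<in> F" for i
    using cheap_child_imp_uniformly_cheap[of "ch i" i c n] ch[of i] assms(3,4) that by auto
  then show ?thesis by blast
qed

lemma cheap_returns_imp_weakly_mixing:
  assumes cheap_returns
  shows "weakly_mixing (Lp_topology I \<rho> p :: ('i, 'k::{real_normed_field, euclidean_space}) edge_fun set topology)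
    (translation_semigroup I e \<rho> p)"
proof (rule weakly_mixing_I)
  fix u1 u2 v1 v2 :: "('i, 'k) edge_fun" and \<epsilon> :: real
  assume L: "u1 \<in> \<L>" "u2 \<in> \<L>" "v1 \<in> \<L>" "v2 \<in> \<L>" and \<epsilon>: "0 < \<epsilon>"
  define \<delta> where "\<delta> = \<epsilon> / 4"
  have \<delta>: "0 < \<delta>" "\<delta> + \<delta> < \<epsilon>" using \<epsilon> by (auto simp: \<delta>_def)
  obtain F1 B1 a1 where 1: "finite F1" "F1 \<subseteq> I" "0 \<le> B1" "bounded_on F1 B1 a1" "dst u1 a1 \<le> \<delta>"
    by (rule truncation_dense[OF L(1) \<delta>(1)])
  obtain F2 B2 a2 where 2: "finite F2" "F2 \<subseteq> I" "0 \<le> B2" "bounded_on F2 B2 a2" "dst u2 a2 \<le> \<delta>"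
    by (rule truncation_dense[OF L(2) \<delta>(1)])
  obtain F3 B3 b1 where 3: "finite F3" "F3 \<subseteq> I" "0 \<le> B3" "bounded_on F3 B3 b1" "dst v1 b1 \<le> \<delta>"
    by (rule truncation_dense[OF L(3) \<delta>(1)])
  obtain F4 B4 b2 where 4: "finite F4" "F4 \<subseteq> I" "0 \<le> B4" "bounded_on F4 B4 b2" "dst v2 b2 \<le> \<delta>"
    by (rule truncation_dense[OF L(4) \<delta>(1)])
  define F B where "F = F1 \<union> F2 \<union> F3 \<union> F4" and "B = B1 + B2 + B3 + B4"
  have F: "finite F" "F \<subseteq> I" and B: "0 \<le> B"
    using 1 2 3 4 by (auto simp: F_def B_def)
  have bnd: "bounded_on F B a1" "bounded_on F B a2" "bounded_on F B b1" "bounded_on F B b2"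
    using 1 2 3 4
    by (auto simp: F_def B_def intro: bounded_on_mono[OF 1(4)] bounded_on_mono[OF 2(4)]
        bounded_on_mono[OF 3(4)] bounded_on_mono[OF 4(4)])
  define C where "C = real (2 * card F) * (B + real (card F) * B) powr p + 1"
  have C: "0 < C" unfolding C_def by (intro add_nonneg_pos mult_nonneg_nonneg) auto
  define c where "c = \<delta> powr p / C"
  have c: "0 < c" using \<delta> C by (simp add: c_def)
  have small: "real (2 * card F) * ((B + real (card F) * B) powr p * c) \<le> \<delta> powr p"
  proof -
    have "real (2 * card F) * ((B + real (card F) * B) powr p * c) = (C - 1) * c"
      by (simp add: C_def)
    also have "\<dots> \<le> C * c" using c by (intro mult_right_mono) auto
    finally show ?thesis using C by (simp add: c_def)
  qed
  obtain n where n: "\<And>i. i \<in> F \<Longrightarrow> uniformly_cheap n i c"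
    using cheap_returns_uniform[OF assms F c] by blast
  obtain f1 where f1: "f1 \<in> \<L>" "dst a1 f1 \<le> \<delta>" "dst b1 (\<T> (real n) f1) \<le> \<delta>"
    using uniformly_cheap_connects[OF F B bnd(1,3) c n _ small] \<delta> by auto
  obtain f2 where f2: "f2 \<in> \<L>" "dst a2 f2 \<le> \<delta>" "dst b2 (\<T> (real n) f2) \<le> \<delta>"
    using uniformly_cheap_connects[OF F B bnd(2,4) c n _ small] \<delta> by auto
  have close: "dst x z < \<epsilon>"
    if "dst x y \<le> \<delta>" "dst y z \<le> \<delta>" "x \<in> \<L>" "y \<in> \<L>" "z \<in> \<L>"
    for x y z :: "('i, 'k) edge_fun"
    using N_triangle[OF that(3-5)] that(1,2) \<delta>(2) by simp
  have L': "a1 \<in> \<L>" "a2 \<in> \<L>" "b1 \<in> \<L>" "b2 \<in> \<L>"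
    using bounded_on_in_\<L>[OF _ F B] bnd by auto
  have T: "\<T> (real n) f1 \<in> \<L>" "\<T> (real n) f2 \<in> \<L>"
    by (rule translate_in_Lp_fun[OF of_nat_0_le_iff f1(1)], rule translate_in_Lp_fun[OF of_nat_0_le_iff f2(1)])
  show "\<exists>t\<ge>0. \<exists>f1\<in>\<L>. \<exists>f2\<in>\<L>.
      dst u1 f1 < \<epsilon> \<and> dst u2 f2 < \<epsilon> \<and>
      dst v1 (\<T> t f1) < \<epsilon> \<and> dst v2 (\<T> t f2) < \<epsilon>"
  proof (rule exI[of _ "real n"], intro conjI, simp, rule bexI[OF _ f1(1)], rule bexI[OF _ f2(1)], intro conjI)
    show "dst u1 f1 < \<epsilon>" by (rule close[OF 1(5) f1(2) L(1) L'(1) f1(1)])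
    show "dst u2 f2 < \<epsilon>" by (rule close[OF 2(5) f2(2) L(2) L'(2) f2(1)])
    show "dst v1 (\<T> (real n) f1) < \<epsilon>" by (rule close[OF 3(5) f1(3) L(3) L'(3) T(1)])
    show "dst v2 (\<T> (real n) f2) < \<epsilon>" by (rule close[OF 4(5) f2(3) L(4) L'(4) T(2)])
  qed
qed

end

section \<open>Necessity of the condition\<close>

context weighted_tree
begin

text \<open>
  The preimage carries the values of \<open>v\<close> on one chosen \<open>n\<close>-th descendant of every edge.
\<close>

lemma translate_has_preimage:
  fixes v :: "('i, 'k::{real_normed_field, euclidean_space}) edge_fun"
  assumes F: "finite F" "F \<subseteq> I" and B: "0 \<le> B" and v: "bounded_on F B v"
  obtains f where "f \<in> \<L>" "\<And>i s. i \<in> I \<Longrightarrow> 0 \<le> s \<Longrightarrow> s < 1 \<Longrightarrow> \<T> (real n) f i s = v i s"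
proof -
  obtain ch where ch: "\<And>i. i \<in> I \<Longrightarrow> ch i \<in> I \<and> par (ch i) = i"
    using child_exists by metis
  have chn: "(ch ^^ m) i \<in> I \<and> (par ^^ m) ((ch ^^ m) i) = i" if "i \<in> I" for i m
  proof (induction m)
    case (Suc m)
    have "(par ^^ Suc m) ((ch ^^ Suc m) i) = (par ^^ m) (par (ch ((ch ^^ m) i)))"
      by (simp add: funpow_swap1)
    then show ?case using ch Suc by simp
  qed (simp add: that)
  define f where "f j s = (if j \<in> (ch ^^ n) ` F then v ((par ^^ n) j) s else 0)" for j s
  have F': "finite ((ch ^^ n) ` F)" "(ch ^^ n) ` F \<subseteq> I"
    using F chn by auto
  have "bounded_on ((ch ^^ n) ` F) B f"
    unfolding bounded_on_def
  proof (intro ballI conjI)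
    fix j assume j: "j \<in> I"
    have a: "(par ^^ n) j \<in> I" by (rule funpow_par_in[OF j])
    show "f j \<in> edge_borel"
      using bounded_on_measurable[OF v a] unfolding f_def by simp
    fix s :: real assume "s \<in> {0..<1}"
    then show "norm (f j s) \<le> (if j \<in> (ch ^^ n) ` F then B else 0)"
      using bounded_on_norm_le[OF v a, of s] B by (auto simp: f_def split: if_splits)
  qed
  then have "f \<in> \<L>" by (rule bounded_on_in_\<L>[OF _ F' B])
  moreover have "\<T> (real n) f i s = v i s" if i: "i \<in> I" and s: "0 \<le> s" "s < 1" for i s
  proof (cases "i \<in> F")
    case True
    have "(\<Sum>\<^sub>\<infinity>j\<in>D n i. f j s) = (\<Sum>\<^sub>\<infinity>j\<in>{(ch ^^ n) i}. f j s)"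
    proof (rule infsum_cong_neutral)
      fix j assume "j \<in> D n i - {(ch ^^ n) i}"
      then have "j \<notin> (ch ^^ n) ` F"
        using i chn F by (auto simp: descendants_eq)
      then show "f j s = 0" by (simp add: f_def)
    qed (use chn[OF i] i in \<open>auto simp: descendants_eq\<close>)
    then show ?thesis
      using True chn[OF i, of n] by (simp add: translate_of_nat[OF i s] f_def)
  next
    case False
    have "f j s = 0" if "j \<in> D n i" for j
    proof -
      have "j \<notin> (ch ^^ n) ` F"
        using that i False chn F by (auto simp: descendants_eq)
      then show ?thesis by (simp add: f_def)
    qed
    then have "(\<Sum>\<^sub>\<infinity>j\<in>D n i. f j s) = 0" by (intro infsum_0)
    then show ?thesis
      using bounded_on_zero[OF v, of i s] i s False by (simp add: translate_of_nat[OF i s])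
  qed
  ultimately show ?thesis by (rule that)
qed

text \<open>
  Since the translation by \<open>n\<close> has dense range, it maps a dense orbit to a dense set; hence every
  tail of a dense orbit is dense.
\<close>

lemma dense_orbit_tail:
  fixes x y :: "('i, 'k::{real_normed_field, euclidean_space}) edge_fun"
  assumes x: "x \<in> \<L>" and dense: "\<forall>y\<in>\<L>. \<forall>\<epsilon>>0. \<exists>t\<ge>0. dst y (\<T> t x) < \<epsilon>"
    and y: "y \<in> \<L>" and \<epsilon>: "0 < \<epsilon>"
  shows "\<exists>t\<ge>real n. dst y (\<T> t x) < \<epsilon>"
proof -
  obtain F B v where F: "finite F" "F \<subseteq> I" and B: "0 \<le> B" and v: "bounded_on F B v"
    and yv: "dst y v \<le> \<epsilon> / 2"
    using truncation_dense[OF y, of "\<epsilon> / 2"] \<epsilon> by auto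
  have vL: "v \<in> \<L>" by (rule bounded_on_in_\<L>[OF v F B])
  obtain f where f: "f \<in> \<L>"
    "\<And>i s. i \<in> I \<Longrightarrow> 0 \<le> s \<Longrightarrow> s < 1 \<Longrightarrow> \<T> (real n) f i s = v i s"
    using translate_has_preimage[OF F B v, of n] by blast
  define k where "k = K (real n) powr (1 / p)"
  have k: "0 < k" using K_ge_1[of "real n"] by (simp add: k_def)
  have "0 < \<epsilon> / (2 * k)" using \<epsilon> k by simp
  then obtain t where t: "0 \<le> t" "dst f (\<T> t x) < \<epsilon> / (2 * k)"
    using dense f(1) by blast
  have Tx: "\<T> t x \<in> \<L>" "\<T> (real n + t) x \<in> \<L>"
    using translate_in_Lp_fun[OF _ x] t(1) by auto
  have "dst v (\<T> (real n + t) x)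
      = dst (\<T> (real n) f) (\<T> (real n) (\<T> t x))"
  proof (rule N_cong_AE)
    fix i assume i: "i \<in> I"
    show "AE s in edge_measure. v i s - \<T> (real n + t) x i s
        = \<T> (real n) f i s - \<T> (real n) (\<T> t x) i s"
      using AE_translate_translate[OF of_nat_0_le_iff t(1) x i, of n] AE_space
    proof eventually_elim
      case (elim s)
      then show ?case using f(2)[OF i, of s] by simp
    qed
  qed
  also have "\<dots> \<le> k * dst f (\<T> t x)"
    unfolding k_def by (rule N_translate_diff_le[OF _ f(1) Tx(1)]) simp
  also have "\<dots> < k * (\<epsilon> / (2 * k))"
    using t(2) k by (rule mult_strict_left_mono)
  also have "\<dots> = \<epsilon> / 2" using k by simp
  finally have "dst y (\<T> (real n + t) x) < \<epsilon>"
    using N_triangle[OF y vL Tx(2)] yv by simp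
  then show ?thesis using t(1) by (intro exI[of _ "real n + t"]) simp
qed

text \<open>
  Two points of the orbit near \<open>y\<close>, the second one late enough.
\<close>

lemma dense_orbit_returns:
  fixes x y :: "('i, 'k::{real_normed_field, euclidean_space}) edge_fun"
  assumes x: "x \<in> \<L>" and dense: "\<forall>y\<in>\<L>. \<forall>\<epsilon>>0. \<exists>t\<ge>0. dst y (\<T> t x) < \<epsilon>"
    and y: "y \<in> \<L>" and \<epsilon>: "0 < \<epsilon>"
  shows "\<exists>t\<ge>real n. \<exists>f\<in>\<L>. dst y f < \<epsilon> \<and> dst y (\<T> t f) < \<epsilon>"
proof -
  obtain t1 where t1: "0 \<le> t1" "dst y (\<T> t1 x) < \<epsilon>"
    using dense y \<epsilon> by blast
  obtain m :: nat where m: "t1 + real n \<le> real m"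
    using real_arch_simple by blast
  obtain t2 where t2: "real m \<le> t2" "dst y (\<T> t2 x) < \<epsilon>"
    using dense_orbit_tail[OF x dense y \<epsilon>, of m] by blast
  have t: "0 \<le> t2 - t1" "real n \<le> t2 - t1" using t1 m t2 by auto
  have "dst y (\<T> (t2 - t1) (\<T> t1 x))
      = dst y (\<T> t2 x)"
  proof (rule N_cong_AE)
    fix i assume "i \<in> I"
    from AE_translate_translate[OF t(1) t1(1) x this]
    show "AE s in edge_measure. y i s - \<T> (t2 - t1) (\<T> t1 x) i s
        = y i s - \<T> t2 x i s"
      by eventually_elim simp
  qed
  then show ?thesis
    using t(2) t1 t2 translate_in_Lp_fun[OF t1(1) x]
    by (intro exI[of _ "t2 - t1"] conjI bexI[of _ "\<T> t1 x"]) auto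
qed

text \<open>
  If \<open>\<phi>\<close> and its translate differ by at least \<open>1\<close> on a set \<open>A\<close>, and a small perturbation \<open>f\<close> of
  \<open>\<phi>\<close> has a translate close to \<open>\<phi>\<close>, then the perturbation accounts for this difference; when the
  cost on the descendants is bounded below, this is impossible for very small perturbations.
\<close>

lemma return_obstruction:
  fixes \<phi> f :: "('i, 'k::{real_normed_field, euclidean_space}) edge_fun"
  assumes l: "l \<in> I" and t: "0 \<le> t" and \<phi>: "\<phi> \<in> \<L>" and f: "f \<in> \<L>" and c: "0 < c" and \<delta>: "0 \<le> \<delta>"
    and A: "\<And>s. s \<in> A \<Longrightarrow> 0 \<le> s \<and> s < 1 \<and> steps t s = n"
    and cost: "\<And>r. 0 \<le> r \<Longrightarrow> r < 1 \<Longrightarrow> cost_ge n l r c"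
    and \<sigma>: "\<And>s. s \<in> A \<Longrightarrow> 0 \<le> \<sigma> s \<and> \<sigma> s \<le> 1 \<and> \<sigma> s \<le> \<rho> l s"
    and diff: "\<And>s. s \<in> A \<Longrightarrow> 1 \<le> norm (\<T> t \<phi> l s - \<phi> l s)"
    and close: "dst \<phi> f \<le> \<delta>" "dst \<phi> (\<T> t f) \<le> \<delta>"
  shows "(\<integral>\<^sup>+s. ennreal (\<sigma> s) * indicator A s \<partial>edge_measure) \<le> ennreal (2 powr p * (1 + 1 / c) * \<delta> powr p)"
proof -
  let ?d = "\<lambda>i s. \<phi> i s - f i s" and ?y = "\<lambda>i s. \<phi> i s - \<T> t f i s"
  let ?h = "\<lambda>j s. ennreal (norm (?d j s) powr p * \<rho> j s)"
  let ?H = "\<lambda>s. \<Sum>\<^sub>\<infinity>j\<in>D (steps t s) l. ?h j (pos t s)"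
  have Tf: "\<T> t f \<in> \<L>" by (rule translate_in_Lp_fun[OF t f])
  have d: "?d \<in> \<L>" by (rule diff_in_\<L>[OF \<phi> f])
  have y: "?y \<in> \<L>" by (rule diff_in_\<L>[OF \<phi> Tf])
  have hm: "?h j \<in> edge_borel" if "j \<in> I" for j
    by (rule powr_measurable[of ?d j, OF \<L>_measurable[OF d that] that])
  have Hm[measurable]: "?H \<in> edge_borel"
    by (rule infsum_integral_translate(1)[OF t hm l])
  have [measurable]: "(\<lambda>s. ennreal (norm (?y l s) powr p * \<rho> l s)) \<in> edge_borel"
    by (rule powr_measurable[of ?y l, OF \<L>_measurable[OF y l] l])
  have N_le: "Lp_sum I \<rho> p u \<le> ennreal (\<delta> powr p)" if "u \<in> \<L>" "N u \<le> \<delta>" for u :: "('i, 'k) edge_fun"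
    using that p_ge_1 N_nonneg[of u] by (simp add: Lp_sum_eq_N ennreal_leI powr_mono2)
  have "(\<integral>\<^sup>+s. ?H s \<partial>edge_measure)
      \<le> (\<Sum>\<^sub>\<infinity>l\<in>I. \<integral>\<^sup>+s. (\<Sum>\<^sub>\<infinity>j\<in>D (steps t s) l. ?h j (pos t s)) \<partial>edge_measure)"
    by (rule le_infsum_ennreal[OF l])
  also have "\<dots> = (\<Sum>\<^sub>\<infinity>j\<in>I. \<integral>\<^sup>+s. ?h j s \<partial>edge_measure)"
    by (rule infsum_integral_translate(2)[OF t hm])
  also have "\<dots> \<le> ennreal (\<delta> powr p)"
    using N_le[OF d close(1)] by (simp add: Lp_sum_def)
  finally have int_H: "(\<integral>\<^sup>+s. ?H s \<partial>edge_measure) \<le> ennreal (\<delta> powr p)" .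
  have "(\<integral>\<^sup>+s. ennreal (norm (?y l s) powr p * \<rho> l s) \<partial>edge_measure) \<le> Lp_sum I \<rho> p ?y"
    unfolding Lp_sum_def by (rule le_infsum_ennreal[OF l])
  also have "\<dots> \<le> ennreal (\<delta> powr p)" by (rule N_le[OF y close(2)])
  finally have int_y: "(\<integral>\<^sup>+s. ennreal (norm (?y l s) powr p * \<rho> l s) \<partial>edge_measure) \<le> ennreal (\<delta> powr p)" .
  have "(\<integral>\<^sup>+s. ennreal (\<sigma> s) * indicator A s \<partial>edge_measure)
      \<le> (\<integral>\<^sup>+s. ennreal (2 powr p) * (ennreal (norm (?y l s) powr p * \<rho> l s) + ennreal (1 / c) * ?H s) \<partial>edge_measure)"
  proof (rule nn_integral_mono_AE)
    show "AE s in edge_measure. ennreal (\<sigma> s) * indicator A s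
        \<le> ennreal (2 powr p) * (ennreal (norm (?y l s) powr p * \<rho> l s) + ennreal (1 / c) * ?H s)"
      using AE_translate_diff[OF t \<phi> f l]
    proof eventually_elim
      case (elim s)
      show ?case
      proof (cases "s \<in> A")
        case True
        note s = A[OF True] and \<sigma> = \<sigma>[OF True]
        let ?X = "norm (\<T> t ?d l s)" and ?Y = "norm (?y l s)"
        have s': "0 \<le> s" "s < 1" using s by auto
        have \<rho>0: "0 \<le> \<rho> l s" using \<sigma> by linarith
        note pos = pos_in[OF t s']
        have "1 \<le> norm ((\<T> t \<phi> l s - \<T> t f l s) - (\<phi> l s - \<T> t f l s))"
          using diff[OF True] by simp
        also have "\<dots> \<le> ?X + ?Y"
          unfolding elim by (rule norm_triangle_ineq4)
        finally have "1 powr p \<le> (?X + ?Y) powr p"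
          using p_ge_1 by (intro powr_mono2) auto
        also have "\<dots> \<le> 2 powr p * (?X powr p + ?Y powr p)"
          using p_ge_1 by (intro powr_add_le) auto
        finally have "\<sigma> s * 1 \<le> \<sigma> s * (2 powr p * (?X powr p + ?Y powr p))"
          using \<sigma> by (intro mult_left_mono) auto
        also have "\<dots> = 2 powr p * (?Y powr p * \<sigma> s + ?X powr p * \<sigma> s)"
          by (simp add: algebra_simps)
        also have "\<dots> \<le> 2 powr p * (?Y powr p * \<rho> l s + ?X powr p * 1)"
          using \<sigma> by (intro mult_left_mono add_mono) auto
        finally have "ennreal (\<sigma> s) \<le> ennreal (2 powr p * (?Y powr p * \<rho> l s + ?X powr p))"
          by (intro ennreal_leI) simp
        also have "\<dots> = ennreal (2 powr p) * (ennreal (?Y powr p * \<rho> l s) + ennreal (?X powr p))"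
          using \<rho>0 by (simp flip: ennreal_mult ennreal_plus)
        also have "\<dots> \<le> ennreal (2 powr p) * (ennreal (?Y powr p * \<rho> l s) + ennreal (1 / c) * ?H s)"
        proof (intro mult_left_mono add_mono order_refl zero_le)
          have "cost_ge (steps t s) l (pos t s) c"
            using cost[OF pos] s by simp
          then have "ennreal (c * ?X powr p) \<le> ?H s"
            unfolding translate_eq[OF l]
            by (rule mass_cost_ge_norm_infsum_le(1)[OF p_ge_1 c])
              (rule \<rho>_pos[OF subsetD[OF descendants_subset] pos])
          then have "ennreal (1 / c) * ennreal (c * ?X powr p) \<le> ennreal (1 / c) * ?H s"
            by (rule mult_left_mono) simp
          then show "ennreal (?X powr p) \<le> ennreal (1 / c) * ?H s"
            using c by (simp flip: ennreal_mult)
        qed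
        finally show ?thesis using True by simp
      qed simp
    qed
  qed
  also have "\<dots> = ennreal (2 powr p) * ((\<integral>\<^sup>+s. ennreal (norm (?y l s) powr p * \<rho> l s) \<partial>edge_measure)
      + ennreal (1 / c) * (\<integral>\<^sup>+s. ?H s \<partial>edge_measure))"
    by (subst nn_integral_cmult, measurable, subst nn_integral_add, measurable)
      (subst nn_integral_cmult, rule Hm, rule refl)
  also have "\<dots> \<le> ennreal (2 powr p) * (ennreal (\<delta> powr p) + ennreal (1 / c) * ennreal (\<delta> powr p))"
    by (intro mult_left_mono add_mono int_y int_H zero_le)
  also have "\<dots> = ennreal (2 powr p * (1 + 1 / c) * \<delta> powr p)"
    using c by (simp add: algebra_simps flip: ennreal_mult ennreal_plus)
  finally show ?thesis .
qed

lemma half_edge_integral_pos: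
  fixes \<sigma> :: "real \<Rightarrow> real"
  assumes \<sigma>: "\<sigma> \<in> edge_borel" "\<And>s. 0 \<le> s \<Longrightarrow> s < 1 \<Longrightarrow> 0 < \<sigma> s"
    and A: "A = {0..<1/2} \<or> A = {1/2..<1}"
  shows "0 < (\<integral>\<^sup>+s. ennreal (\<sigma> s) * indicator A s \<partial>edge_measure)"
proof (rule ccontr)
  have A': "A \<in> sets edge_measure" "emeasure edge_measure A = ennreal (1 / 2)"
    using A by (auto simp: sets_restrict_space_iff emeasure_restrict_space)
  assume "\<not> ?thesis"
  then have "(\<integral>\<^sup>+s. ennreal (\<sigma> s) * indicator A s \<partial>edge_measure) = 0" by simp
  then have "AE s in edge_measure. ennreal (\<sigma> s) * indicator A s = 0"
    using \<sigma>(1) A' by (subst (asm) nn_integral_0_iff_AE) auto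
  then have "AE s in edge_measure. indicator A s = (0::ennreal)"
    using AE_space
  proof eventually_elim
    case (elim s)
    then show ?case using \<sigma>(2)[of s] by (auto simp: ennreal_eq_0_iff indicator_def split: if_splits)
  qed
  then have "(\<integral>\<^sup>+s. indicator A s \<partial>edge_measure) = (\<integral>\<^sup>+s. 0 \<partial>edge_measure)"
    by (rule nn_integral_cong_AE)
  then show False using A' by simp
qed

text \<open>
  Apply the obstruction to the indicator \<open>\<phi>\<close> of finitely many edges. For large \<open>n\<close> the descendants
  of an edge \<open>i\<close> of the support are off the support, so \<open>\<phi>\<close> is \<open>1\<close> on \<open>i\<close> and its translate is \<open>0\<close>;
  the ancestor of \<open>i\<close> is off the support, so there \<open>\<phi>\<close> is \<open>0\<close> and its translate counts edges.
  The number of generations crossed at time \<open>t\<close> is constant on one of the two halves of the edges.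
\<close>

lemma dense_orbit_imp_cheap_returns:
  fixes x :: "('i, 'k::{real_normed_field, euclidean_space}) edge_fun"
  assumes x: "x \<in> \<L>" and dense: "\<forall>y\<in>\<L>. \<forall>\<epsilon>>0. \<exists>t\<ge>0. dst y (\<T> t x) < \<epsilon>"
  shows cheap_returns
  unfolding cheap_returns_def
proof (intro allI impI, elim conjE)
  fix F c m assume F: "finite F" "F \<subseteq> I" and c: "0 < (c::real)"
  obtain m1 where m1: "\<forall>n\<ge>m1. \<forall>i\<in>F. \<forall>j\<in>F. (par ^^ n) j \<noteq> i"
    using finite_generations_bounded[OF F] by blast
  define \<phi> :: "('i, 'k) edge_fun" where "\<phi> i s = (if i \<in> F then 1 else 0)" for i s
  have "bounded_on F 1 \<phi>"
    unfolding bounded_on_def \<phi>_def by auto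
  then have \<phi>: "\<phi> \<in> \<L>" by (rule bounded_on_in_\<L>[OF _ F]) simp
  define P where "P = insert (\<lambda>s. min 1 c) ((\<lambda>i s. min 1 (\<rho> i s)) ` F)"
  define V where "V = (\<lambda>(\<sigma>, A). \<integral>\<^sup>+s. ennreal (\<sigma> s) * indicator A s \<partial>edge_measure) `
      (P \<times> {{0..<1/2}, {1/2..<1::real}})"
  have P: "\<sigma> \<in> edge_borel \<and> (\<forall>s. 0 \<le> s \<longrightarrow> s < 1 \<longrightarrow> 0 < \<sigma> s)" if \<sigma>: "\<sigma> \<in> P" for \<sigma>
  proof -
    have "(\<lambda>s. min 1 (\<rho> i s)) \<in> edge_borel" if "i \<in> F" for i
    proof -
      have [measurable]: "\<rho> i \<in> edge_borel" using F that by (intro \<rho>_measurable) blast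
      show ?thesis by measurable
    qed
    then show ?thesis using \<sigma> c F \<rho>_pos by (auto simp: P_def)
  qed
  have V: "finite V" "V \<noteq> {}" "\<And>v. v \<in> V \<Longrightarrow> 0 < v"
    using F(1) P by (auto simp: V_def P_def intro!: half_edge_integral_pos)
  then have "0 < Min V" by simp
  then obtain \<kappa>' where "0 < \<kappa>'" "\<kappa>' < Min V" using dense_order_class.dense by blast
  then obtain \<kappa> where \<kappa>: "0 < \<kappa>" "ennreal \<kappa> < Min V"
    by (cases \<kappa>') auto
  define b where "b = 2 powr p * (1 + 1 / c)"
  have b: "0 < b" unfolding b_def using c by (intro mult_pos_pos add_pos_pos) auto
  define \<delta> where "\<delta> = (\<kappa> / b) powr (1 / p)"
  have \<delta>: "0 < \<delta>" "b * \<delta> powr p = \<kappa>"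
    using \<kappa> b p_ge_1 by (auto simp: \<delta>_def powr_powr)
  obtain t f where t: "real (m + m1) \<le> t" and f: "f \<in> \<L>"
    and close: "dst \<phi> f < \<delta>" "dst \<phi> (\<T> t f) < \<delta>"
    using dense_orbit_returns[OF x dense \<phi> \<delta>(1), of "m + m1"] by blast
  have t0: "0 \<le> t" using t by simp
  define A where "A = (if frac t \<le> 1/2 then {0..<1/2} else {1/2..<1::real})"
  define n where "n = (if frac t \<le> 1/2 then nat \<lfloor>t\<rfloor> else Suc (nat \<lfloor>t\<rfloor>))"
  have steps: "0 \<le> s \<and> s < 1 \<and> steps t s = n" if "s \<in> A" for s
    using that steps_pos_eq(1)[OF t0, of s] by (auto simp: A_def n_def split: if_splits)
  have "m + m1 \<le> nat \<lfloor>t\<rfloor>" using t by (simp add: le_nat_floor)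
  then have n: "m \<le> n" "m1 \<le> n" by (auto simp: n_def)
  have obstruction: False
    if l: "l \<in> I" and cost: "\<And>r. 0 \<le> r \<Longrightarrow> r < 1 \<Longrightarrow> cost_ge n l r c" and \<sigma>: "\<sigma> \<in> P"
      and \<sigma>_le: "\<And>s. s \<in> A \<Longrightarrow> \<sigma> s \<le> 1 \<and> \<sigma> s \<le> \<rho> l s"
      and diff: "\<And>s. s \<in> A \<Longrightarrow> 1 \<le> norm (\<T> t \<phi> l s - \<phi> l s)" for l \<sigma>
  proof -
    have "(\<integral>\<^sup>+s. ennreal (\<sigma> s) * indicator A s \<partial>edge_measure) \<le> ennreal (b * \<delta> powr p)"
      unfolding b_def
      by (rule return_obstruction[OF l t0 \<phi> f c _ steps cost _ diff])
        (use \<delta> close P[OF \<sigma>] \<sigma>_le steps in \<open>auto simp: less_imp_le\<close>)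
    moreover have "(\<integral>\<^sup>+s. ennreal (\<sigma> s) * indicator A s \<partial>edge_measure) \<in> V"
      unfolding V_def using \<sigma> by (auto simp: A_def image_iff intro!: bexI[of _ \<sigma>])
    ultimately have "Min V \<le> ennreal \<kappa>"
      using V(1) \<delta>(2) by (auto intro: order_trans[OF Min_le])
    then show False using \<kappa>(2) by simp
  qed
  have T\<phi>: "\<T> t \<phi> l s = of_nat (card (D n l \<inter> F))" if "l \<in> I" "s \<in> A" for l s
  proof -
    have "(\<Sum>\<^sub>\<infinity>j\<in>D n l. \<phi> j (pos t s)) = (\<Sum>\<^sub>\<infinity>j\<in>D n l \<inter> F. 1)"
      by (rule infsum_cong_neutral) (auto simp: \<phi>_def)
    also have "\<dots> = of_nat (card (D n l \<inter> F))" using F(1) by simp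
    finally show ?thesis using steps[OF that(2)] by (simp only: translate_eq[OF that(1)])
  qed
  have "cheap n i c" if i: "i \<in> F" for i
  proof (rule ccontr)
    assume not_cheap: "\<not> cheap n i c"
    have iI: "i \<in> I" using i F by blast
    let ?k = "(par ^^ n) i"
    have k: "?k \<in> I" by (rule funpow_par_in[OF iI])
    consider "\<forall>s\<in>{0..<1}. cost_ge n i s c" | "\<forall>s\<in>{0..<1}. c \<le> \<rho> ?k s \<and> cost_ge n ?k s c"
      using not_cheap unfolding cheap_def by force
    then show False
    proof cases
      case 1
      have "D n i \<inter> F = {}"
        using m1 n(2) i iI by (auto simp: descendants_eq)
      then have "\<T> t \<phi> i s - \<phi> i s = - 1" if "s \<in> A" for s
        using T\<phi>[OF iI that] i by (simp add: \<phi>_def)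
      then show False
        using 1 i by (intro obstruction[OF iI, of "\<lambda>s. min 1 (\<rho> i s)"]) (auto simp: P_def)
    next
      case 2
      have "i \<in> D n ?k \<inter> F" using i iI k by (simp add: descendants_eq)
      then have "0 < card (D n ?k \<inter> F)" using F(1) by (auto simp: card_gt_0_iff)
      then have "1 \<le> real (card (D n ?k \<inter> F))" by simp
      moreover have "?k \<notin> F" using m1 n(2) i by blast
      ultimately have "1 \<le> norm (\<T> t \<phi> ?k s - \<phi> ?k s)" if "s \<in> A" for s
        using T\<phi>[OF k that] by (simp add: \<phi>_def)
      moreover have "min 1 c \<le> \<rho> ?k s" if "s \<in> A" for s
        using 2 steps[OF that] by (auto simp: min_le_iff_disj)
      ultimately show False
        using 2 by (intro obstruction[OF k, of "\<lambda>s. min 1 c"]) (auto simp: P_def)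
    qed
  qed
  then show "\<exists>n\<ge>m. \<forall>i\<in>F. cheap n i c" using n(1) by blast
qed

lemma
  fixes X :: "('i, 'k::{real_normed_field, euclidean_space}) edge_fun set topology"
  defines "X \<equiv> Lp_topology I \<rho> p" and "T \<equiv> translation_semigroup I e \<rho> p"
  shows hypercyclic_iff_cheap_returns: "hypercyclic X T \<longleftrightarrow> cheap_returns"
    and weakly_mixing_iff_cheap_returns: "weakly_mixing X T \<longleftrightarrow> cheap_returns"
proof -
  have "cheap_returns" if "hypercyclic X T"
    using that dense_orbit_imp_cheap_returns unfolding X_def T_def hypercyclic_iff by blast
  moreover have "weakly_mixing X T" if cheap_returns
    unfolding X_def T_def by (rule cheap_returns_imp_weakly_mixing[OF that])
  moreover have "hypercyclic X T" if "weakly_mixing X T"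
    using that unfolding X_def T_def
    by (intro transitive_imp_hypercyclic weakly_mixing_imp_transitive)
  ultimately show "hypercyclic X T \<longleftrightarrow> cheap_returns" and "weakly_mixing X T \<longleftrightarrow> cheap_returns"
    by blast+
qed

section \<open>The condition in terms of a sequence\<close>

lemma cheap_mono:
  assumes i: "i \<in> I" and "0 < c" "c \<le> c'" "cheap n i c"
  shows "cheap n i c'"
  using assms(4) mass_cost_ge_mono[OF p_ge_1 assms(2,3)] assms(3) unfolding cheap_def
  by (meson less_le_trans)

text \<open>
  A diagonal choice: the \<open>h\<close>-th member of the sequence serves the first \<open>h\<close> edges of an enumeration
  with \<open>c = 1 / (h + 1)\<close>.
\<close>

lemma cheap_returns_iff_sequence:
  "cheap_returns \<longleftrightarrow>
    (\<exists>n::nat \<Rightarrow> nat. strict_mono n \<and> (\<forall>i\<in>I. \<forall>c>0. \<forall>\<^sub>F h in sequentially. cheap (n h) i c))" (is "_ \<longleftrightarrow> ?R")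
proof
  assume cheap_returns
  define F where "F h = {i \<in> I. to_nat_on I i < h}" for h
  have F: "finite (F h)" "F h \<subseteq> I" for h
    using finite_initial_edges by (auto simp: F_def)
  have ex: "\<exists>n\<ge>m. \<forall>i\<in>F h. cheap n i (1 / (real h + 1))" for m h
    using \<open>cheap_returns\<close> F unfolding cheap_returns_def by simp
  have "\<exists>n. \<forall>h. (\<forall>i\<in>F h. cheap (n h) i (1 / (real h + 1))) \<and> n h < n (Suc h)"
  proof (rule dependent_nat_choice)
    show "\<exists>x. \<forall>i\<in>F 0. cheap x i (1 / (real 0 + 1))" using ex[of 0 0] by auto
    show "\<exists>y. (\<forall>i\<in>F (Suc h). cheap y i (1 / (real (Suc h) + 1))) \<and> x < y" for x h
      using ex[of "Suc x" "Suc h"] by (auto simp: Suc_le_eq)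
  qed
  then obtain n where n: "\<And>h i. i \<in> F h \<Longrightarrow> cheap (n h) i (1 / (real h + 1))" "\<And>h. n h < n (Suc h)"
    by blast
  have "\<forall>\<^sub>F h in sequentially. cheap (n h) i c" if i: "i \<in> I" and c: "0 < c" for i c
  proof -
    obtain h0 :: nat where h0: "1 / c \<le> real h0" using real_arch_simple by blast
    show ?thesis
      unfolding eventually_sequentially
    proof (intro exI[of _ "max h0 (Suc (to_nat_on I i))"] allI impI)
      fix h assume h: "max h0 (Suc (to_nat_on I i)) \<le> h"
      have "1 / c \<le> real h + 1" using h h0 by simp
      then have "1 / (real h + 1) \<le> c"
        using c by (simp add: field_simps)
      then show "cheap (n h) i c"
        using h i n(1)[of i h] by (intro cheap_mono[OF i _ _ n(1)]) (auto simp: F_def)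
    qed
  qed
  moreover have "strict_mono n" using n(2) by (simp add: strict_mono_Suc_iff)
  ultimately show ?R by blast
next
  assume ?R
  then obtain n :: "nat \<Rightarrow> nat" where n: "strict_mono n"
    "\<And>i c. i \<in> I \<Longrightarrow> 0 < c \<Longrightarrow> \<forall>\<^sub>F h in sequentially. cheap (n h) i c" by blast
  show cheap_returns
    unfolding cheap_returns_def
  proof (intro allI impI, elim conjE)
    fix F c m assume F: "finite F" "F \<subseteq> I" and c: "0 < (c::real)"
    have "\<forall>\<^sub>F h in sequentially. \<forall>i\<in>F. cheap (n h) i c"
      using F n(2) c by (intro eventually_ball_finite) auto
    moreover have "\<forall>\<^sub>F h in sequentially. m \<le> h" by (rule eventually_ge_at_top)
    ultimately have "\<forall>\<^sub>F h in sequentially. m \<le> h \<and> (\<forall>i\<in>F. cheap (n h) i c)"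
      by eventually_elim simp
    then obtain h where "m \<le> h" "\<forall>i\<in>F. cheap (n h) i c"
      by (auto simp: eventually_sequentially)
    moreover have "h \<le> n h" by (rule strict_mono_imp_increasing[OF n(1)])
    ultimately show "\<exists>n\<ge>m. \<forall>i\<in>F. cheap n i c" by (meson order_trans)
  qed
qed

lemma tendsto_0_iff_ennreal:
  fixes u :: "nat \<Rightarrow> ennreal"
  shows "u \<longlonglongrightarrow> 0 \<longleftrightarrow> (\<forall>c>0. \<forall>\<^sub>F h in sequentially. u h < ennreal c)"
proof
  assume "u \<longlonglongrightarrow> 0"
  then show "\<forall>c>0. \<forall>\<^sub>F h in sequentially. u h < ennreal c"
    by (auto intro: order_tendstoD)
next
  assume *: "\<forall>c>0. \<forall>\<^sub>F h in sequentially. u h < ennreal c"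
  show "u \<longlonglongrightarrow> 0"
  proof (rule order_tendstoI)
    fix a :: ennreal assume "0 < a"
    then obtain a' where "0 < a'" "a' < a" using dense_order_class.dense by blast
    then obtain c where c: "0 < c" "ennreal c < a" by (cases a') auto
    from * c(1) have "\<forall>\<^sub>F h in sequentially. u h < ennreal c" by blast
    then show "\<forall>\<^sub>F h in sequentially. u h < a"
      by eventually_elim (use c(2) in \<open>auto intro: less_trans\<close>)
  qed simp
qed

lemma tendsto_top_iff_powr:
  fixes u :: "nat \<Rightarrow> ennreal"
  assumes "0 < q"
  shows "u \<longlonglongrightarrow> \<infinity> \<longleftrightarrow> (\<forall>c>0. \<forall>\<^sub>F h in sequentially. ennreal (c powr - q) < u h)"
proof -
  have "u \<longlonglongrightarrow> \<infinity> \<longleftrightarrow> (\<forall>l\<ge>0. \<forall>\<^sub>F h in sequentially. ennreal l < u h)"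
    using tendsto_top_iff_ennreal[of u sequentially] by simp
  also have "\<dots> \<longleftrightarrow> (\<forall>c>0. \<forall>\<^sub>F h in sequentially. ennreal (c powr - q) < u h)"
  proof
    assume *: "\<forall>c>0. \<forall>\<^sub>F h in sequentially. ennreal (c powr - q) < u h"
    show "\<forall>l\<ge>0. \<forall>\<^sub>F h in sequentially. ennreal l < u h"
    proof (intro allI impI)
      fix l :: real assume l: "0 \<le> l"
      have "((l + 1) powr (- 1 / q)) powr - q = l + 1"
        using l assms by (simp add: powr_powr)
      moreover have "\<forall>\<^sub>F h in sequentially. ennreal (((l + 1) powr (- 1 / q)) powr - q) < u h"
        using * l by simp
      ultimately have "\<forall>\<^sub>F h in sequentially. ennreal (l + 1) < u h" by (simp only:)
      moreover have "ennreal l \<le> ennreal (l + 1)" by (rule ennreal_leI) simp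
      ultimately show "\<forall>\<^sub>F h in sequentially. ennreal l < u h"
        by (auto elim!: eventually_mono intro: le_less_trans)
    qed
  qed simp
  finally show ?thesis .
qed


lemma cheap_sequence_iff_1:
  assumes p: "p = 1" and i: "i \<in> I"
  shows "(\<forall>c>0. \<forall>\<^sub>F h in sequentially. cheap (n h) i c) \<longleftrightarrow>
    (\<lambda>h. INF s\<in>{0..<1}. INF j\<in>D (n h) i. ennreal (\<rho> j s)) \<longlonglongrightarrow> 0 \<and>
    (\<lambda>h. INF s\<in>{0..<1}. min (ennreal (\<rho> (ancestor I e (n h) i) s))
        (INF j\<in>D (n h) (ancestor I e (n h) i). ennreal (\<rho> j s))) \<longlonglongrightarrow> 0"
proof -
  have less: "ennreal (\<rho> j s) < ennreal c \<longleftrightarrow> \<rho> j s < c" if "j \<in> I" "s \<in> {0..<1}" for j s c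
    using \<rho>_pos[OF that(1), of s] that(2) by (simp add: ennreal_less_iff less_imp_le)
  have INF_less: "(INF j\<in>D m k. ennreal (\<rho> j s)) < ennreal c \<longleftrightarrow> \<not> cost_ge m k s c" if "s \<in> {0..<1}" for m k s c
    using less that descendants_subset p by (fastforce simp: INF_less_iff mass_cost_ge_def not_le)
  have "cheap m i c \<longleftrightarrow> (INF s\<in>{0..<1}. INF j\<in>D m i. ennreal (\<rho> j s)) < ennreal c \<and>
      (INF s\<in>{0..<1}. min (ennreal (\<rho> (ancestor I e m i) s))
        (INF j\<in>D m (ancestor I e m i). ennreal (\<rho> j s))) < ennreal c" for m c
    unfolding cheap_def ancestor_eq[OF i] INF_less_iff[of _ "{0..<1::real}"] min_less_iff_disj
    by (simp add: INF_less less funpow_par_in[OF i])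
  then show ?thesis
    by (auto simp: tendsto_0_iff_ennreal eventually_conj_iff)
qed

lemma cheap_sequence_iff:
  assumes p: "1 < p" and i: "i \<in> I"
  shows "(\<forall>c>0. \<forall>\<^sub>F h in sequentially. cheap (n h) i c) \<longleftrightarrow>
    (\<lambda>h. SUP s\<in>{0..<1}. \<Sum>\<^sub>\<infinity>j\<in>D (n h) i. ennreal (1 / \<rho> j s powr (1 / (p - 1)))) \<longlonglongrightarrow> \<infinity> \<and>
    (\<lambda>h. SUP s\<in>{0..<1}. ennreal (1 / \<rho> (ancestor I e (n h) i) s powr (1 / (p - 1))) +
        (\<Sum>\<^sub>\<infinity>j\<in>D (n h) (ancestor I e (n h) i). ennreal (1 / \<rho> j s powr (1 / (p - 1))))) \<longlonglongrightarrow> \<infinity>"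
proof -
  define q where "q = 1 / (p - 1)"
  have q: "0 < q" using p by (simp add: q_def)
  let ?w = "\<lambda>j s. ennreal (1 / \<rho> j s powr q)"
  let ?S = "\<lambda>m k s. \<Sum>\<^sub>\<infinity>j\<in>D m k. ?w j s"
  let ?a = "\<lambda>m. (par ^^ m) i"
  have S_less: "ennreal (c powr - q) < ?S m k s \<longleftrightarrow> \<not> cost_ge m k s c" for m k s c
    using p by (simp add: mass_cost_ge_def q_def powr_minus_divide not_le)
  have w_less: "ennreal (c powr - q) < ?w k s \<longleftrightarrow> \<rho> k s < c" if "k \<in> I" "s \<in> {0..<1}" "0 < c" for k s c
  proof -
    have \<rho>: "0 < \<rho> k s" using \<rho>_pos that by simp
    have "c powr - q < \<rho> k s powr - q \<longleftrightarrow> \<rho> k s < c"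
    proof
      assume less: "c powr - q < \<rho> k s powr - q"
      show "\<rho> k s < c"
      proof (rule ccontr)
        assume "\<not> \<rho> k s < c"
        then have "\<rho> k s powr - q \<le> c powr - q"
          using that(3) q by (intro powr_mono2') auto
        with less show False by simp
      qed
    next
      assume "\<rho> k s < c"
      then show "c powr - q < \<rho> k s powr - q"
        using \<rho> q by (intro powr_less_mono2_neg) auto
    qed
    then show ?thesis
      by (simp add: ennreal_less_iff flip: powr_minus_divide)
  qed
  have 1: "(\<exists>s\<in>{0..<1}. \<not> cost_ge m i s c) \<longleftrightarrow> ennreal (c powr - q) < (SUP s\<in>{0..<1}. ?S m i s)" for m c
    by (simp only: less_SUP_iff S_less)
  \<comment> \<open>The larger of two summands is at least half of their sum.\<close>
  have 2: "(\<forall>c>0. \<forall>\<^sub>F h in sequentially. \<exists>s\<in>{0..<1}. \<rho> (?a (n h)) s < c \<or> \<not> cost_ge (n h) (?a (n h)) s c) \<longleftrightarrow>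
      (\<forall>c>0. \<forall>\<^sub>F h in sequentially. ennreal (c powr - q) < (SUP s\<in>{0..<1}. ?w (?a (n h)) s + ?S (n h) (?a (n h)) s))"
  proof (intro iffI allI impI)
    fix c :: real assume c: "0 < c"
    assume "\<forall>c>0. \<forall>\<^sub>F h in sequentially. \<exists>s\<in>{0..<1}. \<rho> (?a (n h)) s < c \<or> \<not> cost_ge (n h) (?a (n h)) s c"
    then have "\<forall>\<^sub>F h in sequentially. \<exists>s\<in>{0..<1}. \<rho> (?a (n h)) s < c \<or> \<not> cost_ge (n h) (?a (n h)) s c"
      using c by blast
    then show "\<forall>\<^sub>F h in sequentially. ennreal (c powr - q) < (SUP s\<in>{0..<1}. ?w (?a (n h)) s + ?S (n h) (?a (n h)) s)"
    proof (rule eventually_mono)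
      fix h assume "\<exists>s\<in>{0..<1}. \<rho> (?a (n h)) s < c \<or> \<not> cost_ge (n h) (?a (n h)) s c"
      then obtain s where s: "s \<in> {0..<1}" "\<rho> (?a (n h)) s < c \<or> \<not> cost_ge (n h) (?a (n h)) s c" by blast
      then have "ennreal (c powr - q) < ?w (?a (n h)) s \<or> ennreal (c powr - q) < ?S (n h) (?a (n h)) s"
        using w_less[OF funpow_par_in[OF i] s(1) c] S_less by blast
      then have "ennreal (c powr - q) < ?w (?a (n h)) s + ?S (n h) (?a (n h)) s"
        by (auto intro: less_le_trans)
      then show "ennreal (c powr - q) < (SUP s\<in>{0..<1}. ?w (?a (n h)) s + ?S (n h) (?a (n h)) s)"
        using s(1) unfolding less_SUP_iff by blast
    qed
  next
    fix c :: real assume c: "0 < c"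
    assume *: "\<forall>c>0. \<forall>\<^sub>F h in sequentially. ennreal (c powr - q) < (SUP s\<in>{0..<1}. ?w (?a (n h)) s + ?S (n h) (?a (n h)) s)"
    define c' where "c' = c * 2 powr (- 1 / q)"
    have "c' powr - q = c powr - q + c powr - q"
      using c q by (simp add: c'_def powr_mult powr_powr)
    then have "ennreal (c' powr - q) = ennreal (c powr - q + c powr - q)"
      by (simp only:)
    also have "\<dots> = ennreal (c powr - q) + ennreal (c powr - q)"
      by (rule ennreal_plus) simp_all
    finally have c': "0 < c'" "ennreal (c' powr - q) = ennreal (c powr - q) + ennreal (c powr - q)"
      using c by (simp_all add: c'_def)
    from * c'(1) have "\<forall>\<^sub>F h in sequentially. ennreal (c' powr - q) < (SUP s\<in>{0..<1}. ?w (?a (n h)) s + ?S (n h) (?a (n h)) s)"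
      by blast
    then show "\<forall>\<^sub>F h in sequentially. \<exists>s\<in>{0..<1}. \<rho> (?a (n h)) s < c \<or> \<not> cost_ge (n h) (?a (n h)) s c"
    proof (rule eventually_mono)
      fix h assume "ennreal (c' powr - q) < (SUP s\<in>{0..<1}. ?w (?a (n h)) s + ?S (n h) (?a (n h)) s)"
      then obtain s where s: "s \<in> {0..<1}"
        "ennreal (c powr - q) + ennreal (c powr - q) < ?w (?a (n h)) s + ?S (n h) (?a (n h)) s"
        unfolding less_SUP_iff c'(2) by blast
      have "ennreal (c powr - q) < ?w (?a (n h)) s \<or> ennreal (c powr - q) < ?S (n h) (?a (n h)) s"
      proof (rule ccontr)
        assume "\<not> ?thesis"
        then have "?w (?a (n h)) s + ?S (n h) (?a (n h)) s \<le> ennreal (c powr - q) + ennreal (c powr - q)"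
          by (intro add_mono) (simp_all only: not_less de_Morgan_disj)
        from leD[OF this] s(2) show False by (rule notE)
      qed
      then show "\<exists>s\<in>{0..<1}. \<rho> (?a (n h)) s < c \<or> \<not> cost_ge (n h) (?a (n h)) s c"
        using w_less[OF funpow_par_in[OF i] s(1) c] S_less s(1) by blast
    qed
  qed
  have "(\<forall>c>0. \<forall>\<^sub>F h in sequentially. cheap (n h) i c) \<longleftrightarrow>
      (\<forall>c>0. \<forall>\<^sub>F h in sequentially. \<exists>s\<in>{0..<1}. \<not> cost_ge (n h) i s c) \<and>
      (\<forall>c>0. \<forall>\<^sub>F h in sequentially. \<exists>s\<in>{0..<1}. \<rho> (?a (n h)) s < c \<or> \<not> cost_ge (n h) (?a (n h)) s c)"
    unfolding cheap_def eventually_conj_iff by blast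
  then show ?thesis
    unfolding 1 2 ancestor_eq[OF i] tendsto_top_iff_powr[OF q, symmetric] unfolding q_def .
qed

end

section \<open>Hypercyclic translation semigroups\<close>

theorem theorem3p3:
  fixes V :: "'v set" and E :: "('v \<times> 'v) set"
    and I :: "'i set" and e :: "'i \<Rightarrow> 'v \<times> 'v"
  assumes "directed_tree V E" and "unrooted V E" and "leafless V E"
    and "bij_betw e I E"
  shows
    "(\<forall>\<rho>. admissible I e 1 \<rho> \<longrightarrow>
        (let X = (Lp_topology I \<rho> 1
                    :: ('i, 'k::{real_normed_field, euclidean_space}) edge_fun set topology);
             T = translation_semigroup I e \<rho> 1 in
          (hypercyclic X T \<longleftrightarrow> weakly_mixing X T) \<and>
          (weakly_mixing X T \<longleftrightarrow>
             (\<exists>n :: nat \<Rightarrow> nat. strict_mono n \<and>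
                (\<forall>i\<in>I.
                   (\<lambda>h. INF s\<in>{0..<1}. INF j\<in>descendants I e (n h) i. ennreal (\<rho> j s))
                     \<longlonglongrightarrow> 0 \<and>
                   (\<lambda>h. INF s\<in>{0..<1}.
                      min (ennreal (\<rho> (ancestor I e (n h) i) s))
                        (INF j\<in>descendants I e (n h) (ancestor I e (n h) i). ennreal (\<rho> j s)))
                     \<longlonglongrightarrow> 0)))))
     \<and>
     (\<forall>p \<rho>. 1 < p \<and> admissible I e p \<rho> \<longrightarrow>
        (let X = (Lp_topology I \<rho> p :: ('i, 'k) edge_fun set topology);
             T = translation_semigroup I e \<rho> p in
          (hypercyclic X T \<longleftrightarrow> weakly_mixing X T) \<and>
          (weakly_mixing X T \<longleftrightarrow>
             (\<exists>n :: nat \<Rightarrow> nat. strict_mono n \<and>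
                (\<forall>i\<in>I.
                   (\<lambda>h. SUP s\<in>{0..<1}.
                      \<Sum>\<^sub>\<infinity>j\<in>descendants I e (n h) i. ennreal (1 / \<rho> j s powr (1 / (p - 1))))
                     \<longlonglongrightarrow> \<infinity> \<and>
                   (\<lambda>h. SUP s\<in>{0..<1}.
                      ennreal (1 / \<rho> (ancestor I e (n h) i) s powr (1 / (p - 1))) +
                      (\<Sum>\<^sub>\<infinity>j\<in>descendants I e (n h) (ancestor I e (n h) i).
                         ennreal (1 / \<rho> j s powr (1 / (p - 1)))))
                     \<longlonglongrightarrow> \<infinity>)))))"
proof (intro conjI allI impI)
  obtain par where "edge_tree I e par"
    using edge_tree_exists[OF assms] .
  then interpret edge_tree I e par .
  fix \<rho> :: "('i, real) edge_fun"
  assume "admissible I e 1 \<rho>"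
  then obtain K where "weighted_tree I e par 1 \<rho> K"
    by (rule weighted_tree_exists)
  then interpret weighted_tree I e par 1 \<rho> K .
  let ?X = "Lp_topology I \<rho> 1 :: ('i, 'k) edge_fun set topology"
  show "let X = ?X; T = translation_semigroup I e \<rho> 1 in
      (hypercyclic X T \<longleftrightarrow> weakly_mixing X T) \<and>
      (weakly_mixing X T \<longleftrightarrow>
         (\<exists>n :: nat \<Rightarrow> nat. strict_mono n \<and>
            (\<forall>i\<in>I.
               (\<lambda>h. INF s\<in>{0..<1}. INF j\<in>descendants I e (n h) i. ennreal (\<rho> j s))
                 \<longlonglongrightarrow> 0 \<and>
               (\<lambda>h. INF s\<in>{0..<1}.
                  min (ennreal (\<rho> (ancestor I e (n h) i) s))
                    (INF j\<in>descendants I e (n h) (ancestor I e (n h) i). ennreal (\<rho> j s)))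
                 \<longlonglongrightarrow> 0)))"
    unfolding Let_def hypercyclic_iff_cheap_returns weakly_mixing_iff_cheap_returns
      cheap_returns_iff_sequence
    using cheap_sequence_iff_1[OF refl] by (simp cong: ball_cong)
next
  obtain par where "edge_tree I e par"
    using edge_tree_exists[OF assms] .
  then interpret edge_tree I e par .
  fix p :: real and \<rho> :: "('i, real) edge_fun"
  assume p: "1 < p \<and> admissible I e p \<rho>"
  then obtain K where "weighted_tree I e par p \<rho> K"
    using weighted_tree_exists by blast
  then interpret weighted_tree I e par p \<rho> K .
  let ?X = "Lp_topology I \<rho> p :: ('i, 'k) edge_fun set topology"
  show "let X = ?X; T = translation_semigroup I e \<rho> p in
      (hypercyclic X T \<longleftrightarrow> weakly_mixing X T) \<and>
      (weakly_mixing X T \<longleftrightarrow>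
         (\<exists>n :: nat \<Rightarrow> nat. strict_mono n \<and>
            (\<forall>i\<in>I.
               (\<lambda>h. SUP s\<in>{0..<1}.
                  \<Sum>\<^sub>\<infinity>j\<in>descendants I e (n h) i. ennreal (1 / \<rho> j s powr (1 / (p - 1))))
                 \<longlonglongrightarrow> \<infinity> \<and>
               (\<lambda>h. SUP s\<in>{0..<1}.
                  ennreal (1 / \<rho> (ancestor I e (n h) i) s powr (1 / (p - 1))) +
                  (\<Sum>\<^sub>\<infinity>j\<in>descendants I e (n h) (ancestor I e (n h) i).
                     ennreal (1 / \<rho> j s powr (1 / (p - 1)))))
                 \<longlonglongrightarrow> \<infinity>)))"
    unfolding Let_def hypercyclic_iff_cheap_returns weakly_mixing_iff_cheap_returns
      cheap_returns_iff_sequence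
    using cheap_sequence_iff[OF conjunct1[OF p]] by (simp cong: ball_cong)
qed

end
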